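(* There exist a sequence of positive integers $(d_n)_{n\in\mathbb N}$ and sequences of matrices $A_n,B_n\in\mathbb M_{d_n}(\mathbb C)$ such that (a) $\|A_n\|\leq 1$ and $\|B_n\|\leq 1$ for every $n\in\mathbb N$; (b) $\lim_{n\to\infty}\|A_nB_n-B_nA_n\|_2=\lim_{n\to\infty}\|A_nB_n^*-B_n^*A_n\|_2=0$; and (c) for any sequences of matrices $A_n',B_n'\in\mathbb M_{d_n}(\mathbb C)$ such that $A_n'B_n'=B_n'A_n'$ and $A_n'B_n'^*=B_n'^*A_n'$ for every $n\in\mathbb N$, one has $\inf_{n\in\mathbb N}\big(\|A_n-A_n'\|_2+\|B_n-B_n'\|_2\big)>0$.
   Context: For $A=(a_{i,j})_{i,j=1}^d\in\mathbb M_d(\mathbb C)$, $\|A\|$ denotes the operator norm and $\|A\|_2=\big(\frac1d\sum_{i,j=1}^d|a_{i,j}|^2\big)^{1/2}$ the normalized Hilbert–Schmidt norm; $A^*$ is the adjoint (conjugate transpose). *)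

theory Defs
  imports Complex_Main "Jordan_Normal_Form.Matrix"
begin

definition vec_norm :: "complex vec \<Rightarrow> real" where
  "vec_norm x = sqrt (\<Sum>i<dim_vec x. (cmod (x $ i))^2)"

definition op_norm :: "complex mat \<Rightarrow> real" where
  "op_norm A = Sup {vec_norm (A *\<^sub>v x) | x. x \<in> carrier_vec (dim_col A) \<and> vec_norm x \<le> 1}"

definition hs_norm :: "complex mat \<Rightarrow> real" where
  "hs_norm A = sqrt ((1 / real (dim_row A)) *
      (\<Sum>i<dim_row A. \<Sum>j<dim_col A. (cmod (A $$ (i, j)))^2))"

definition adj :: "complex mat \<Rightarrow> complex mat" where
  "adj A = mat (dim_col A) (dim_row A) (\<lambda>(i, j). cnj (A $$ (j, i)))"

end

theory Submission
  imports Defs "HOL-Analysis.Convex" "HOL-Analysis.Elementary_Metric_Spaces"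
begin

text \<open>
  Let \<open>\<sigma>\<^sub>i\<close>, \<open>\<tau>\<^sub>i\<close> be the first and third Pauli matrices at the \<open>i\<close>-th of \<open>N\<close> spins. The controlled
  spins \<open>U = \<Sum>\<^sub>i e\<^sub>i\<^sub>i \<otimes> 1 \<otimes> \<sigma>\<^sub>i\<close> and \<open>V = \<Sum>\<^sub>j 1 \<otimes> e\<^sub>j\<^sub>j \<otimes> \<tau>\<^sub>j\<close> on \<open>\<complex>\<^sup>N \<otimes> \<complex>\<^sup>N \<otimes> (\<complex>\<^sup>2)\<^bsup>\<otimes>N\<^esup>\<close> almost commute, because
  \<open>\<sigma>\<^sub>i\<close> and \<open>\<tau>\<^sub>j\<close> commute unless \<open>i = j\<close>. Let \<open>A\<close> encode \<open>U\<close> together with three unitaries (shift, quadratic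
  phase, Fourier transform) on the first factor \<open>\<complex>\<^sup>N\<close>, and let \<open>B\<close> encode \<open>V\<close> and the same unitaries on
  the second factor. Conjugation by these unitaries acts on Weyl coefficients by phases, a shear and a
  rotation of the torus \<open>(\<int>/N)\<^sup>2\<close>, so a ping-pong argument gives a spectral gap independent of \<open>N\<close>.
  Hence whatever almost commutes with \<open>A\<close> and its adjoint almost commutes with \<open>\<sigma>\<^sub>i\<close> on average over
  \<open>i\<close>, and likewise for \<open>B\<close> and \<open>\<tau>\<^sub>i\<close>.

  Suppose \<open>A'\<close> commutes with \<open>B'\<close> and its adjoint, both being close to \<open>A\<close>, \<open>B\<close>. Unitaries commuting
  with \<open>A'\<close> and its adjoint almost commute with \<open>A\<close>, hence with most \<open>\<sigma>\<^sub>i\<close>. Averaging \<open>\<sigma>\<^sub>i\<close> over this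
  unitary group yields \<open>p\<^sub>i\<close> in its commutant, close to \<open>\<sigma>\<^sub>i\<close> for most \<open>i\<close>; averaging \<open>\<tau>\<^sub>i\<close> over the unitaries
  of that commutant yields \<open>q\<^sub>i\<close> close to \<open>\<tau>\<^sub>i\<close> and commuting with \<open>p\<^sub>i\<close>. As \<open>\<sigma>\<^sub>i\<close> and \<open>\<tau>\<^sub>i\<close> anticommute,
  this is impossible.
\<close>

section \<open>Finitely supported matrices\<close>

text \<open>The final lower bound must not depend on the dimension, so everything rests on estimates
  that do not decay with \<open>N\<close>. The commutator of \<open>A\<close> and \<open>B\<close>
  lives only where the two control coordinates agree, a proportion of order 1/\<open>N\<close> of
  the basis, whereas the separation argument needs the spins only on average over the sites. This
  contrast is why the spins are controlled by an extra coordinate.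

  One matrix \<open>A\<close> has to carry four operators. It is a 4 by 4 block matrix whose real
  part has the distinct eigenvalues 0, 1, 2, 3 (up to scaling), so that whatever almost commutes
  with it is almost block diagonal, and whose imaginary part has the operators as blocks.
  Controlling the commutators with both \<open>A\<close> and its adjoint separates the two parts.

  The passage between commuting matrices and unitary groups goes through the Cayley transform: a
  self-adjoint matrix and its Cayley transform commute with the same matrices. This is what lets the
  unitaries of a commutant stand for the commutant itself, and what makes \<open>p\<close> and
  \<open>q\<close> commute.\<close>

typedef 'i fmat = "{f :: 'i \<Rightarrow> 'i \<Rightarrow> complex. \<exists>S. finite S \<and> (\<forall>x y. f x y \<noteq> 0 \<longrightarrow> x \<in> S \<and> y \<in> S)}"
  morphisms ent Abs_fmat
  by (rule exI[of _ "\<lambda>_ _. 0"]) auto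

setup_lifting type_definition_fmat

lemma fmat_eqI: "(\<And>x y. ent A x y = ent B x y) \<Longrightarrow> A = B"
  by (metis ent_inject ext)

text \<open>All dimensions and block structures share one type, whose index set may be infinite; the
  finite set \<open>S\<close> plays the role of the dimension. The type has no identity, and
  \<open>idm S\<close> below is the unit for matrices supported on \<open>S\<close>.\<close>

definition supported :: "'i set \<Rightarrow> 'i fmat \<Rightarrow> bool" where
  "supported S A \<longleftrightarrow> finite S \<and> (\<forall>x y. ent A x y \<noteq> 0 \<longrightarrow> x \<in> S \<and> y \<in> S)"

lemma supported_finite: "supported S A \<Longrightarrow> finite S"
  by (simp add: supported_def)

lemma ent_outside: "supported S A \<Longrightarrow> x \<notin> S \<or> y \<notin> S \<Longrightarrow> ent A x y = 0"
  by (auto simp: supported_def)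

lemma ex_supported: "\<exists>S. supported S A"
  using ent[of A] by (auto simp: supported_def)

lemma ex_supported3: "\<exists>S. supported S A \<and> supported S B \<and> supported S C"
proof -
  obtain S T U where "supported S A" "supported T B" "supported U C"
    using ex_supported by meson
  then have "supported (S \<union> T \<union> U) A \<and> supported (S \<union> T \<union> U) B \<and> supported (S \<union> T \<union> U) C"
    by (auto simp: supported_def)
  then show ?thesis by blast
qed

lift_definition mk :: "'i set \<Rightarrow> ('i \<Rightarrow> 'i \<Rightarrow> complex) \<Rightarrow> 'i fmat" is
  "\<lambda>S f x y. if finite S \<and> x \<in> S \<and> y \<in> S then f x y else 0"
  by (rename_tac S f, rule_tac x = "if finite S then S else {}" in exI) auto

lemma ent_mk: "finite S \<Longrightarrow> ent (mk S f) x y = (if x \<in> S \<and> y \<in> S then f x y else 0)"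
  by transfer auto

lemma supported_mk: "finite S \<Longrightarrow> supported S (mk S f)"
  by (auto simp: supported_def ent_mk)

lemma supported_eqI:
  "supported S A \<Longrightarrow> supported S B \<Longrightarrow> (\<And>x y. x \<in> S \<Longrightarrow> y \<in> S \<Longrightarrow> ent A x y = ent B x y) \<Longrightarrow> A = B"
  by (rule fmat_eqI) (metis ent_outside)

instantiation fmat :: (type) ab_group_add
begin

lift_definition zero_fmat :: "'a fmat" is "\<lambda>_ _. 0" by auto

lift_definition plus_fmat :: "'a fmat \<Rightarrow> 'a fmat \<Rightarrow> 'a fmat" is "\<lambda>f g x y. f x y + g x y"
proof -
  fix f g :: "'a \<Rightarrow> 'a \<Rightarrow> complex"
  assume "\<exists>S. finite S \<and> (\<forall>x y. f x y \<noteq> 0 \<longrightarrow> x \<in> S \<and> y \<in> S)"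
    and "\<exists>S. finite S \<and> (\<forall>x y. g x y \<noteq> 0 \<longrightarrow> x \<in> S \<and> y \<in> S)"
  then obtain S T where S: "finite S" "\<And>x y. f x y \<noteq> 0 \<Longrightarrow> x \<in> S \<and> y \<in> S"
    and T: "finite T" "\<And>x y. g x y \<noteq> 0 \<Longrightarrow> x \<in> T \<and> y \<in> T"
    by (elim exE conjE) simp
  have "x \<in> S \<union> T \<and> y \<in> S \<union> T" if "f x y + g x y \<noteq> 0" for x y
    using that S(2)[of x y] T(2)[of x y] by (cases "f x y = 0") auto
  with S(1) T(1) show "\<exists>S. finite S \<and> (\<forall>x y. f x y + g x y \<noteq> 0 \<longrightarrow> x \<in> S \<and> y \<in> S)"
    by (intro exI[of _ "S \<union> T"]) simp
qed

lift_definition uminus_fmat :: "'a fmat \<Rightarrow> 'a fmat" is "\<lambda>f x y. - f x y" by auto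

definition minus_fmat :: "'a fmat \<Rightarrow> 'a fmat \<Rightarrow> 'a fmat" where "minus_fmat A B = A + - B"

instance
  by standard (transfer; auto simp: minus_fmat_def fun_eq_iff; fail | simp add: minus_fmat_def)+

end

lemma ent_simps [simp]:
  "ent 0 x y = 0" "ent (A + B) x y = ent A x y + ent B x y" "ent (- A) x y = - ent A x y"
  "ent (A - B) x y = ent A x y - ent B x y"
  unfolding minus_fmat_def by (transfer; simp)+

instantiation fmat :: (type) ring
begin

text \<open>The sum runs over the nonzero entries of a row, always a finite set, so the product
  refers to no chosen support; \<open>ent_times\<close> and \<open>ent_times'\<close> then allow any
  support of either factor.\<close>

lift_definition times_fmat :: "'a fmat \<Rightarrow> 'a fmat \<Rightarrow> 'a fmat" is
  "\<lambda>f g x y. \<Sum>z | f x z \<noteq> 0. f x z * g z y"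
proof -
  fix f g :: "'a \<Rightarrow> 'a \<Rightarrow> complex"
  assume "\<exists>S. finite S \<and> (\<forall>x y. f x y \<noteq> 0 \<longrightarrow> x \<in> S \<and> y \<in> S)"
    and "\<exists>S. finite S \<and> (\<forall>x y. g x y \<noteq> 0 \<longrightarrow> x \<in> S \<and> y \<in> S)"
  then obtain S T where S: "finite S" "\<And>x y. f x y \<noteq> 0 \<Longrightarrow> x \<in> S \<and> y \<in> S"
    and T: "finite T" "\<And>x y. g x y \<noteq> 0 \<Longrightarrow> x \<in> T \<and> y \<in> T"
    by (elim exE conjE) simp
  have "x \<in> S \<union> T \<and> y \<in> S \<union> T" if ne: "(\<Sum>z | f x z \<noteq> 0. f x z * g z y) \<noteq> 0" for x y
  proof -
    obtain z where "f x z \<noteq> 0" "g z y \<noteq> 0"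
      using sum.not_neutral_contains_not_neutral[OF ne] by auto
    then show ?thesis using S(2)[of x z] T(2)[of z y] by simp
  qed
  with S(1) T(1) show "\<exists>S. finite S \<and> (\<forall>x y. (\<Sum>z | f x z \<noteq> 0. f x z * g z y) \<noteq> 0 \<longrightarrow> x \<in> S \<and> y \<in> S)"
    by (intro exI[of _ "S \<union> T"]) simp
qed

lemma ent_times: "supported S A \<Longrightarrow> ent (A * B) x y = (\<Sum>z\<in>S. ent A x z * ent B z y)"
proof -
  assume "supported S A"
  then have "finite S" "{z. ent A x z \<noteq> 0} \<subseteq> S" by (auto simp: supported_def)
  then show ?thesis
    by (auto simp: times_fmat.rep_eq intro!: sum.mono_neutral_left)
qed

lemma ent_times': "supported S B \<Longrightarrow> ent (A * B) x y = (\<Sum>z\<in>S. ent A x z * ent B z y)"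
proof -
  assume "supported S B"
  obtain T where T: "supported T A" using ex_supported by blast
  have "finite S" "finite T" using T \<open>supported S B\<close> by (auto simp: supported_def)
  have "ent (A * B) x y = (\<Sum>z\<in>S \<union> T. ent A x z * ent B z y)"
    using T \<open>finite S\<close> \<open>finite T\<close> by (intro ent_times) (auto simp: supported_def)
  also have "\<dots> = (\<Sum>z\<in>S. ent A x z * ent B z y)"
    using \<open>finite S\<close> \<open>finite T\<close> \<open>supported S B\<close>
    by (intro sum.mono_neutral_right) (auto simp: supported_def)
  finally show ?thesis .
qed

instance
proof
  fix A B C :: "'a fmat"
  obtain S where S: "supported S A" "supported S B" "supported S C" using ex_supported3 by blast
  have AB: "supported S (A + B)"
    using S unfolding supported_def by (metis add.right_neutral ent_simps(2))
  show "A * B * C = A * (B * C)"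
  proof (rule fmat_eqI)
    fix x y
    have "ent (A * B * C) x y = (\<Sum>z\<in>S. \<Sum>w\<in>S. ent A x w * ent B w z * ent C z y)"
      using S by (simp add: ent_times'[of S C] ent_times[of S A] sum_distrib_right)
    also have "\<dots> = (\<Sum>w\<in>S. \<Sum>z\<in>S. ent A x w * ent B w z * ent C z y)"
      by (rule sum.swap)
    also have "\<dots> = ent (A * (B * C)) x y"
      using S by (simp add: ent_times[of S A] ent_times[of S B] sum_distrib_left mult.assoc)
    finally show "ent (A * B * C) x y = ent (A * (B * C)) x y" .
  qed
  show "(A + B) * C = A * C + B * C"
    using S AB by (intro fmat_eqI) (simp add: ent_times[of S] distrib_right sum.distrib)
  show "A * (B + C) = A * B + A * C"
    using S by (intro fmat_eqI) (simp add: ent_times[of S A] distrib_left sum.distrib)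
qed

end

instantiation fmat :: (type) real_inner
begin

lift_definition scaleR_fmat :: "real \<Rightarrow> 'a fmat \<Rightarrow> 'a fmat" is "\<lambda>r f x y. r *\<^sub>R f x y" by auto

text \<open>The real part of the trace inner product. Its norm is the Hilbert-Schmidt norm without
  the factor 1/d, which enters only in \<open>hs_norm_to_mat\<close>.\<close>

definition inner_fmat :: "'a fmat \<Rightarrow> 'a fmat \<Rightarrow> real" where
  "inner_fmat A B = (\<Sum>(x, y) | ent A x y \<noteq> 0. inner (ent A x y) (ent B x y))"

definition norm_fmat :: "'a fmat \<Rightarrow> real" where "norm_fmat A = sqrt (inner A A)"
definition dist_fmat :: "'a fmat \<Rightarrow> 'a fmat \<Rightarrow> real" where "dist_fmat A B = norm (A - B)"
definition sgn_fmat :: "'a fmat \<Rightarrow> 'a fmat" where "sgn_fmat A = inverse (norm A) *\<^sub>R A"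
definition uniformity_fmat :: "('a fmat \<times> 'a fmat) filter" where
  "uniformity_fmat = (INF e\<in>{0<..}. principal {(x, y). dist x y < e})"
definition open_fmat :: "'a fmat set \<Rightarrow> bool" where
  "open_fmat U \<longleftrightarrow> (\<forall>x\<in>U. eventually (\<lambda>(x', y). x' = x \<longrightarrow> y \<in> U) uniformity)"

lemma ent_scaleR [simp]: "ent (r *\<^sub>R A) x y = r *\<^sub>R ent A x y"
  by transfer simp

lemma inner_fmat_eq: "supported S A \<Longrightarrow> inner A B = (\<Sum>x\<in>S. \<Sum>y\<in>S. inner (ent A x y) (ent B x y))"
proof -
  assume S: "supported S A"
  then have "inner A B = (\<Sum>(x, y)\<in>S \<times> S. inner (ent A x y) (ent B x y))"
    unfolding inner_fmat_def by (intro sum.mono_neutral_left) (auto simp: supported_def)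
  then show ?thesis by (simp add: sum.cartesian_product)
qed

instance
proof
  fix A B C :: "'a fmat" and r s :: real
  obtain S where S: "supported S A" "supported S B" "supported S C" using ex_supported3 by blast
  have AB: "supported S (A + B)" "supported S (r *\<^sub>R A)"
    using S unfolding supported_def by (metis add.right_neutral ent_simps(2), metis ent_scaleR scaleR_zero_right)
  show "r *\<^sub>R (A + B) = r *\<^sub>R A + r *\<^sub>R B" "(r + s) *\<^sub>R A = r *\<^sub>R A + s *\<^sub>R A"
    "r *\<^sub>R s *\<^sub>R A = (r * s) *\<^sub>R A" "1 *\<^sub>R A = A"
    by (rule fmat_eqI; simp add: algebra_simps)+
  show "dist A B = norm (A - B)" "sgn A = inverse (norm A) *\<^sub>R A" "norm A = sqrt (inner A A)"
    "uniformity = (INF e\<in>{0<..}. principal {(x, y). dist (x::'a fmat) y < e})"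
    by (simp_all add: dist_fmat_def sgn_fmat_def norm_fmat_def uniformity_fmat_def)
  show "open U \<longleftrightarrow> (\<forall>x\<in>U. \<forall>\<^sub>F (x', y) in uniformity. x' = x \<longrightarrow> y \<in> U)" for U :: "'a fmat set"
    by (simp add: open_fmat_def)
  show "inner A B = inner B A" using S by (simp add: inner_fmat_eq[of S] inner_commute)
  show "inner (A + B) C = inner A C + inner B C"
    using S AB by (simp add: inner_fmat_eq[of S] inner_add_left sum.distrib)
  show "inner (r *\<^sub>R A) B = r * inner A B"
    using S AB by (simp add: inner_fmat_eq[of S] sum_distrib_left)
  show "0 \<le> inner A A" using S by (simp add: inner_fmat_eq[of S] sum_nonneg)
  show "inner A A = 0 \<longleftrightarrow> A = 0"
  proof
    assume "inner A A = 0"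
    then have "(\<Sum>x\<in>S. \<Sum>y\<in>S. inner (ent A x y) (ent A x y)) = 0"
      using S by (simp add: inner_fmat_eq[of S])
    then have "\<forall>x\<in>S. \<forall>y\<in>S. inner (ent A x y) (ent A x y) = 0"
      using supported_finite[OF S(1)] by (simp add: sum_nonneg_eq_0_iff sum_nonneg)
    then show "A = 0" using ent_outside[OF S(1)] by (intro fmat_eqI) fastforce
  qed (use S in \<open>simp add: inner_fmat_eq[of S]\<close>)
qed

end

lemma norm_fmat_sq: "supported S A \<Longrightarrow> (norm A)\<^sup>2 = (\<Sum>x\<in>S. \<Sum>y\<in>S. (cmod (ent A x y))\<^sup>2)"
  by (simp add: power2_norm_eq_inner inner_fmat_eq)

instance fmat :: (type) real_normed_algebra
proof
  fix A B :: "'a fmat" and r :: real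
  obtain S where S: "supported S A" "supported S B" using ex_supported3 by blast
  have rA: "supported S (r *\<^sub>R A)" using S unfolding supported_def by (metis ent_scaleR scaleR_zero_right)
  show "r *\<^sub>R A * B = r *\<^sub>R (A * B)"
    using S rA by (intro fmat_eqI) (simp add: ent_times[of S] scaleR_sum_right)
  show "A * r *\<^sub>R B = r *\<^sub>R (A * B)"
    using S rA by (intro fmat_eqI) (simp add: ent_times[of S] scaleR_sum_right)
  have AB: "supported S (A * B)"
    using S unfolding supported_def
    by (metis (no_types, lifting) S(1) ent_times[OF S(1)] mult_eq_0_iff sum.neutral)
  have "(norm (A * B))\<^sup>2 \<le> (norm A * norm B)\<^sup>2"
  proof -
    have "(norm (A * B))\<^sup>2 = (\<Sum>x\<in>S. \<Sum>y\<in>S. (cmod (\<Sum>z\<in>S. ent A x z * ent B z y))\<^sup>2)"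
      using S AB by (simp add: norm_fmat_sq ent_times)
    also have "\<dots> \<le> (\<Sum>x\<in>S. \<Sum>y\<in>S. (\<Sum>z\<in>S. (cmod (ent A x z))\<^sup>2) * (\<Sum>z\<in>S. (cmod (ent B z y))\<^sup>2))"
    proof (intro sum_mono)
      fix x y
      have "(cmod (\<Sum>z\<in>S. ent A x z * ent B z y))\<^sup>2 \<le> (\<Sum>z\<in>S. cmod (ent A x z) * cmod (ent B z y))\<^sup>2"
        by (intro power_mono) (auto intro: order_trans[OF norm_sum] simp: norm_mult)
      also have "\<dots> \<le> (\<Sum>z\<in>S. (cmod (ent A x z))\<^sup>2) * (\<Sum>z\<in>S. (cmod (ent B z y))\<^sup>2)"
        by (rule Cauchy_Schwarz_ineq_sum)
      finally show "(cmod (\<Sum>z\<in>S. ent A x z * ent B z y))\<^sup>2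
        \<le> (\<Sum>z\<in>S. (cmod (ent A x z))\<^sup>2) * (\<Sum>z\<in>S. (cmod (ent B z y))\<^sup>2)" .
    qed
    also have "\<dots> = (\<Sum>x\<in>S. \<Sum>z\<in>S. (cmod (ent A x z))\<^sup>2) * (\<Sum>y\<in>S. \<Sum>z\<in>S. (cmod (ent B z y))\<^sup>2)"
      by (rule sum_product[symmetric])
    also have "\<dots> = (norm A * norm B)\<^sup>2"
      using S by (subst sum.swap[of "\<lambda>y z. (cmod (ent B z y))\<^sup>2"]) (simp add: norm_fmat_sq power_mult_distrib)
    finally show ?thesis .
  qed
  then show "norm (A * B) \<le> norm A * norm B" by (rule power2_le_imp_le) simp
qed

lemma supported_add: "supported S A \<Longrightarrow> supported S B \<Longrightarrow> supported S (A + B)"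
  unfolding supported_def by (metis add.right_neutral ent_simps(2))

lemma supported_uminus: "supported S A \<Longrightarrow> supported S (- A)"
  by (auto simp: supported_def)

lemma supported_diff: "supported S A \<Longrightarrow> supported S B \<Longrightarrow> supported S (A - B)"
  by (metis diff_conv_add_uminus supported_add supported_uminus)

lemma supported_scaleR: "supported S A \<Longrightarrow> supported S (r *\<^sub>R A)"
  unfolding supported_def by (metis ent_scaleR scaleR_zero_right)

lemma supported_times:
  assumes "supported S A" "supported S B" shows "supported S (A * B)"
proof -
  have "ent (A * B) x y = 0" if "x \<notin> S \<or> y \<notin> S" for x y
    using that assms by (auto simp: ent_times[OF assms(1)] ent_outside intro!: sum.neutral)
  then show ?thesis using assms by (auto simp: supported_def)
qed

section \<open>Adjoints, diagonal matrices and the unit on a support\<close>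

lift_definition star :: "'i fmat \<Rightarrow> 'i fmat" is "\<lambda>f x y. cnj (f y x)" by auto

lemma ent_star [simp]: "ent (star A) x y = cnj (ent A y x)"
  by transfer simp

lemma supported_star: "supported S A \<Longrightarrow> supported S (star A)"
  by (auto simp: supported_def)

lemmas supported_intros =
  supported_add supported_uminus supported_diff supported_scaleR supported_times supported_star

lemma star_simps [simp]:
  "star (star A) = A" "star 0 = 0" "star (A + B) = star A + star B" "star (A - B) = star A - star B"
  "star (- A) = - star A" "star (r *\<^sub>R A) = r *\<^sub>R star A"
  by (rule fmat_eqI; simp)+

lemma star_times [simp]: "star (A * B) = star B * star A"
proof -
  obtain S where S: "supported S A" "supported S B" using ex_supported3 by blast
  show ?thesis
    using S by (intro fmat_eqI) (simp add: ent_times[of S] supported_star mult.commute)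
qed

lemma norm_star [simp]: "norm (star A) = norm A"
proof -
  obtain S where S: "supported S A" using ex_supported by blast
  have "(norm (star A))\<^sup>2 = (norm A)\<^sup>2"
    unfolding norm_fmat_sq[OF S] norm_fmat_sq[OF supported_star[OF S]]
    by (subst sum.swap) simp
  then show ?thesis by simp
qed

lemma inner_times_left: "inner (A * B) C = inner B (star A * C)" for A B C :: "'i fmat"
proof -
  obtain S where S: "supported S A" "supported S B" "supported S C" using ex_supported3 by blast
  have [simp]: "inner (a * b) c = inner b (cnj a * c)" for a b c :: complex
    by (simp add: inner_complex_def algebra_simps)
  have "inner (A * B) C = (\<Sum>x\<in>S. \<Sum>y\<in>S. \<Sum>z\<in>S. inner (ent B z y) (cnj (ent A x z) * ent C x y))"
    using S by (simp add: inner_fmat_eq[of S] supported_times ent_times[of S] inner_sum_left)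
  also have "\<dots> = (\<Sum>x\<in>S. \<Sum>z\<in>S. \<Sum>y\<in>S. inner (ent B z y) (cnj (ent A x z) * ent C x y))"
    by (rule sum.cong[OF refl], rule sum.swap)
  also have "\<dots> = (\<Sum>z\<in>S. \<Sum>x\<in>S. \<Sum>y\<in>S. inner (ent B z y) (cnj (ent A x z) * ent C x y))"
    by (rule sum.swap)
  also have "\<dots> = (\<Sum>z\<in>S. \<Sum>y\<in>S. \<Sum>x\<in>S. inner (ent B z y) (cnj (ent A x z) * ent C x y))"
    by (rule sum.cong[OF refl], rule sum.swap)
  also have "\<dots> = inner B (star A * C)"
    using S by (simp add: inner_fmat_eq[of S] ent_times[of S] supported_star inner_sum_right)
  finally show ?thesis .
qed

definition dg :: "'i set \<Rightarrow> ('i \<Rightarrow> complex) \<Rightarrow> 'i fmat" where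
  "dg S f = mk S (\<lambda>x y. if x = y then f x else 0)"

lemma ent_dg: "finite S \<Longrightarrow> ent (dg S f) x y = (if x = y \<and> x \<in> S then f x else 0)"
  by (auto simp: dg_def ent_mk)

lemma supported_dg: "finite S \<Longrightarrow> supported S (dg S f)"
  by (simp add: dg_def supported_mk)

lemma ent_dg_times: "finite S \<Longrightarrow> ent (dg S f * A) x y = (if x \<in> S then f x * ent A x y else 0)"
  by (auto simp: ent_times[OF supported_dg] ent_dg if_distrib[of "\<lambda>u. u * _"] cong: if_cong)

lemma ent_times_dg: "finite S \<Longrightarrow> ent (A * dg S f) x y = (if y \<in> S then ent A x y * f y else 0)"
  by (auto simp: ent_times'[OF supported_dg] ent_dg if_distrib[of "\<lambda>u. _ * u"] cong: if_cong conj_cong)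

lemma star_dg: "finite S \<Longrightarrow> star (dg S f) = dg S (\<lambda>x. cnj (f x))"
  by (intro fmat_eqI) (auto simp: ent_dg)

abbreviation idm :: "'i set \<Rightarrow> 'i fmat" where "idm S \<equiv> dg S (\<lambda>_. 1)"

text \<open>Only real scalars act on \<open>fmat\<close>. Complex scalars enter through this matrix,
  central among those supported on \<open>S\<close>, with square \<open>- idm S\<close>.\<close>

abbreviation iim :: "'i set \<Rightarrow> 'i fmat" where "iim S \<equiv> dg S (\<lambda>_. \<i>)"

lemma idm_times [simp]: "supported S A \<Longrightarrow> idm S * A = A"
  by (intro fmat_eqI) (auto simp: ent_dg_times supported_finite ent_outside)

lemma times_idm [simp]: "supported S A \<Longrightarrow> A * idm S = A"
  by (intro fmat_eqI) (auto simp: ent_times_dg supported_finite ent_outside)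

lemma iim_commute: "supported S A \<Longrightarrow> A * iim S = iim S * A"
  by (intro fmat_eqI) (auto simp: ent_times_dg ent_dg_times supported_finite ent_outside)

lemma iim_sq: "finite S \<Longrightarrow> iim S * iim S = - idm S"
  by (intro fmat_eqI) (auto simp: ent_dg_times ent_dg)

lemma star_iim: "finite S \<Longrightarrow> star (iim S) = - iim S"
  by (intro fmat_eqI) (auto simp: ent_dg)

lemma norm_iim_times: "supported S A \<Longrightarrow> norm (iim S * A) = norm A"
proof -
  assume A: "supported S A"
  then have "(norm (iim S * A))\<^sup>2 = (norm A)\<^sup>2"
    by (simp add: norm_fmat_sq[of S] supported_times supported_dg ent_dg_times norm_mult supported_finite
        cong: sum.cong)
  then show ?thesis by simp
qed

lemma norm_idm: "finite S \<Longrightarrow> norm (idm S) = sqrt (card S)"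
proof -
  assume S: "finite S"
  have "(norm (idm S))\<^sup>2 = (sqrt (card S))\<^sup>2"
    using S by (simp add: norm_fmat_sq[of S] supported_dg ent_dg if_distrib[of cmod] if_distrib[of "\<lambda>u. u\<^sup>2"] cong: if_cong)
  then show ?thesis by (metis abs_norm_cancel abs_of_nonneg of_nat_0_le_iff power2_eq_iff_nonneg real_sqrt_ge_zero norm_ge_zero)
qed

lemma norm_ent_le: "cmod (ent A x y) \<le> norm A"
proof -
  obtain S where S: "supported S A" using ex_supported by blast
  show ?thesis
  proof (cases "x \<in> S \<and> y \<in> S")
    case True
    have "(cmod (ent A x y))\<^sup>2 \<le> (\<Sum>y\<in>S. (cmod (ent A x y))\<^sup>2)"
      using True supported_finite[OF S] by (intro member_le_sum) auto
    also have "\<dots> \<le> (norm A)\<^sup>2"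
      unfolding norm_fmat_sq[OF S] using True supported_finite[OF S]
      by (intro member_le_sum[of x S "\<lambda>x. \<Sum>y\<in>S. (cmod (ent A x y))\<^sup>2"]) (auto intro: sum_nonneg)
    finally show ?thesis by (rule power2_le_imp_le) simp
  qed (use ent_outside[OF S] in auto)
qed

text \<open>Entrywise limits exist by \<open>norm_ent_le\<close>. Over an infinite index type
  supports may grow along a Cauchy sequence; fixing a finite \<open>S\<close> makes Banach's fixed
  point theorem and minimizing sequences available.\<close>

lemma complete_supported:
  assumes "finite S" shows "complete {A. supported S A}"
  unfolding complete_def
proof safe
  fix f :: "nat \<Rightarrow> 'a fmat"
  assume f: "\<forall>n. f n \<in> Collect (supported S)" and C: "Cauchy f"
  have f': "supported S (f n)" for n using f by auto
  have "Cauchy (\<lambda>n. ent (f n) x y)" for x y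
    unfolding Cauchy_def dist_norm
    by (metis C Cauchy_def dist_norm ent_simps(4) norm_ent_le order_le_less_trans)
  then have lim: "(\<lambda>n. ent (f n) x y) \<longlonglongrightarrow> lim (\<lambda>n. ent (f n) x y)" for x y
    using Cauchy_convergent convergent_LIMSEQ_iff by blast
  define L where "L = mk S (\<lambda>x y. lim (\<lambda>n. ent (f n) x y))"
  have L: "supported S L" unfolding L_def using assms by (rule supported_mk)
  have "(\<lambda>n. \<Sum>x\<in>S. \<Sum>y\<in>S. (cmod (ent (f n - L) x y))\<^sup>2) \<longlonglongrightarrow> (\<Sum>x\<in>S. \<Sum>y\<in>S. (cmod 0)\<^sup>2)"
    using lim by (intro tendsto_sum tendsto_power tendsto_norm)
      (auto simp: L_def ent_mk assms LIM_zero_iff)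
  then have "(\<lambda>n. (norm (f n - L))\<^sup>2) \<longlonglongrightarrow> 0"
    using L f' by (simp add: norm_fmat_sq[of S] supported_intros)
  then have "(\<lambda>n. sqrt ((norm (f n - L))\<^sup>2)) \<longlonglongrightarrow> 0"
    using tendsto_real_sqrt by fastforce
  then have "f \<longlonglongrightarrow> L" by (simp add: LIM_zero_iff tendsto_norm_zero_iff)
  then show "\<exists>l\<in>Collect (supported S). f \<longlonglongrightarrow> l" using L by auto
qed

section \<open>Averaging over unitary groups\<close>

text \<open>Operator norm at most 1, tested by left multiplication on the Hilbert-Schmidt space; a
  vector corresponds to a matrix with one nonzero column.\<close>

definition contr :: "'i fmat \<Rightarrow> bool" where
  "contr A \<longleftrightarrow> (\<forall>Y. norm (A * Y) \<le> norm Y)"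

lemma contrD: "contr A \<Longrightarrow> norm (A * Y) \<le> norm Y"
  by (simp add: contr_def)

lemma norm_le_of_sq_le: "a\<^sup>2 \<le> b * a \<Longrightarrow> 0 \<le> b \<Longrightarrow> a \<le> b" for a b :: real
  by (metis mult_le_cancel_right not_less power2_eq_square le_cases order_trans)

lemma contr_star: "contr A \<Longrightarrow> contr (star A)"
proof -
  assume A: "contr A"
  have "norm (star A * Y) \<le> norm Y" for Y
  proof (rule norm_le_of_sq_le)
    have "(norm (star A * Y))\<^sup>2 = inner Y (A * (star A * Y))"
      by (simp add: power2_norm_eq_inner inner_times_left)
    also have "\<dots> \<le> norm Y * norm (A * (star A * Y))" by (rule norm_cauchy_schwarz)
    also have "\<dots> \<le> norm Y * norm (star A * Y)" by (intro mult_left_mono contrD A) simp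
    finally show "(norm (star A * Y))\<^sup>2 \<le> norm Y * norm (star A * Y)" .
  qed simp
  then show ?thesis by (simp add: contr_def)
qed

lemma contrD_right: "contr A \<Longrightarrow> norm (Y * A) \<le> norm Y"
  using contrD[OF contr_star, of A "star Y"] by (metis norm_star star_times)

lemma contr_times: "contr A \<Longrightarrow> contr B \<Longrightarrow> contr (A * B)"
  by (simp add: contr_def mult.assoc) (meson order_trans)

lemma contr_idm: "finite S \<Longrightarrow> contr (idm S)"
proof -
  assume S: "finite S"
  have "norm (idm S * Y) \<le> norm Y" for Y
  proof (rule norm_le_of_sq_le)
    have "(norm (idm S * Y))\<^sup>2 = inner Y (idm S * Y)"
      using S by (simp add: power2_norm_eq_inner inner_times_left star_dg supported_dg flip: mult.assoc)
    also have "\<dots> \<le> norm Y * norm (idm S * Y)" by (rule norm_cauchy_schwarz)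
    finally show "(norm (idm S * Y))\<^sup>2 \<le> norm Y * norm (idm S * Y)" .
  qed simp
  then show ?thesis by (simp add: contr_def)
qed

lemma contr_isometry: "finite S \<Longrightarrow> star A * A = idm S \<Longrightarrow> contr A"
proof -
  assume S: "finite S" and A: "star A * A = idm S"
  have "norm (A * Y) \<le> norm Y" for Y
  proof -
    have "(norm (A * Y))\<^sup>2 = inner Y (idm S * Y)"
      by (simp add: power2_norm_eq_inner inner_times_left A flip: mult.assoc)
    also have "\<dots> \<le> norm Y * norm (idm S * Y)" by (rule norm_cauchy_schwarz)
    also have "\<dots> \<le> norm Y * norm Y" by (intro mult_left_mono contrD contr_idm S) simp
    finally show ?thesis by (metis power2_eq_square power2_le_imp_le norm_ge_zero)
  qed
  then show ?thesis by (simp add: contr_def)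
qed

lemma norm_comm_le: "contr W \<Longrightarrow> norm (D * W - W * D) \<le> 2 * norm D"
  using norm_triangle_ineq4[of "D * W" "W * D"] contrD[of W D] contrD_right[of W D] by simp

section \<open>Unitaries and the Cayley transform\<close>

definition unitary :: "'i set \<Rightarrow> 'i fmat \<Rightarrow> bool" where
  "unitary S W \<longleftrightarrow> supported S W \<and> star W * W = idm S \<and> W * star W = idm S"

lemma unitary_contr: "unitary S W \<Longrightarrow> contr W"
  unfolding unitary_def using contr_isometry supported_finite by blast

lemma unitary_idm: "finite S \<Longrightarrow> unitary S (idm S)"
  by (simp add: unitary_def supported_dg star_dg)

lemma unitary_times: "unitary S V \<Longrightarrow> unitary S W \<Longrightarrow> unitary S (V * W)"
proof -
  assume V: "unitary S V" and W: "unitary S W"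
  have "star W * star V * (V * W) = star W * (star V * V) * W" "V * W * (star W * star V) = V * (W * star W) * star V"
    by (simp_all only: mult.assoc)
  then show ?thesis using V W by (simp add: unitary_def supported_intros)
qed

lemma norm_unitary_conj:
  assumes W: "unitary S W" and A: "supported S A"
  shows "norm (W * A * star W) = norm A"
proof (rule antisym)
  have c: "contr W" "contr (star W)" using unitary_contr[OF W] contr_star by auto
  show "norm (W * A * star W) \<le> norm A"
    by (meson c contrD contrD_right order_trans)
  have "A = star W * W * A * (star W * W)"
    using W A by (simp add: unitary_def)
  also have "\<dots> = star W * (W * A * star W) * W" by (simp only: mult.assoc)
  finally show "norm A \<le> norm (W * A * star W)"
    by (metis c contrD contrD_right order_trans)
qed

text \<open>Multiplying (K + i) Y = 1 by -i gives the fixed point equation Y = -i + i K Y, whose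
  right side contracts with factor 1/2.\<close>

lemma ex_right_inverse:
  assumes K: "supported S K" "norm K \<le> 1/2"
  shows "\<exists>R. supported S R \<and> (K + iim S) * R = idm S"
proof -
  have S: "finite S" using K supported_finite by blast
  note sI = supported_intros supported_dg[OF S] K
  let ?f = "\<lambda>Y. - iim S + iim S * (K * Y)"
  have "\<exists>!Y\<in>{Y. supported S Y}. ?f Y = Y"
  proof (rule Banach_fix)
    show "complete {Y. supported S Y}" by (rule complete_supported[OF S])
    show "{Y. supported S Y} \<noteq> {}" using supported_dg[OF S] by blast
    show "?f ` {Y. supported S Y} \<subseteq> {Y. supported S Y}" by (auto intro!: sI)
    fix Y Z assume YZ: "Y \<in> {Y. supported S Y}" "Z \<in> {Y. supported S Y}"
    have "?f Y - ?f Z = iim S * (K * (Y - Z))" by (simp add: algebra_simps)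
    then have "dist (?f Y) (?f Z) = norm (K * (Y - Z))"
      using YZ by (simp add: dist_norm norm_iim_times sI)
    also have "\<dots> \<le> norm K * norm (Y - Z)" by (rule norm_mult_ineq)
    also have "\<dots> \<le> 1/2 * norm (Y - Z)" by (intro mult_right_mono K) simp
    finally show "dist (?f Y) (?f Z) \<le> 1/2 * dist Y Z" by (simp add: dist_norm)
  qed auto
  then obtain Y where Y: "supported S Y" "?f Y = Y" by auto
  have "iim S * ?f Y = - (iim S * iim S) + iim S * iim S * (K * Y)"
    by (simp add: algebra_simps)
  also have "\<dots> = idm S - K * Y"
    using S Y(1) by (simp add: iim_sq sI)
  finally have "iim S * Y = idm S - K * Y" unfolding Y(2) .
  then show ?thesis using Y by (intro exI[of _ Y]) (simp add: distrib_right)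
qed

text \<open>The unitary is the Cayley transform (T - i) (T + i)^(-1) of a multiple \<open>T\<close>
  of \<open>K\<close>. It replaces commutation with a self-adjoint matrix by commutation with a
  member of a unitary group.\<close>

lemma ex_cayley:
  assumes K: "supported S K" "star K = K"
  shows "\<exists>W. unitary S W \<and> (\<forall>Y. supported S Y \<longrightarrow> (Y * W = W * Y \<longleftrightarrow> Y * K = K * Y))"
proof -
  have S: "finite S" using K supported_finite by blast
  \<comment> \<open>Scaling brings the norm of \<open>T\<close> down to 1/2, as
    \<open>ex_right_inverse\<close> demands, and leaves the commutant unchanged.\<close>
  define r where "r = 1 / (2 * (norm K + 1))"
  have r: "r > 0" by (simp add: r_def add_nonneg_pos)
  define T where "T = r *\<^sub>R K"
  define J where "J = iim S"
  define I where "I = idm S"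
  have T: "supported S T" "star T = T" "norm T \<le> 1/2"
    using K r by (auto simp: T_def supported_intros) (simp add: r_def field_simps add_nonneg_pos)
  have J: "supported S J" "star J = - J" "J * J = - I" "supported S I" "star I = I"
    using S by (simp_all add: J_def I_def supported_dg star_iim iim_sq star_dg)
  have unit: "I * Y = Y" "Y * I = Y" "J * Y = Y * J" if "supported S Y" for Y
    using that by (simp_all add: I_def J_def iim_commute)
  obtain R where R: "supported S R" "(T + J) * R = I"
    using ex_right_inverse[OF T(1,3)] by (auto simp: I_def J_def)
  \<comment> \<open>A right inverse of \<open>- T + J\<close> yields a left inverse of
    \<open>T + J\<close> by taking adjoints, since \<open>T\<close> is self-adjoint and
    \<open>J\<close> is skew.\<close>
  obtain L' where L': "supported S L'" "(- T + J) * L' = I"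
    using ex_right_inverse[of S "- T"] T by (auto simp: I_def J_def supported_intros)
  define L where "L = - star L'"
  have "star ((- T + J) * L') = I" using L' J by simp
  then have L: "L * (T + J) = I" "supported S L"
    using T J L' by (simp_all add: L_def algebra_simps supported_intros)
  have "L = L * ((T + J) * R)" using R L unit(1,2) by simp
  also have "\<dots> = L * (T + J) * R" by (simp only: mult.assoc)
  also have "\<dots> = R" using R L unit(1,2) by simp
  finally have RL: "R * (T + J) = I" using L by simp
  have sR: "star R * (T - J) = I" "(T - J) * star R = I"
    using arg_cong[OF R(2), of star] arg_cong[OF RL, of star] T J by simp_all
  have swap: "(T + J) * (T - J) = (T - J) * (T + J)"
    using unit(3)[OF T(1)] by (simp add: algebra_simps)
  have Rcomm: "Y * R = R * Y" if Y: "supported S Y" "Y * (T + J) = (T + J) * Y" for Y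
  proof -
    have "Y * R = R * (T + J) * Y * R" using RL Y unit(1,2) by (simp add: mult.assoc)
    also have "\<dots> = R * (Y * (T + J)) * R" using Y by (simp add: mult.assoc)
    also have "\<dots> = R * Y * ((T + J) * R)" by (simp only: mult.assoc)
    also have "\<dots> = R * Y" using R Y unit(1,2) by (simp add: supported_intros)
    finally show ?thesis .
  qed
  define W where "W = (T - J) * R"
  have W': "W = R * (T - J)"
    using Rcomm[of "T - J"] swap T J by (simp add: W_def supported_intros)
  have sW: "supported S W" using T J R by (simp add: W_def supported_intros)
  have "star W * W = star R * ((T + J) * (T - J)) * R"
    using T J by (simp add: W_def mult.assoc)
  also have "\<dots> = star R * (T - J) * ((T + J) * R)" by (simp only: swap mult.assoc)
  finally have W1: "star W * W = I" using sR R J unit(1,2) by simp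
  have "W * star W = R * ((T - J) * (T + J)) * star R"
    using T J by (simp add: W' mult.assoc)
  also have "\<dots> = R * (T + J) * ((T - J) * star R)" by (simp only: swap[symmetric] mult.assoc)
  finally have W2: "W * star W = I" using sR RL J unit(1,2) by simp
  \<comment> \<open>I - W = 2 J R recovers the inverse \<open>R\<close> of \<open>T + J\<close> from
    \<open>W\<close>, hence also \<open>T\<close>; this is the way back from commuting with
    \<open>W\<close> to commuting with \<open>K\<close>.\<close>
  have "I - W = (T + J) * R - (T - J) * R" by (simp add: R W_def)
  also have "\<dots> = 2 *\<^sub>R (J * R)" by (simp add: algebra_simps scaleR_2)
  finally have "(- (1/2)) *\<^sub>R (J * (I - W)) = - (J * (J * R))" by simp
  then have Req: "R = (- (1/2)) *\<^sub>R (J * (I - W))"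
    using J R unit(1,2) by (simp add: mult.assoc[symmetric])
  have "Y * W = W * Y \<longleftrightarrow> Y * K = K * Y" if Y: "supported S Y" for Y
  proof
    assume "Y * K = K * Y"
    then have "Y * T = T * Y" by (simp add: T_def)
    then have c: "Y * (T + J) = (T + J) * Y" "Y * (T - J) = (T - J) * Y"
      using unit(3)[OF Y] by (simp_all add: algebra_simps)
    have "Y * W = Y * (T - J) * R" by (simp only: W_def mult.assoc)
    also have "\<dots> = (T - J) * (Y * R)" by (simp only: c mult.assoc)
    also have "\<dots> = W * Y" by (simp only: Rcomm[OF Y c(1)] W_def mult.assoc)
    finally show "Y * W = W * Y" .
  next
    assume YW: "Y * W = W * Y"
    have "Y * (J * (I - W)) = J * (I - W) * Y"
    proof -
      have "Y * (J * (I - W)) = J * (Y * (I - W))" using unit(3)[OF Y] by (simp add: mult.assoc[symmetric])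
      also have "Y * (I - W) = (I - W) * Y" using YW unit(1,2) Y by (simp add: algebra_simps)
      finally show ?thesis by (simp add: mult.assoc)
    qed
    then have YR: "Y * R = R * Y" unfolding Req by simp
    have "Y * (T + J) = (T + J) * R * Y * (T + J)" using R Y unit(1,2) by simp
    also have "\<dots> = (T + J) * (Y * R) * (T + J)" by (simp add: YR mult.assoc)
    also have "\<dots> = (T + J) * Y" using RL Y T J unit(1,2) by (simp add: mult.assoc)
    finally have "Y * T = T * Y" using unit(3)[OF Y] by (simp add: algebra_simps)
    then show "Y * K = K * Y" using r by (simp add: T_def)
  qed
  then show ?thesis using sW W1 W2 by (auto simp: unitary_def I_def)
qed

text \<open>Midpoints suffice for a minimizing sequence, which only needs the parallelogram law. The
  elements are maps rather than matrices, so that one and the same average acts on all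
  \<open>s i\<close> together.\<close>

inductive_set conj_hull :: "'i fmat set \<Rightarrow> ('i fmat \<Rightarrow> 'i fmat) set" for G where
  conj: "W \<in> G \<Longrightarrow> (\<lambda>X. W * X * star W) \<in> conj_hull G"
| mid: "\<Phi> \<in> conj_hull G \<Longrightarrow> \<Psi> \<in> conj_hull G \<Longrightarrow> (\<lambda>X. (1/2) *\<^sub>R (\<Phi> X + \<Psi> X)) \<in> conj_hull G"

lemma conj_hull_conj:
  assumes "\<Phi> \<in> conj_hull G" "W \<in> G" "\<And>V. V \<in> G \<Longrightarrow> W * V \<in> G"
  shows "(\<lambda>X. W * \<Phi> X * star W) \<in> conj_hull G"
  using assms(1)
proof induction
  case (conj V)
  have "(\<lambda>X. W * (V * X * star V) * star W) = (\<lambda>X. (W * V) * X * star (W * V))"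
    by (simp add: mult.assoc)
  then show ?case using conj_hull.conj[OF assms(3)[OF conj]] by simp
next
  case (mid \<Phi> \<Psi>)
  show ?case using conj_hull.mid[OF mid(3,4)] by (simp add: distrib_left distrib_right)
qed

lemma parallelogram: "(norm (x - y))\<^sup>2 = 2 * (norm x)\<^sup>2 + 2 * (norm y)\<^sup>2 - 4 * (norm ((1/2) *\<^sub>R (x + y)))\<^sup>2"
  for x y :: "'a :: real_inner"
proof -
  have "(norm ((1/2) *\<^sub>R (x + y)))\<^sup>2 = (norm (x + y))\<^sup>2 / 4" by (simp add: power2_eq_square)
  then show ?thesis
    by (simp add: power2_norm_eq_inner inner_diff_left inner_diff_right inner_add_left inner_add_right inner_commute)
qed

lemma norm_mid_sq_le: "(norm ((1/2) *\<^sub>R (x + y)))\<^sup>2 \<le> ((norm x)\<^sup>2 + (norm y)\<^sup>2) / 2"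
  for x y :: "'a :: real_inner"
proof -
  define m where "m = (norm ((1/2) *\<^sub>R (x + y)))\<^sup>2"
  have "0 \<le> 2 * (norm x)\<^sup>2 + 2 * (norm y)\<^sup>2 - 4 * m"
    unfolding m_def parallelogram[of x y, symmetric] by simp
  then show ?thesis unfolding m_def[symmetric] by (simp add: field_simps)
qed

definition unitaries_commuting :: "'i set \<Rightarrow> 'i fmat set \<Rightarrow> 'i fmat set" where
  "unitaries_commuting S Z = {W. unitary S W \<and> (\<forall>X\<in>Z. W * X = X * W)}"

lemma unitaries_commuting_times:
  "V \<in> unitaries_commuting S Z \<Longrightarrow> W \<in> unitaries_commuting S Z \<Longrightarrow> V * W \<in> unitaries_commuting S Z"
  unfolding unitaries_commuting_def
  by (auto simp: unitary_times) (metis mult.assoc)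

text \<open>The point of minimal norm in the closed convex hull of an orbit of a unitary group is
  invariant; it plays the role of the conditional expectation onto the commutant.\<close>

lemma ex_invariant_average:
  fixes s :: "nat \<Rightarrow> 'i fmat"
  assumes S: "finite S" and G: "G = unitaries_commuting S Z"
    and Z: "\<And>X. X \<in> Z \<Longrightarrow> supported S X"
    and s: "\<And>i. i < N \<Longrightarrow> supported S (s i)" "\<And>i. i < N \<Longrightarrow> star (s i) = s i" "\<And>i. i < N \<Longrightarrow> contr (s i)"
    and e: "\<And>W. W \<in> G \<Longrightarrow> (\<Sum>i<N. (norm (s i * W - W * s i))\<^sup>2) \<le> e"
  shows "\<exists>p. (\<forall>i<N. supported S (p i) \<and> star (p i) = p i \<and> contr (p i) \<and> (\<forall>W\<in>G. W * p i = p i * W))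
    \<and> (\<Sum>i<N. (norm (p i - s i))\<^sup>2) \<le> e"
proof -
  have Gu: "unitary S W" if "W \<in> G" for W using that by (simp add: G unitaries_commuting_def)
  have Gm: "V * W \<in> G" if "V \<in> G" "W \<in> G" for V W using that by (simp add: G unitaries_commuting_times)
  have G1: "idm S \<in> G"
    using S Z by (simp add: G unitaries_commuting_def unitary_idm)
  define f where "f \<Phi> = (\<Sum>i<N. (norm (\<Phi> (s i)))\<^sup>2)" for \<Phi> :: "'i fmat \<Rightarrow> 'i fmat"
  let ?H = "conj_hull G"
  define m where "m = Inf (f ` ?H)"
  have m: "m \<le> f \<Phi>" if "\<Phi> \<in> ?H" for \<Phi>
    unfolding m_def using that
    by (intro cInf_lower bdd_belowI[of _ 0]) (auto simp: f_def intro: sum_nonneg)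
  have hull: "supported S (\<Phi> (s i)) \<and> star (\<Phi> (s i)) = \<Phi> (s i) \<and> contr (\<Phi> (s i))"
    if "\<Phi> \<in> ?H" "i < N" for \<Phi> i
    using that(1)
  proof induction
    case (conj W)
    note W = Gu[OF conj]
    have "contr (W * s i * star W)"
      by (intro contr_times contr_star unitary_contr[OF W] s that)
    then show ?case using s[OF that(2)] W by (simp add: unitary_def supported_intros mult.assoc)
  next
    case (mid \<Phi> \<Psi>)
    have "norm ((1/2) *\<^sub>R (\<Phi> (s i) + \<Psi> (s i)) * Y) \<le> norm Y" for Y
    proof -
      have "norm (\<Phi> (s i) * Y + \<Psi> (s i) * Y) \<le> norm Y + norm Y"
        using mid by (intro norm_triangle_mono contrD) auto
      then show ?thesis by (simp add: distrib_right flip: scaleR_add_right)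
    qed
    then show ?case using mid by (simp add: supported_intros contr_def)
  qed
  have dist_s: "(\<Sum>i<N. (norm (\<Phi> (s i) - s i))\<^sup>2) \<le> e" if "\<Phi> \<in> ?H" for \<Phi>
    using that
  proof induction
    case (conj W)
    note W = Gu[OF conj]
    have "norm (W * s i * star W - s i) \<le> norm (s i * W - W * s i)" if "i < N" for i
    proof -
      have "W * s i * star W - s i = (W * s i - s i * W) * star W"
        using W s that by (simp add: unitary_def algebra_simps)
      then show ?thesis
        using contrD_right[OF contr_star[OF unitary_contr[OF W]]] by (metis norm_minus_commute)
    qed
    then have "(\<Sum>i<N. (norm (W * s i * star W - s i))\<^sup>2) \<le> (\<Sum>i<N. (norm (s i * W - W * s i))\<^sup>2)"
      by (intro sum_mono power_mono) auto
    then show ?case using e[OF conj] by simp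
  next
    case (mid \<Phi> \<Psi>)
    have "(1/2) *\<^sub>R (\<Phi> (s i) + \<Psi> (s i)) - s i = (1/2) *\<^sub>R ((\<Phi> (s i) - s i) + (\<Psi> (s i) - s i))" for i
      by (simp add: algebra_simps) (simp flip: scaleR_add_left)
    then have "(\<Sum>i<N. (norm ((1/2) *\<^sub>R (\<Phi> (s i) + \<Psi> (s i)) - s i))\<^sup>2)
        \<le> (\<Sum>i<N. ((norm (\<Phi> (s i) - s i))\<^sup>2 + (norm (\<Psi> (s i) - s i))\<^sup>2) / 2)"
      by (simp only:) (intro sum_mono norm_mid_sq_le)
    also have "\<dots> \<le> e" using mid(3,4) by (simp add: sum.distrib flip: sum_divide_distrib)
    finally show ?case .
  qed
  \<comment> \<open>The midpoint of two maps of the hull lies in the hull, so \<open>f\<close> is at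
    least \<open>m\<close> there; by the parallelogram law two near-minimizers of \<open>f\<close>
    are close at every \<open>s i\<close>.\<close>
  have close: "(norm (\<Phi> (s i) - \<Psi> (s i)))\<^sup>2 \<le> 4 * \<eta>"
    if "\<Phi> \<in> ?H" "\<Psi> \<in> ?H" "f \<Phi> \<le> m + \<eta>" "f \<Psi> \<le> m + \<eta>" "i < N" for \<Phi> \<Psi> \<eta> i
  proof -
    have "(norm (\<Phi> (s i) - \<Psi> (s i)))\<^sup>2 \<le> (\<Sum>i<N. (norm (\<Phi> (s i) - \<Psi> (s i)))\<^sup>2)"
      using that by (intro member_le_sum) auto
    also have "\<dots> = 2 * f \<Phi> + 2 * f \<Psi> - 4 * f (\<lambda>X. (1/2) *\<^sub>R (\<Phi> X + \<Psi> X))"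
      unfolding parallelogram f_def sum_distrib_left sum.distrib sum_subtractf by simp
    finally show ?thesis using m[OF conj_hull.mid[OF that(1,2)]] that(3,4) by linarith
  qed
  have "\<exists>\<Phi>\<in>?H. f \<Phi> < m + 1 / real (Suc k)" for k
  proof -
    have "f ` ?H \<noteq> {}" using conj_hull.conj[OF G1] by blast
    then have "\<exists>y\<in>f ` ?H. y < m + 1 / real (Suc k)"
      unfolding m_def by (intro cInf_lessD) auto
    then show ?thesis by blast
  qed
  then obtain \<Phi> where \<Phi>: "\<And>k. \<Phi> k \<in> ?H" "\<And>k. f (\<Phi> k) < m + 1 / real (Suc k)" by metis
  have small: "f (\<Phi> k) \<le> m + 1 / real (Suc j)" if "j \<le> k" for j k
  proof -
    have "1 / real (Suc k) \<le> 1 / real (Suc j)" using that by (intro frac_le) auto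
    then show ?thesis using \<Phi>(2)[of k] by linarith
  qed
  have conv: "\<exists>l. supported S l \<and> (\<lambda>k. \<Phi> k (s i)) \<longlonglongrightarrow> l" if i: "i < N" for i
  proof -
    have "Cauchy (\<lambda>k. \<Phi> k (s i))"
    proof (rule CauchyI)
      fix r :: real assume r: "0 < r"
      then obtain M where "inverse (real (Suc M)) < r\<^sup>2 / 4"
        using reals_Archimedean[of "r\<^sup>2 / 4"] by auto
      then have M: "4 / real (Suc M) < r\<^sup>2" by (simp add: field_simps)
      have "norm (\<Phi> j (s i) - \<Phi> k (s i)) < r" if "j \<ge> M" "k \<ge> M" for j k
      proof (rule power2_less_imp_less)
        show "(norm (\<Phi> j (s i) - \<Phi> k (s i)))\<^sup>2 < r\<^sup>2"
          using close[OF \<Phi>(1) \<Phi>(1) small[OF that(1)] small[OF that(2)] i] M by simp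
      qed (use r in simp)
      then show "\<exists>M. \<forall>j\<ge>M. \<forall>k\<ge>M. norm (\<Phi> j (s i) - \<Phi> k (s i)) < r" by blast
    qed
    moreover have "\<forall>k. \<Phi> k (s i) \<in> {A. supported S A}" using hull \<Phi>(1) i by blast
    ultimately obtain l where "l \<in> {A. supported S A}" "(\<lambda>k. \<Phi> k (s i)) \<longlonglongrightarrow> l"
      using completeE[OF complete_supported[OF S]] by metis
    then show ?thesis by blast
  qed
  then obtain p where p: "\<And>i. i < N \<Longrightarrow> supported S (p i)" "\<And>i. i < N \<Longrightarrow> (\<lambda>k. \<Phi> k (s i)) \<longlonglongrightarrow> p i"
    by metis
  have star_lim: "(\<lambda>k. star (X k)) \<longlonglongrightarrow> star L" if "X \<longlonglongrightarrow> L" for X and L :: "'i fmat"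
  proof -
    have "(\<lambda>k. norm (star (X k - L))) \<longlonglongrightarrow> 0"
      unfolding norm_star using that by (simp add: LIM_zero tendsto_norm_zero)
    then have "(\<lambda>k. star (X k) - star L) \<longlonglongrightarrow> 0" unfolding star_simps by (rule tendsto_norm_zero_cancel)
    then show ?thesis by (rule LIM_zero_cancel)
  qed
  have "star (p i) = p i" if i: "i < N" for i
    using star_lim[OF p(2)[OF i]] p(2)[OF i] hull[OF \<Phi>(1) i] LIMSEQ_unique by auto
  moreover have "contr (p i)" if i: "i < N" for i
    unfolding contr_def
  proof
    fix Y
    have "(\<lambda>k. norm (\<Phi> k (s i) * Y)) \<longlonglongrightarrow> norm (p i * Y)"
      by (intro tendsto_intros p i)
    then show "norm (p i * Y) \<le> norm Y"
      using hull[OF \<Phi>(1) i] by (intro LIMSEQ_le_const2) (auto simp: contr_def)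
  qed
  moreover have "W * p i = p i * W" if W: "W \<in> G" and i: "i < N" for W i
  proof -
    let ?d = "\<lambda>X. W * X * star W - X"
    \<comment> \<open>Conjugation by \<open>W\<close> preserves both the hull and \<open>f\<close>,
      so it takes a near-minimizer to a near-minimizer. The two are close, and the limit is fixed by
      \<open>W\<close>.\<close>
    have b: "(norm (?d (\<Phi> k (s i))))\<^sup>2 \<le> 4 * (1 / real (Suc k))" for k
    proof -
      have "f (\<lambda>X. W * \<Phi> k X * star W) = f (\<Phi> k)"
        unfolding f_def using norm_unitary_conj[OF Gu[OF W]] hull[OF \<Phi>(1)] by simp
      then show ?thesis
        using small[of k k] i
        by (intro close[OF conj_hull_conj[OF \<Phi>(1) W Gm[OF W]] \<Phi>(1)]) simp_all
    qed
    have "(\<lambda>k. (norm (?d (\<Phi> k (s i))))\<^sup>2) \<longlonglongrightarrow> (norm (?d (p i)))\<^sup>2"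
      by (intro tendsto_intros p i)
    moreover have "(\<lambda>k. 4 * (1 / real (Suc k))) \<longlonglongrightarrow> 4 * 0"
      by (intro tendsto_intros) (use LIMSEQ_inverse_real_of_nat in \<open>simp add: inverse_eq_divide\<close>)
    ultimately have "(norm (?d (p i)))\<^sup>2 \<le> 4 * 0"
      using b by (intro LIMSEQ_le) auto
    then have "W * p i * star W = p i" by simp
    then have "p i * W = W * p i * (star W * W)" by (metis mult.assoc)
    then show ?thesis using Gu[OF W] p(1)[OF i] by (simp add: unitary_def supported_intros)
  qed
  moreover have "(\<Sum>i<N. (norm (p i - s i))\<^sup>2) \<le> e"
  proof -
    have "(\<lambda>k. \<Sum>i<N. (norm (\<Phi> k (s i) - s i))\<^sup>2) \<longlonglongrightarrow> (\<Sum>i<N. (norm (p i - s i))\<^sup>2)"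
      by (intro tendsto_intros p) auto
    then show ?thesis using dist_s[OF \<Phi>(1)] by (intro LIMSEQ_le_const2) auto
  qed
  ultimately show ?thesis using p(1) by (intro exI[of _ p]) blast
qed

text \<open>\<open>Q\<close> and \<open>P\<close> are the unitary groups of the commutant and of the
  bicommutant of \<open>A'\<close> and its adjoint. The assumptions on \<open>A\<close> and
  \<open>B\<close> are the spectral gaps: commutators with them dominate those with the
  \<open>s i\<close> and the \<open>t i\<close>, on average over \<open>i\<close>.\<close>

lemma no_commuting_approximants:
  fixes s t :: "nat \<Rightarrow> 'i fmat"
  assumes S: "finite S" and N: "N > 0" and C: "C > 0"
    and s: "\<And>i. i < N \<Longrightarrow> supported S (s i)" "\<And>i. i < N \<Longrightarrow> star (s i) = s i" "\<And>i. i < N \<Longrightarrow> contr (s i)"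
    and t: "\<And>i. i < N \<Longrightarrow> supported S (t i)" "\<And>i. i < N \<Longrightarrow> star (t i) = t i" "\<And>i. i < N \<Longrightarrow> contr (t i)"
    and anti: "\<And>i. i < N \<Longrightarrow> norm (s i * t i - t i * s i) = 2 * norm (idm S)"
    and A: "supported S A" "\<And>V. supported S V \<Longrightarrow> (\<Sum>i<N. (norm (s i * V - V * s i))\<^sup>2)
      \<le> N * C\<^sup>2 * ((norm (A * V - V * A))\<^sup>2 + (norm (star A * V - V * star A))\<^sup>2)"
    and B: "supported S B" "\<And>V. supported S V \<Longrightarrow> (\<Sum>i<N. (norm (t i * V - V * t i))\<^sup>2)
      \<le> N * C\<^sup>2 * ((norm (B * V - V * B))\<^sup>2 + (norm (star B * V - V * star B))\<^sup>2)"
    and A': "supported S A'" and B': "supported S B'"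
    and comm: "A' * B' = B' * A'" "A' * star B' = star B' * A'"
  shows "norm (idm S) \<le> 8 * C * (norm (A - A') + norm (B - B'))"
proof -
  \<comment> \<open>A unitary commuting with \<open>E'\<close> only sees \<open>E - E'\<close>, so
    each of the two commutators is at most twice its norm; the two squares add up to the factor
    8.\<close>
  have bound: "(\<Sum>i<N. (norm (u i * W - W * u i))\<^sup>2) \<le> N * (8 * C\<^sup>2 * (norm (E - E'))\<^sup>2)"
    if W: "unitary S W" "E' * W = W * E'" "star E' * W = W * star E'"
      and E: "\<And>V. supported S V \<Longrightarrow> (\<Sum>i<N. (norm (u i * V - V * u i))\<^sup>2)
      \<le> N * C\<^sup>2 * ((norm (E * V - V * E))\<^sup>2 + (norm (star E * V - V * star E))\<^sup>2)" for u E E' W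
  proof -
    have "E * W - W * E = (E - E') * W - W * (E - E')"
      "star E * W - W * star E = star (E - E') * W - W * star (E - E')"
      using W by (simp_all add: algebra_simps)
    then have le: "norm (E * W - W * E) \<le> 2 * norm (E - E')" "norm (star E * W - W * star E) \<le> 2 * norm (E - E')"
      using norm_comm_le[OF unitary_contr[OF W(1)], of "E - E'"]
        norm_comm_le[OF unitary_contr[OF W(1)], of "star (E - E')"]
      by (simp_all only: norm_star)
    have "(norm (E * W - W * E))\<^sup>2 + (norm (star E * W - W * star E))\<^sup>2 \<le> 8 * (norm (E - E'))\<^sup>2"
      using power_mono[OF le(1), of 2] power_mono[OF le(2), of 2] by (simp add: power_mult_distrib)
    then have "N * C\<^sup>2 * ((norm (E * W - W * E))\<^sup>2 + (norm (star E * W - W * star E))\<^sup>2) \<le> N * C\<^sup>2 * (8 * (norm (E - E'))\<^sup>2)"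
      by (intro mult_left_mono) auto
    then show ?thesis using E[of W] W(1) by (simp add: unitary_def algebra_simps)
  qed
  define Q where "Q = unitaries_commuting S {A', star A'}"
  define P where "P = unitaries_commuting S Q"
  have QS: "supported S W" if "W \<in> Q" for W using that by (simp add: Q_def unitaries_commuting_def unitary_def)
  obtain p where p: "\<And>i. i < N \<Longrightarrow> supported S (p i) \<and> star (p i) = p i \<and> contr (p i) \<and> (\<forall>W\<in>Q. W * p i = p i * W)"
    "(\<Sum>i<N. (norm (p i - s i))\<^sup>2) \<le> N * (8 * C\<^sup>2 * (norm (A - A'))\<^sup>2)"
  proof -
    have "(\<Sum>i<N. (norm (s i * W - W * s i))\<^sup>2) \<le> N * (8 * C\<^sup>2 * (norm (A - A'))\<^sup>2)" if "W \<in> Q" for W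
      using that by (intro bound A) (auto simp: Q_def unitaries_commuting_def)
    from ex_invariant_average[OF S Q_def _ s this] show thesis using A' that supported_star by blast
  qed
  have selfadj: "W * K = K * W" if K: "supported S K" "star K = K" and W: "supported S W"
    and c: "\<And>V. unitary S V \<Longrightarrow> (\<And>Y. supported S Y \<Longrightarrow> Y * K = K * Y \<Longrightarrow> Y * V = V * Y) \<Longrightarrow> W * V = V * W" for W K
    using ex_cayley[OF K] c W by metis
  \<comment> \<open>The real and imaginary parts of \<open>B'\<close> commute with \<open>A'\<close>
    and its adjoint, so their Cayley transforms lie in \<open>Q\<close>, and \<open>W\<close>
    commutes with \<open>Q\<close>.\<close>
  have P_comm: "W * B' = B' * W \<and> W * star B' = star B' * W" if W: "W \<in> P" for W
  proof -
    have WS: "supported S W" using W by (simp add: P_def unitaries_commuting_def unitary_def)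
    have sc: "star A' * B' = B' * star A'" "star A' * star B' = star B' * star A'"
      using arg_cong[OF comm(1), of star] arg_cong[OF comm(2), of star] by simp_all
    have W_self: "W * K = K * W" if K: "supported S K" "star K = K" "A' * K = K * A'" "star A' * K = K * star A'" for K
    proof (rule selfadj[OF K(1,2) WS])
      fix V assume "unitary S V" "\<And>Y. supported S Y \<Longrightarrow> Y * K = K * Y \<Longrightarrow> Y * V = V * Y"
      then have "V \<in> Q" using K A' by (simp add: Q_def unitaries_commuting_def supported_intros)
      then show "W * V = V * W" using W by (simp add: P_def unitaries_commuting_def)
    qed
    let ?J = "iim S"
    have J: "supported S ?J" "star ?J = - ?J" "?J * ?J = - idm S"
      using S by (simp_all add: supported_dg star_iim iim_sq)
    have Jc: "X * ?J = ?J * X" if "supported S X" for X using iim_commute[OF that] .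
    have 1: "W * (B' + star B') = (B' + star B') * W"
      using B' comm sc by (intro W_self) (auto simp: supported_intros algebra_simps)
    have 2: "W * (?J * (B' - star B')) = ?J * (B' - star B') * W"
    proof (rule W_self)
      show "star (?J * (B' - star B')) = ?J * (B' - star B')"
        using Jc[of "B' - star B'"] B' J by (simp add: supported_intros algebra_simps)
      show "A' * (?J * (B' - star B')) = ?J * (B' - star B') * A'"
        using comm Jc[OF A'] by (simp add: mult.assoc[symmetric]) (simp add: mult.assoc algebra_simps)
      show "star A' * (?J * (B' - star B')) = ?J * (B' - star B') * star A'"
        using sc Jc[OF supported_star[OF A']] by (simp add: mult.assoc[symmetric]) (simp add: mult.assoc algebra_simps)
    qed (use B' J in \<open>simp add: supported_intros\<close>)
    have "?J * (W * (?J * (B' - star B'))) = ?J * ?J * (W * (B' - star B'))"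
      using Jc[OF WS] by (metis mult.assoc)
    moreover have "?J * (?J * (B' - star B') * W) = ?J * ?J * ((B' - star B') * W)" by (simp only: mult.assoc)
    ultimately have "W * (B' - star B') = (B' - star B') * W"
      using 2 J B' WS by (simp add: supported_intros)
    note 3 = this
    have "2 *\<^sub>R (W * B') = W * (B' + star B') + W * (B' - star B')"
      "2 *\<^sub>R (B' * W) = (B' + star B') * W + (B' - star B') * W"
      "2 *\<^sub>R (W * star B') = W * (B' + star B') - W * (B' - star B')"
      "2 *\<^sub>R (star B' * W) = (B' + star B') * W - (B' - star B') * W"
      by (simp_all add: scaleR_2 algebra_simps)
    then have "2 *\<^sub>R (W * B') = 2 *\<^sub>R (B' * W)" "2 *\<^sub>R (W * star B') = 2 *\<^sub>R (star B' * W)"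
      by (simp_all only: 1 3)
    then show ?thesis by simp
  qed
  obtain q where q: "\<And>i. i < N \<Longrightarrow> supported S (q i) \<and> star (q i) = q i \<and> contr (q i) \<and> (\<forall>W\<in>P. W * q i = q i * W)"
    "(\<Sum>i<N. (norm (q i - t i))\<^sup>2) \<le> N * (8 * C\<^sup>2 * (norm (B - B'))\<^sup>2)"
  proof -
    have "(\<Sum>i<N. (norm (t i * W - W * t i))\<^sup>2) \<le> N * (8 * C\<^sup>2 * (norm (B - B'))\<^sup>2)" if "W \<in> P" for W
      using that P_comm[OF that] by (intro bound B) (auto simp: P_def unitaries_commuting_def)
    from ex_invariant_average[OF S P_def _ t this] show thesis using QS that by blast
  qed
  \<comment> \<open>Every element of \<open>Q\<close> commutes with \<open>p i\<close>, so the
    Cayley transform of \<open>p i\<close> lies in \<open>P\<close>. As \<open>q i\<close> commutes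
    with \<open>P\<close>, it commutes with \<open>p i\<close>.\<close>
  have pq: "p i * q i = q i * p i" if i: "i < N" for i
  proof -
    have "q i * p i = p i * q i"
    proof (rule selfadj)
      fix V assume V: "unitary S V" "\<And>Y. supported S Y \<Longrightarrow> Y * p i = p i * Y \<Longrightarrow> Y * V = V * Y"
      have "V \<in> P" using V p(1)[OF i] QS by (auto simp: P_def unitaries_commuting_def)
      then show "q i * V = V * q i" using q(1)[OF i] by auto
    qed (use p(1) q(1) i in auto)
    then show ?thesis by simp
  qed
  have st: "norm (idm S) \<le> norm (p i - s i) + norm (q i - t i)" if i: "i < N" for i
  proof -
    \<comment> \<open>[s, t] = [s - p, t] + [q - t, p] because p and q commute; \<open>t i\<close>
      and \<open>p i\<close> are contractions, so each term is at most twice the norm of a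
      difference.\<close>
    have "s i * t i - t i * s i = ((s i - p i) * t i - t i * (s i - p i)) + ((q i - t i) * p i - p i * (q i - t i))"
      using pq[OF i] by (simp add: algebra_simps)
    then have "2 * norm (idm S) \<le> norm ((s i - p i) * t i - t i * (s i - p i)) + norm ((q i - t i) * p i - p i * (q i - t i))"
      using anti[OF i] norm_triangle_ineq by metis
    also have "\<dots> \<le> 2 * norm (s i - p i) + 2 * norm (q i - t i)"
      using t(3)[OF i] p(1)[OF i] by (intro add_mono norm_comm_le) auto
    finally show ?thesis by (simp add: norm_minus_commute)
  qed
  define a where "a = norm (A - A')"
  define b where "b = norm (B - B')"
  have "real N * (norm (idm S))\<^sup>2 = (\<Sum>i<N. (norm (idm S))\<^sup>2)" by simp
  also have "\<dots> \<le> (\<Sum>i<N. 2 * (norm (p i - s i))\<^sup>2 + 2 * (norm (q i - t i))\<^sup>2)"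
  proof (rule sum_mono)
    fix i assume "i \<in> {..<N}"
    then have "(norm (idm S))\<^sup>2 \<le> (norm (p i - s i) + norm (q i - t i))\<^sup>2"
      using st by (intro power_mono) auto
    also have "\<dots> \<le> 2 * (norm (p i - s i))\<^sup>2 + 2 * (norm (q i - t i))\<^sup>2"
      by (smt (verit) sum_squares_bound power2_sum)
    finally show "(norm (idm S))\<^sup>2 \<le> 2 * (norm (p i - s i))\<^sup>2 + 2 * (norm (q i - t i))\<^sup>2" .
  qed
  also have "\<dots> \<le> real N * (16 * C\<^sup>2 * a\<^sup>2 + 16 * C\<^sup>2 * b\<^sup>2)"
    using p(2) q(2) by (simp add: sum.distrib a_def b_def algebra_simps flip: sum_distrib_left)
  also have "\<dots> \<le> real N * (8 * C * (a + b))\<^sup>2"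
  proof -
    have "0 \<le> C\<^sup>2 * (a * b)" "0 \<le> C\<^sup>2 * a\<^sup>2" "0 \<le> C\<^sup>2 * b\<^sup>2" by (simp_all add: a_def b_def)
    then show ?thesis
      by (intro mult_left_mono) (auto simp: power2_eq_square algebra_simps)
  qed
  finally have "(norm (idm S))\<^sup>2 \<le> (8 * C * (a + b))\<^sup>2" using N by simp
  then have "norm (idm S) \<le> 8 * C * (a + b)"
    by (rule power2_le_imp_le) (use C in \<open>simp add: a_def b_def\<close>)
  then show ?thesis by (simp add: a_def b_def)
qed

section \<open>A uniform spectral gap on the finite torus\<close>

text \<open>Cauchy-Schwarz applied to u^2 - v^2 = (u - v)(u + v): amplitudes that are close in
  square mean have masses that are close in total variation, the form in which sets can be
  compared.\<close>

lemma sum_diff_squares_le: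
  fixes u v :: "int \<Rightarrow> int \<Rightarrow> real"
  assumes "(\<Sum>a\<in>Z. \<Sum>b\<in>Z. (u a b - v a b)\<^sup>2) \<le> d\<^sup>2" "d \<ge> 0"
    and "(\<Sum>a\<in>Z. \<Sum>b\<in>Z. (u a b)\<^sup>2) = M" "(\<Sum>a\<in>Z. \<Sum>b\<in>Z. (v a b)\<^sup>2) = M"
  shows "(\<Sum>a\<in>Z. \<Sum>b\<in>Z. \<bar>(u a b)\<^sup>2 - (v a b)\<^sup>2\<bar>) \<le> 2 * d * sqrt M"
proof -
  let ?P = "Z \<times> Z"
  have M: "M \<ge> 0" using assms(3) by (auto intro!: sum_nonneg)
  have "(\<Sum>p\<in>?P. \<bar>u (fst p) (snd p) - v (fst p) (snd p)\<bar> * \<bar>u (fst p) (snd p) + v (fst p) (snd p)\<bar>)\<^sup>2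
    \<le> (\<Sum>p\<in>?P. \<bar>u (fst p) (snd p) - v (fst p) (snd p)\<bar>\<^sup>2) * (\<Sum>p\<in>?P. \<bar>u (fst p) (snd p) + v (fst p) (snd p)\<bar>\<^sup>2)"
    by (rule Cauchy_Schwarz_ineq_sum)
  then have "(\<Sum>a\<in>Z. \<Sum>b\<in>Z. \<bar>u a b - v a b\<bar> * \<bar>u a b + v a b\<bar>)\<^sup>2
    \<le> (\<Sum>a\<in>Z. \<Sum>b\<in>Z. (u a b - v a b)\<^sup>2) * (\<Sum>a\<in>Z. \<Sum>b\<in>Z. (u a b + v a b)\<^sup>2)"
    by (simp add: sum.cartesian_product case_prod_beta)
  also have "\<dots> \<le> d\<^sup>2 * (4 * M)"
  proof (intro mult_mono assms)
    have "(\<Sum>a\<in>Z. \<Sum>b\<in>Z. (u a b + v a b)\<^sup>2) \<le> (\<Sum>a\<in>Z. \<Sum>b\<in>Z. 2 * (u a b)\<^sup>2 + 2 * (v a b)\<^sup>2)"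
      by (intro sum_mono) (smt (verit) sum_squares_bound power2_sum)
    also have "\<dots> = 4 * M" using assms(3,4) by (simp add: sum.distrib flip: sum_distrib_left)
    finally show "(\<Sum>a\<in>Z. \<Sum>b\<in>Z. (u a b + v a b)\<^sup>2) \<le> 4 * M" .
  qed (auto intro!: sum_nonneg)
  also have "\<dots> = (2 * d * sqrt M)\<^sup>2" using M by (simp add: power_mult_distrib)
  finally have "(\<Sum>a\<in>Z. \<Sum>b\<in>Z. \<bar>u a b - v a b\<bar> * \<bar>u a b + v a b\<bar>) \<le> 2 * d * sqrt M"
    by (rule power2_le_imp_le) (use assms(2) M in simp)
  moreover have "\<bar>(u a b)\<^sup>2 - (v a b)\<^sup>2\<bar> = \<bar>u a b - v a b\<bar> * \<bar>u a b + v a b\<bar>" for a b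
    by (simp add: power2_eq_square algebra_simps flip: abs_mult)
  ultimately show ?thesis by simp
qed

context fixes N :: nat assumes N: "N > 0"
begin

section \<open>Characters of the cyclic group and Plancherel\<close>

definition ev :: "int \<Rightarrow> complex" where "ev m = cis (2 * pi * of_int m / real N)"

abbreviation ZN :: "int set" where "ZN \<equiv> {0..<int N}"

text \<open>Functions on Z/N are represented by periodic functions on the integers, so that
  arguments can be shifted and reflected freely; sums run over the representatives in
  \<open>ZN\<close>.\<close>

definition per :: "(int \<Rightarrow> 'a) \<Rightarrow> bool" where "per f \<longleftrightarrow> (\<forall>x. f (x + int N) = f x)"

lemma ev_add: "ev (m + n) = ev m * ev n"
  by (simp add: ev_def cis_mult distrib_left add_divide_distrib)

lemma ev_minus: "ev (- m) = cnj (ev m)"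
  by (simp add: ev_def cis_cnj)

lemma norm_ev [simp]: "cmod (ev m) = 1"
  by (simp add: ev_def)

lemma ev_0 [simp]: "ev 0 = 1"
  by (simp add: ev_def)

lemma ev_cancel [simp]: "ev m * cnj (ev m) = 1" "cnj (ev m) * ev m = 1"
  by (simp_all add: complex_norm_square[symmetric] mult.commute)

lemma ev_multiple [simp]: "ev (int N * k) = 1"
proof -
  have "ev (int N * k) = cis (2 * pi * of_int k)" 
    unfolding ev_def by (rule arg_cong[of _ _ cis]) (use N in simp)
  also have "\<dots> = 1" by (rule cis_multiple_2pi) simp
  finally show ?thesis .
qed

lemma ev_eq_1_iff: "ev m = 1 \<longleftrightarrow> int N dvd m"
proof
  assume "ev m = 1"
  then have "cos (2 * pi * of_int m / real N) = 1" by (simp add: ev_def cis.ctr complex_eq_iff)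
  then obtain k :: int where "2 * pi * of_int m / real N = of_int k * 2 * pi"
    by (auto simp: cos_one_2pi_int)
  then have "of_int m = (of_int k * real N :: real)" using N by (simp add: field_simps)
  then have "m = k * int N" by (metis of_int_eq_iff of_int_mult of_int_of_nat_eq)
  then show "int N dvd m" by simp
qed (auto elim!: dvdE)

lemma per_mod:
  assumes "per f" shows "f (x mod int N) = f x"
proof -
  have n: "f (y + int N * int k) = f y" for y k
  proof (induction k)
    case (Suc k)
    have "f (y + int N * int (Suc k)) = f (y + int N * int k + int N)" by (simp add: algebra_simps)
    also have "\<dots> = f y" using Suc assms by (simp add: per_def)
    finally show ?case .
  qed simp
  have "f (y + int N * k) = f y" for y k
  proof (cases "k \<ge> 0")
    case True
    then show ?thesis using n[of y "nat k"] by simp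
  next
    case False
    then show ?thesis using n[of "y + int N * k" "nat (- k)"] by (simp add: algebra_simps)
  qed
  from this[of "x mod int N" "x div int N"] show ?thesis by simp
qed

lemma per_ev: "per (\<lambda>x. ev (k * x))"
  by (simp add: per_def distrib_left ev_add mult.commute[of k "int N"])

lemma sum_shift: assumes "per f" shows "(\<Sum>x\<in>ZN. f (x + k)) = (\<Sum>x\<in>ZN. f x)"
  by (rule sum.reindex_bij_witness[of _ "\<lambda>x. (x - k) mod int N" "\<lambda>x. (x + k) mod int N"])
    (use N per_mod[OF assms] in \<open>auto simp: mod_diff_left_eq mod_add_left_eq\<close>)

lemma sum_reflect: assumes "per f" shows "(\<Sum>x\<in>ZN. f (- x)) = (\<Sum>x\<in>ZN. f x)"
  by (rule sum.reindex_bij_witness[of _ "\<lambda>x. (- x) mod int N" "\<lambda>x. (- x) mod int N"])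
    (use N per_mod[OF assms] in \<open>auto simp: mod_minus_eq\<close>)

lemma sum_ev: "(\<Sum>x\<in>ZN. ev (m * x)) = (if int N dvd m then of_nat N else 0)"
proof (cases "int N dvd m")
  case True
  then have "ev (m * x) = 1" for x by (auto elim!: dvdE simp: mult.assoc)
  then show ?thesis using True by simp
next
  case False
  have "(\<Sum>x\<in>ZN. ev (m * x)) = (\<Sum>x\<in>ZN. ev (m * (x + 1)))"
    by (rule sum_shift[OF per_ev, symmetric])
  also have "\<dots> = ev m * (\<Sum>x\<in>ZN. ev (m * x))"
    by (simp add: distrib_left ev_add sum_distrib_left mult.commute)
  finally have "(1 - ev m) * (\<Sum>x\<in>ZN. ev (m * x)) = 0" by (simp add: algebra_simps)
  then show ?thesis using False ev_eq_1_iff by auto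
qed

lemma sum_ev_diff:
  assumes "x \<in> ZN" "y \<in> ZN"
  shows "(\<Sum>b\<in>ZN. ev ((x - y) * b)) = (if x = y then of_nat N else 0)"
proof -
  have "int N dvd x - y \<longleftrightarrow> x = y"
    using assms by (auto simp flip: mod_eq_dvd_iff)
  then show ?thesis by (simp add: sum_ev)
qed

lemma parseval: "(\<Sum>b\<in>ZN. (cmod (\<Sum>x\<in>ZN. f x * ev (- b * x)))\<^sup>2) = real N * (\<Sum>x\<in>ZN. (cmod (f x))\<^sup>2)"
proof -
  have ev: "ev ((y - x) * b) = ev (- b * x) * cnj (ev (- b * y))" for x y b
    by (simp add: algebra_simps flip: ev_minus ev_add)
  have "complex_of_real (\<Sum>b\<in>ZN. (cmod (\<Sum>x\<in>ZN. f x * ev (- b * x)))\<^sup>2)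
      = (\<Sum>b\<in>ZN. \<Sum>x\<in>ZN. \<Sum>y\<in>ZN. f x * cnj (f y) * ev ((y - x) * b))"
    unfolding of_real_sum complex_norm_square cnj_sum sum_product ev
    by (simp add: mult_ac)
  also have "\<dots> = (\<Sum>x\<in>ZN. \<Sum>b\<in>ZN. \<Sum>y\<in>ZN. f x * cnj (f y) * ev ((y - x) * b))"
    by (rule sum.swap)
  also have "\<dots> = (\<Sum>x\<in>ZN. \<Sum>y\<in>ZN. f x * cnj (f y) * (\<Sum>b\<in>ZN. ev ((y - x) * b)))"
    unfolding sum_distrib_left by (rule sum.cong[OF refl], rule sum.swap)
  also have "\<dots> = (\<Sum>x\<in>ZN. \<Sum>y\<in>ZN. if y = x then of_nat N * (f x * cnj (f x)) else 0)"
    by (intro sum.cong refl) (simp add: sum_ev_diff)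
  also have "\<dots> = complex_of_real (real N * (\<Sum>x\<in>ZN. (cmod (f x))\<^sup>2))"
    unfolding of_real_mult of_real_sum complex_norm_square by (simp add: sum_distrib_left)
  finally show ?thesis by (simp only: of_real_eq_iff)
qed

section \<open>Ping-pong on the torus\<close>

definition near :: "int \<Rightarrow> bool" where
  "near b \<longleftrightarrow> (\<exists>\<beta>. int N dvd b - \<beta> \<and> 8 * \<bar>\<beta>\<bar> < int N)"

text \<open>A balanced residue of modulus at least N/8 means an angle of at least pi/4, and 2 - 2
  cos (pi/4) = 2 - sqrt 2 exceeds 1/2.\<close>

lemma far_ev: assumes "\<not> near b" shows "(cmod (ev b - 1))\<^sup>2 \<ge> 1/2"
proof -
  define \<beta> where "\<beta> = (if 2 * (b mod int N) \<le> int N then b mod int N else b mod int N - int N)"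
  have "b mod int N < int N" "b mod int N \<ge> 0" using N by auto
  then have \<beta>: "2 * \<bar>\<beta>\<bar> \<le> int N" by (auto simp: \<beta>_def)
  have "b = \<beta> + int N * (b div int N + (if 2 * (b mod int N) \<le> int N then 0 else 1))"
    by (auto simp: \<beta>_def algebra_simps)
  then obtain k where k: "b = \<beta> + int N * k" by blast
  then have ev: "ev b = ev \<beta>" by (simp add: ev_add)
  have "int N dvd b - \<beta>" using k by simp
  then have "8 * \<bar>\<beta>\<bar> \<ge> int N" using assms unfolding near_def by (meson not_le)
  then have "8 * real_of_int \<bar>\<beta>\<bar> \<ge> real N" by (metis of_int_le_iff of_int_mult of_int_numeral of_int_of_nat_eq)
  moreover have "2 * real_of_int \<bar>\<beta>\<bar> \<le> real N" using \<beta> by (metis of_int_le_iff of_int_mult of_int_numeral of_int_of_nat_eq)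
  moreover define \<theta> where "\<theta> = 2 * pi * of_int \<bar>\<beta>\<bar> / real N"
  ultimately have th: "pi / 4 \<le> \<theta>" "\<theta> \<le> pi" using N by (auto simp: \<theta>_def field_simps)
  have "cos \<theta> \<le> cos (pi / 4)" using th by (intro cos_monotone_0_pi_le) auto
  also have "\<dots> \<le> 3/4"
  proof -
    have "sqrt 2 \<le> 3/2" by (rule real_le_lsqrt) (auto simp: power2_eq_square)
    then show ?thesis by (simp add: cos_45)
  qed
  finally have "cos \<theta> \<le> 3/4" .
  moreover have "cos (2 * pi * of_int \<beta> / real N) = cos \<theta>"
    by (cases "\<beta> \<ge> 0") (auto simp: \<theta>_def)
  moreover have "(cmod (cis x - 1))\<^sup>2 = 2 - 2 * cos x" for x
  proof -
    have "(cmod (cis x - 1))\<^sup>2 = (cos x)\<^sup>2 + (sin x)\<^sup>2 + 1 - 2 * cos x"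
      unfolding cmod_power2 by (simp add: power2_eq_square algebra_simps)
    then show ?thesis by simp
  qed
  ultimately show ?thesis unfolding ev by (simp add: ev_def)
qed

text \<open>Pairs with small representatives of slope in \<open>[-1, 1)\<close>. Shearing by \<open>\<plusminus>2\<close> moves the slopes to
  \<open>[1, 3)\<close> and \<open>[-3, -1)\<close> without wrapping around the torus.\<close>

definition sector :: "int \<Rightarrow> int \<Rightarrow> bool" where
  "sector a b \<longleftrightarrow> (\<exists>\<alpha> \<beta>. int N dvd a - \<alpha> \<and> int N dvd b - \<beta> \<and> 8 * \<bar>\<alpha>\<bar> < int N \<and> 8 * \<bar>\<beta>\<bar> < int N \<and>
    (0 < \<alpha> \<and> - \<alpha> \<le> \<beta> \<and> \<beta> < \<alpha> \<or> \<alpha> < 0 \<and> \<alpha> < \<beta> \<and> \<beta> \<le> - \<alpha>))"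

lemma dvd_small: "int N dvd x \<Longrightarrow> \<bar>x\<bar> < int N \<Longrightarrow> x = 0"
  using zdvd_imp_le[of "int N" "\<bar>x\<bar>"] by (cases "x = 0") auto

text \<open>With representatives below N/8 in modulus, \<beta>' - \<beta> - k \<alpha> stays below
  (1/8 + 1/8 + 4/8) N, so the congruence is an equality of integers and slopes really shift by
  \<open>k\<close>. The value 4 compares the shears by 2 and by -2 with each other.\<close>

lemma sector_disjoint:
  assumes "sector a b" "sector a (b + k * a)" "k \<in> {2, 4}" shows False
proof -
  obtain \<alpha> \<beta> where 1: "int N dvd a - \<alpha>" "int N dvd b - \<beta>" "8 * \<bar>\<alpha>\<bar> < int N" "8 * \<bar>\<beta>\<bar> < int N"
    "0 < \<alpha> \<and> - \<alpha> \<le> \<beta> \<and> \<beta> < \<alpha> \<or> \<alpha> < 0 \<and> \<alpha> < \<beta> \<and> \<beta> \<le> - \<alpha>"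
    using assms(1) unfolding sector_def by blast
  obtain \<alpha>' \<beta>' where 2: "int N dvd a - \<alpha>'" "int N dvd b + k * a - \<beta>'" "8 * \<bar>\<alpha>'\<bar> < int N" "8 * \<bar>\<beta>'\<bar> < int N"
    "0 < \<alpha>' \<and> - \<alpha>' \<le> \<beta>' \<and> \<beta>' < \<alpha>' \<or> \<alpha>' < 0 \<and> \<alpha>' < \<beta>' \<and> \<beta>' \<le> - \<alpha>'"
    using assms(2) unfolding sector_def by blast
  have "int N dvd (a - \<alpha>) - (a - \<alpha>')" using 1(1) 2(1) by (rule dvd_diff)
  then have "\<alpha>' - \<alpha> = 0" using 1 2 by (intro dvd_small) (auto simp: algebra_simps)
  moreover have "int N dvd (b - \<beta>) + k * (a - \<alpha>) - (b + k * a - \<beta>')"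
    by (rule dvd_diff[OF dvd_add[OF 1(2) dvd_mult[OF 1(1)]] 2(2)])
  then have "\<beta>' - \<beta> - k * \<alpha> = 0"
    using 1 2 assms(3) by (intro dvd_small) (auto simp: algebra_simps)
  ultimately show False using 1 2 assms(3) by auto
qed

text \<open>The half-open sector and its quarter turn partition the plane without the
  origin.\<close>

lemma near_cover:
  assumes "near a" "near b" "\<not> (int N dvd a \<and> int N dvd b)"
  shows "sector a b \<or> sector b (- a)"
proof -
  obtain \<alpha> \<beta> where 1: "int N dvd a - \<alpha>" "int N dvd b - \<beta>" "8 * \<bar>\<alpha>\<bar> < int N" "8 * \<bar>\<beta>\<bar> < int N"
    using assms unfolding near_def by blast
  have "\<alpha> \<noteq> 0 \<or> \<beta> \<noteq> 0" using 1 assms(3) by auto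
  then have "(0 < \<alpha> \<and> - \<alpha> \<le> \<beta> \<and> \<beta> < \<alpha> \<or> \<alpha> < 0 \<and> \<alpha> < \<beta> \<and> \<beta> \<le> - \<alpha>) \<or>
    (0 < \<beta> \<and> - \<beta> \<le> -\<alpha> \<and> -\<alpha> < \<beta> \<or> \<beta> < 0 \<and> \<beta> < -\<alpha> \<and> -\<alpha> \<le> - \<beta>)" by linarith
  moreover have "int N dvd - a - (- \<alpha>)" using 1(1) by (metis dvd_minus_iff minus_diff_minus)
  ultimately show ?thesis using 1 unfolding sector_def by (metis abs_minus_cancel)
qed

lemma per_dvd: "int N dvd (b + int N) - \<beta> \<longleftrightarrow> int N dvd b - \<beta>"
  by (metis add_diff_eq add.commute dvd_add_triv_left_iff)

text \<open>Regard m^2 as a mass of total \<open>M\<close>. Little of it sits at far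
  \<open>b\<close>, and by rotation little at far \<open>a\<close>. Three disjoint sheared copies
  leave the sector at most about M/3, while the sector and its quarter turn cover the near pairs
  other than the origin. So \<open>M\<close> is at most two thirds of itself up to errors.\<close>

lemma torus_gap:
  fixes m :: "int \<Rightarrow> int \<Rightarrow> real"
  assumes per1: "\<And>b. per (\<lambda>a. m a b)" and per2: "\<And>a. per (\<lambda>b. m a b)"
    and m0: "m 0 0 = 0" and d: "d \<ge> 0"
    and h1: "(\<Sum>a\<in>ZN. \<Sum>b\<in>ZN. (cmod (ev b - 1))\<^sup>2 * (m a b)\<^sup>2) \<le> d\<^sup>2"
    and h2: "(\<Sum>a\<in>ZN. \<Sum>b\<in>ZN. (m a (b - 2 * a) - m a b)\<^sup>2) \<le> d\<^sup>2"
    and h3: "(\<Sum>a\<in>ZN. \<Sum>b\<in>ZN. (m b (- a) - m a b)\<^sup>2) \<le> d\<^sup>2"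
  shows "(\<Sum>a\<in>ZN. \<Sum>b\<in>ZN. (m a b)\<^sup>2) \<le> 441 * d\<^sup>2"
proof -
  define M where "M = (\<Sum>a\<in>ZN. \<Sum>b\<in>ZN. (m a b)\<^sup>2)"
  define \<mu> where "\<mu> \<phi> = (\<Sum>a\<in>ZN. \<Sum>b\<in>ZN. of_bool (\<phi> a b) * (m a b)\<^sup>2)" for \<phi> :: "int \<Rightarrow> int \<Rightarrow> bool"
  define \<kappa> where "\<kappa> = 2 * d * sqrt M"
  have M0: "M \<ge> 0" unfolding M_def by (auto intro!: sum_nonneg)
  have shear: "(\<Sum>a\<in>ZN. \<Sum>b\<in>ZN. f a (b + k * a)) = (\<Sum>a\<in>ZN. \<Sum>b\<in>ZN. f a b)"
    if "\<And>a. per (f a)" for f :: "int \<Rightarrow> int \<Rightarrow> real" and k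
    by (intro sum.cong refl sum_shift that)
  have rot: "(\<Sum>a\<in>ZN. \<Sum>b\<in>ZN. f b (- a)) = (\<Sum>a\<in>ZN. \<Sum>b\<in>ZN. f a b)"
    if "\<And>a. per (f a)" for f :: "int \<Rightarrow> int \<Rightarrow> real"
    by (subst sum.swap) (intro sum.cong refl sum_reflect that)
  have pm: "per (\<lambda>b. (m a b)\<^sup>2)" for a using per2 by (simp add: per_def)
  have cmp: "\<bar>\<mu> \<phi> - \<mu> \<psi>\<bar> \<le> \<kappa>" if "(\<Sum>a\<in>ZN. \<Sum>b\<in>ZN. (u a b - m a b)\<^sup>2) \<le> d\<^sup>2"
    "(\<Sum>a\<in>ZN. \<Sum>b\<in>ZN. (u a b)\<^sup>2) = M" "\<mu> \<phi> = (\<Sum>a\<in>ZN. \<Sum>b\<in>ZN. of_bool (\<psi> a b) * (u a b)\<^sup>2)" for \<phi> \<psi> u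
  proof -
    have "\<mu> \<phi> - \<mu> \<psi> = (\<Sum>a\<in>ZN. \<Sum>b\<in>ZN. of_bool (\<psi> a b) * ((u a b)\<^sup>2 - (m a b)\<^sup>2))"
      unfolding that(3) \<mu>_def[of \<psi>] by (simp only: sum_subtractf right_diff_distrib)
    also have "\<bar>\<dots>\<bar> \<le> (\<Sum>a\<in>ZN. \<Sum>b\<in>ZN. \<bar>of_bool (\<psi> a b) * ((u a b)\<^sup>2 - (m a b)\<^sup>2)\<bar>)"
      by (rule order_trans[OF sum_abs sum_mono[OF sum_abs]])
    also have "\<dots> \<le> (\<Sum>a\<in>ZN. \<Sum>b\<in>ZN. \<bar>(u a b)\<^sup>2 - (m a b)\<^sup>2\<bar>)"
      by (rule sum_mono, rule sum_mono) auto
    also have "\<dots> \<le> \<kappa>"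
      unfolding \<kappa>_def using that(1,2) d by (intro sum_diff_squares_le) (auto simp: M_def)
    finally show ?thesis .
  qed
  have per_sector: "per (sector a)" for a by (simp add: per_def sector_def per_dvd)
  have pernear: "per near" by (simp add: per_def near_def per_dvd)
  have p\<mu>: "per (\<lambda>b. of_bool (\<phi> a b) * (m a b)\<^sup>2)" if "\<And>a. per (\<phi> a)" for \<phi> a
    using that per2 by (simp add: per_def)
  have sh: "\<bar>\<mu> sector - \<mu> (\<lambda>a b. sector a (b + k * a))\<bar> \<le> \<kappa>" if "k = 2 \<or> k = - 2" for k
  proof (rule cmp[of "\<lambda>a b. m a (b + k * a)"])
    show "(\<Sum>a\<in>ZN. \<Sum>b\<in>ZN. (m a (b + k * a) - m a b)\<^sup>2) \<le> d\<^sup>2"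
    proof (cases "k = 2")
      case True
      have "(\<Sum>a\<in>ZN. \<Sum>b\<in>ZN. (m a (b - 2 * a) - m a b)\<^sup>2) =
        (\<Sum>a\<in>ZN. \<Sum>b\<in>ZN. (m a ((b + 2 * a) - 2 * a) - m a (b + 2 * a))\<^sup>2)"
        by (rule shear[symmetric]) (use per2 in \<open>simp add: per_def flip: diff_add_eq\<close>)
      then show ?thesis using h2 True by (simp add: power2_commute)
    qed (use h2 that in auto)
    show "(\<Sum>a\<in>ZN. \<Sum>b\<in>ZN. (m a (b + k * a))\<^sup>2) = M"
      unfolding M_def by (rule shear[OF pm])
    show "\<mu> sector = (\<Sum>a\<in>ZN. \<Sum>b\<in>ZN. of_bool (sector a (b + k * a)) * (m a (b + k * a))\<^sup>2)"
      unfolding \<mu>_def by (rule shear[symmetric, OF p\<mu>[OF per_sector]])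
  qed
  have ro: "\<bar>\<mu> \<phi> - \<mu> (\<lambda>a b. \<phi> b (- a))\<bar> \<le> \<kappa>" if "\<And>a. per (\<phi> a)" for \<phi>
  proof (rule cmp[OF h3])
    show "(\<Sum>a\<in>ZN. \<Sum>b\<in>ZN. (m b (- a))\<^sup>2) = M"
      unfolding M_def by (rule rot[OF pm])
    show "\<mu> \<phi> = (\<Sum>a\<in>ZN. \<Sum>b\<in>ZN. of_bool (\<phi> b (- a)) * (m b (- a))\<^sup>2)"
      unfolding \<mu>_def by (rule rot[symmetric, OF p\<mu>[OF that]])
  qed
  have V3: "\<mu> sector + \<mu> (\<lambda>a b. sector a (b + 2 * a)) + \<mu> (\<lambda>a b. sector a (b + (-2) * a)) \<le> M"
  proof -
    have "of_bool (sector a b) + of_bool (sector a (b + 2 * a)) + of_bool (sector a (b + (-2) * a)) \<le> (1::real)" for a b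
      using sector_disjoint[of a b 2] sector_disjoint[of a "b + (-2) * a" 2] sector_disjoint[of a "b + (-2) * a" 4]
      by (auto simp: algebra_simps)
    then have "(of_bool (sector a b) + of_bool (sector a (b + 2 * a)) + of_bool (sector a (b + (-2) * a))) * (m a b)\<^sup>2 \<le> 1 * (m a b)\<^sup>2" for a b
      by (intro mult_right_mono) auto
    then show ?thesis unfolding \<mu>_def M_def sum.distrib[symmetric] distrib_right[symmetric]
      by (intro sum_mono) simp
  qed
  have farb: "\<mu> (\<lambda>a b. \<not> near b) \<le> 2 * d\<^sup>2"
  proof -
    have "\<mu> (\<lambda>a b. \<not> near b) \<le> (\<Sum>a\<in>ZN. \<Sum>b\<in>ZN. 2 * ((cmod (ev b - 1))\<^sup>2 * (m a b)\<^sup>2))"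
      unfolding \<mu>_def
    proof (intro sum_mono)
      fix a b
      show "of_bool (\<not> near b) * (m a b)\<^sup>2 \<le> 2 * ((cmod (ev b - 1))\<^sup>2 * (m a b)\<^sup>2)"
        using mult_right_mono[OF far_ev[of b], of "(m a b)\<^sup>2"] by (cases "near b") auto
    qed
    also have "\<dots> \<le> 2 * d\<^sup>2" using h1 by (simp flip: sum_distrib_left)
    finally show ?thesis .
  qed
  have "near (- a) \<longleftrightarrow> near a" for a
    unfolding near_def by (metis abs_minus_cancel dvd_minus_iff minus_diff_minus minus_minus)
  then have fara: "\<mu> (\<lambda>a b. \<not> near a) \<le> 2 * d\<^sup>2 + \<kappa>"
    using ro[of "\<lambda>a b. \<not> near b"] farb pernear by (simp add: per_def)
  have "M \<le> \<mu> (\<lambda>a b. \<not> near a) + \<mu> (\<lambda>a b. \<not> near b) + \<mu> sector + \<mu> (\<lambda>a b. sector b (- a))"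
    unfolding M_def \<mu>_def sum.distrib[symmetric] distrib_right[symmetric]
  proof (intro sum_mono)
    fix a b assume ab: "a \<in> ZN" "b \<in> ZN"
    show "(m a b)\<^sup>2 \<le> (of_bool (\<not> near a) + of_bool (\<not> near b) + of_bool (sector a b) + of_bool (sector b (- a))) * (m a b)\<^sup>2"
    proof (cases "a = 0 \<and> b = 0")
      case False
      then have "\<not> (int N dvd a \<and> int N dvd b)" using ab by (auto dest: zdvd_imp_le)
      then have "1 \<le> (of_bool (\<not> near a) + of_bool (\<not> near b) + of_bool (sector a b) + of_bool (sector b (- a)) :: real)"
        using near_cover[of a b] by auto
      then show ?thesis using mult_right_mono[of 1 _ "(m a b)\<^sup>2"] by simp
    qed (use m0 in auto)
  qed
  \<comment> \<open>Combine 3 \<mu>(sector) \<le> M + 2 \<kappa> with M \<le> 4 d^2 + 2 \<kappa> + 2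
    \<mu>(sector).\<close>
  then have "M \<le> 12 * d\<^sup>2 + 10 * \<kappa>"
    using fara farb V3 sh[of 2] sh[of "-2"] ro[of sector, OF per_sector] by linarith
  then have le: "(sqrt M)\<^sup>2 \<le> 12 * d\<^sup>2 + 20 * d * sqrt M" using M0 by (simp add: \<kappa>_def)
  \<comment> \<open>The largest solution of x^2 = 12 d^2 + 20 d x is about 20.6 d, whence 21, and
    441 = 21^2.\<close>
  have "sqrt M \<le> 21 * d"
  proof (rule ccontr)
    assume c: "\<not> sqrt M \<le> 21 * d"
    then have "21 * d * sqrt M \<le> sqrt M * sqrt M" using M0 by (intro mult_right_mono) auto
    with le have "d * sqrt M \<le> 12 * (d * d)" by (simp add: power2_eq_square)
    moreover have "21 * d * d \<le> sqrt M * d" using c d by (intro mult_right_mono) auto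
    ultimately have "d * d \<le> 0" by (simp add: mult.commute)
    then have "d = 0" using d by (auto simp: mult_le_0_iff)
    then show False using le c M0 by simp
  qed
  then have "(sqrt M)\<^sup>2 \<le> (21 * d)\<^sup>2" using M0 by (intro power_mono) auto
  then show ?thesis using M0 by (simp add: M_def[symmetric] power_mult_distrib)
qed

text \<open>The Fourier transform along the \<open>a\<close>-th cyclic diagonal: up to
  normalization, the coefficient of \<open>T\<close> at translation by \<open>a\<close> composed
  with modulation by \<open>b\<close>.\<close>

definition weyl :: "(int \<Rightarrow> int \<Rightarrow> complex) \<Rightarrow> int \<Rightarrow> int \<Rightarrow> complex" where
  "weyl T a b = (\<Sum>x\<in>ZN. T (x + a) x * ev (- b * x))"

definition fro :: "(int \<Rightarrow> int \<Rightarrow> complex) \<Rightarrow> real" where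
  "fro T = (\<Sum>x\<in>ZN. \<Sum>y\<in>ZN. (cmod (T x y))\<^sup>2)"

lemma sum_weyl:
  assumes "\<And>y. per (\<lambda>x. T x y)"
  shows "(\<Sum>a\<in>ZN. \<Sum>b\<in>ZN. (cmod (weyl T a b))\<^sup>2) = real N * fro T"
proof -
  have "(\<Sum>a\<in>ZN. \<Sum>b\<in>ZN. (cmod (weyl T a b))\<^sup>2) = (\<Sum>a\<in>ZN. real N * (\<Sum>x\<in>ZN. (cmod (T (x + a) x))\<^sup>2))"
    unfolding weyl_def by (simp only: parseval)
  also have "\<dots> = real N * (\<Sum>x\<in>ZN. \<Sum>a\<in>ZN. (cmod (T (a + x) x))\<^sup>2)"
    unfolding sum_distrib_left[symmetric] by (subst sum.swap) (simp only: add.commute)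
  also have "\<dots> = real N * (\<Sum>x\<in>ZN. \<Sum>a\<in>ZN. (cmod (T a x))\<^sup>2)"
    using assms by (subst sum_shift) (auto simp: per_def)
  also have "\<dots> = real N * fro T" unfolding fro_def by (subst sum.swap) (rule refl)
  finally show ?thesis .
qed

lemma weyl_diff: "weyl (\<lambda>x y. T x y - U x y) a b = weyl T a b - weyl U a b"
  by (simp add: weyl_def left_diff_distrib sum_subtractf)

lemma fro_nonneg: "fro T \<ge> 0"
  by (auto simp: fro_def intro!: sum_nonneg)

lemma weyl_translate:
  assumes "\<And>y. per (\<lambda>x. T x y)" "\<And>x. per (T x)"
  shows "weyl (\<lambda>x y. T (x - 1) (y - 1)) a b = ev (- b) * weyl T a b"
proof -
  have p: "per (\<lambda>x. T (x - 1 + a) (x - 1) * ev (- b * x))"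
    using assms per_ev[of "- b"] unfolding per_def
    by (simp add: algebra_simps) (metis add.commute add.left_commute add_diff_eq)
  have e1: "ev (- b * (x + 1)) = ev (- b) * ev (- b * x)" for x
    unfolding ev_add[symmetric] by (simp add: algebra_simps)
  have "weyl (\<lambda>x y. T (x - 1) (y - 1)) a b = (\<Sum>x\<in>ZN. T (x - 1 + a) (x - 1) * ev (- b * x))"
    by (simp add: weyl_def algebra_simps)
  also have "\<dots> = (\<Sum>x\<in>ZN. T ((x + 1) - 1 + a) ((x + 1) - 1) * ev (- b * (x + 1)))"
    by (rule sum_shift[OF p, symmetric])
  also have "\<dots> = ev (- b) * weyl T a b"
    unfolding e1 weyl_def sum_distrib_left by (simp add: mult_ac)
  finally show ?thesis .
qed

text \<open>The phase is x^2 rather than x^2/2, which makes it well defined modulo every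
  \<open>N\<close>, even or odd. The resulting shear is by 2a, matching the width 2 of the slope
  interval of \<open>sector\<close>.\<close>

lemma weyl_quadratic:
  "weyl (\<lambda>x y. ev (x\<^sup>2 - y\<^sup>2) * T x y) a b = ev (a\<^sup>2) * weyl T a (b - 2 * a)"
  unfolding weyl_def sum_distrib_left
proof (rule sum.cong[OF refl])
  fix x
  have "ev ((x + a)\<^sup>2 - x\<^sup>2) * ev (- b * x) = ev (a\<^sup>2) * ev (- (b - 2 * a) * x)"
    by (simp add: power2_eq_square algebra_simps flip: ev_add)
  then show "ev ((x + a)\<^sup>2 - x\<^sup>2) * T (x + a) x * ev (- b * x) = ev (a\<^sup>2) * (T (x + a) x * ev (- (b - 2 * a) * x))"
    by (simp add: mult_ac)
qed

lemma weyl_fourier: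
  assumes "\<And>y. per (\<lambda>x. T x y)"
  shows "weyl (\<lambda>x y. (\<Sum>v\<in>ZN. \<Sum>u\<in>ZN. ev (x * u) * T u v * ev (- v * y)) / of_nat N) a b
    = ev (a * b) * weyl T b (- a)"
proof -
  have ev: "ev ((x + a) * u) * ev (- v * x) * ev (- b * x) = ev (a * u) * ev ((u - v - b) * x)" for x u v
    by (simp add: algebra_simps flip: ev_add)
  have "weyl (\<lambda>x y. (\<Sum>v\<in>ZN. \<Sum>u\<in>ZN. ev (x * u) * T u v * ev (- v * y)) / of_nat N) a b
    = (\<Sum>x\<in>ZN. \<Sum>v\<in>ZN. \<Sum>u\<in>ZN. (ev ((x + a) * u) * ev (- v * x) * ev (- b * x)) * T u v / of_nat N)"
    unfolding weyl_def sum_divide_distrib sum_distrib_right by (simp add: mult_ac)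
  also have "\<dots> = (\<Sum>x\<in>ZN. \<Sum>v\<in>ZN. \<Sum>u\<in>ZN. ev (a * u) * T u v / of_nat N * ev ((u - v - b) * x))"
    unfolding ev by (simp add: mult_ac)
  also have "\<dots> = (\<Sum>v\<in>ZN. \<Sum>x\<in>ZN. \<Sum>u\<in>ZN. ev (a * u) * T u v / of_nat N * ev ((u - v - b) * x))"
    by (rule sum.swap)
  also have "\<dots> = (\<Sum>v\<in>ZN. \<Sum>u\<in>ZN. ev (a * u) * T u v / of_nat N * (\<Sum>x\<in>ZN. ev ((u - v - b) * x)))"
    unfolding sum_distrib_left by (rule sum.cong[OF refl], rule sum.swap)
  \<comment> \<open>Orthogonality of characters forces u = v + b modulo \<open>N\<close>; shifting
    the \<open>u\<close>-sum by v + b puts the surviving term at u = 0, inside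
    \<open>ZN\<close>.\<close>
  also have "\<dots> = (\<Sum>v\<in>ZN. ev (a * (v + b)) * T (v + b) v)"
  proof (rule sum.cong[OF refl])
    fix v
    let ?g = "\<lambda>u. ev (a * u) * T u v / of_nat N * (\<Sum>x\<in>ZN. ev ((u - v - b) * x))"
    have p: "per ?g"
      unfolding per_def
    proof
      fix u
      have "ev ((u + int N - v - b) * x) = ev ((u - v - b) * x)" for x
      proof -
        have "(u + int N - v - b) * x = (u - v - b) * x + int N * x" by (simp add: algebra_simps)
        then show ?thesis by (simp only: ev_add ev_multiple) simp
      qed
      moreover have "ev (a * (u + int N)) = ev (a * u)" using per_ev by (simp add: per_def)
      ultimately show "?g (u + int N) = ?g u" using assms by (simp add: per_def)
    qed
    have "(\<Sum>u\<in>ZN. ?g u) = (\<Sum>u\<in>ZN. ?g (u + (v + b)))" by (rule sum_shift[OF p, symmetric])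
    also have "\<dots> = (\<Sum>u\<in>ZN. if u = 0 then ev (a * (v + b)) * T (v + b) v else 0)"
    proof (rule sum.cong[OF refl])
      fix u assume u: "u \<in> ZN"
      have "u + (v + b) - v - b = u - 0" by simp
      then show "?g (u + (v + b)) = (if u = 0 then ev (a * (v + b)) * T (v + b) v else 0)"
        using sum_ev_diff[of u 0] u N by simp
    qed
    also have "\<dots> = ev (a * (v + b)) * T (v + b) v" using N by simp
    finally show "(\<Sum>u\<in>ZN. ?g u) = ev (a * (v + b)) * T (v + b) v" .
  qed
  also have "\<dots> = ev (a * b) * weyl T b (- a)"
    by (simp add: weyl_def sum_distrib_left distrib_left ev_add mult_ac)
  finally show ?thesis .
qed

text \<open>Trace zero removes the coefficient at (0, 0), as \<open>torus_gap\<close> requires. The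
  three terms are commutators with the generators; each has the same norm as the difference between
  \<open>T\<close> and its conjugate, which the Weyl coefficients describe.\<close>

lemma weyl_gap:
  assumes p1: "\<And>y. per (\<lambda>x. T x y)" and p2: "\<And>x. per (T x)" and tr: "(\<Sum>x\<in>ZN. T x x) = 0"
  shows "fro T \<le> 441 * (fro (\<lambda>x y. T (x - 1) y - T x (y + 1)) + fro (\<lambda>x y. (ev (x\<^sup>2) - ev (y\<^sup>2)) * T x y)
    + fro (\<lambda>x y. ((\<Sum>u\<in>ZN. ev (x * u) * T u y) - (\<Sum>u\<in>ZN. T x u * ev (u * y))) / sqrt N))"
    (is "_ \<le> 441 * (?X + ?D + ?F)")
proof -
  define d where "d = sqrt (real N * (?X + ?D + ?F))"
  have pos: "?X \<ge> 0" "?D \<ge> 0" "?F \<ge> 0" by (rule fro_nonneg)+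
  have d2: "d\<^sup>2 = real N * (?X + ?D + ?F)" unfolding d_def using pos by (intro real_sqrt_pow2) auto
  define m where "m a b = cmod (weyl T a b)" for a b
  have le: "real N * ?X \<le> d\<^sup>2" "real N * ?D \<le> d\<^sup>2" "real N * ?F \<le> d\<^sup>2"
    unfolding d2 using pos by (auto intro!: mult_left_mono)
  \<comment> \<open>Conjugation also multiplies coefficients by phases. The reverse triangle
    inequality passes to the moduli \<open>m\<close>, where the phases vanish.\<close>
  have tri: "(cmod z - cmod w)\<^sup>2 \<le> (cmod (z - w))\<^sup>2" for z w :: complex
    using norm_triangle_ineq3[of z w] by (metis abs_le_square_iff abs_norm_cancel)
  have "(\<Sum>a\<in>ZN. \<Sum>b\<in>ZN. (m a b)\<^sup>2) \<le> 441 * d\<^sup>2"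
  proof (rule torus_gap)
    show "per (\<lambda>a. m a b)" for b
      using p1 unfolding per_def m_def weyl_def by (simp add: add.assoc[symmetric])
    show "per (m a)" for a
    proof -
      have "ev (- (b + int N) * x) = ev (- b * x)" for b x
      proof -
        have "- (b + int N) * x = - b * x + int N * (- x)" by (simp add: algebra_simps)
        then show ?thesis by (simp only: ev_add ev_multiple) simp
      qed
      then show ?thesis unfolding per_def m_def weyl_def by simp
    qed
    show "m 0 0 = 0" using tr by (simp add: m_def weyl_def)
    show "d \<ge> 0" unfolding d_def using pos by simp
    show "(\<Sum>a\<in>ZN. \<Sum>b\<in>ZN. (cmod (ev b - 1))\<^sup>2 * (m a b)\<^sup>2) \<le> d\<^sup>2"
    proof -
      let ?S = "\<lambda>x y. T (x - 1) (y - 1) - T x y"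
      have "cmod (ev b - 1) * m a b = cmod (weyl ?S a b)" for a b
      proof -
        have "weyl ?S a b = (ev (- b) - 1) * weyl T a b"
          unfolding weyl_diff weyl_translate[OF p1 p2] by (simp add: algebra_simps)
        moreover have "cmod (ev (- b) - 1) = cmod (ev b - 1)"
          unfolding ev_minus by (metis complex_cnj_diff complex_cnj_one complex_mod_cnj)
        ultimately show ?thesis by (simp add: m_def norm_mult)
      qed
      then have "(\<Sum>a\<in>ZN. \<Sum>b\<in>ZN. (cmod (ev b - 1))\<^sup>2 * (m a b)\<^sup>2) = (\<Sum>a\<in>ZN. \<Sum>b\<in>ZN. (cmod (weyl ?S a b))\<^sup>2)"
        by (simp only: power_mult_distrib[symmetric])
      also have "\<dots> = real N * fro ?S"
        by (rule sum_weyl) (use p1 in \<open>simp add: per_def flip: diff_add_eq\<close>)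
      also have "fro ?S = ?X"
      proof -
        have "(\<Sum>y\<in>ZN. (cmod (T (x - 1) y - T x (y + 1)))\<^sup>2) = (\<Sum>y\<in>ZN. (cmod (T (x - 1) (y + (- 1)) - T x (y + (- 1) + 1)))\<^sup>2)" for x
        proof (rule sum_shift[symmetric])
          have "T x (y + int N + 1) = T x (y + 1)" for y
            using p2[of x] unfolding per_def by (metis add.assoc add.commute)
          then show "per (\<lambda>y. (cmod (T (x - 1) y - T x (y + 1)))\<^sup>2)" using p2 by (simp add: per_def)
        qed
        then show ?thesis by (simp add: fro_def)
      qed
      finally show ?thesis using le by simp
    qed
    show "(\<Sum>a\<in>ZN. \<Sum>b\<in>ZN. (m a (b - 2 * a) - m a b)\<^sup>2) \<le> d\<^sup>2"
    proof -
      let ?S = "\<lambda>x y. ev (x\<^sup>2 - y\<^sup>2) * T x y - T x y"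
      have "(m a (b - 2 * a) - m a b)\<^sup>2 \<le> (cmod (weyl ?S a b))\<^sup>2" for a b
        using tri[of "ev (a\<^sup>2) * weyl T a (b - 2 * a)" "weyl T a b"]
        unfolding weyl_diff weyl_quadratic by (simp add: m_def norm_mult)
      then have "(\<Sum>a\<in>ZN. \<Sum>b\<in>ZN. (m a (b - 2 * a) - m a b)\<^sup>2) \<le> (\<Sum>a\<in>ZN. \<Sum>b\<in>ZN. (cmod (weyl ?S a b))\<^sup>2)"
        by (intro sum_mono)
      also have "\<dots> = real N * fro ?S"
      proof (rule sum_weyl)
        fix y
        have "ev ((x + int N)\<^sup>2 - y\<^sup>2) = ev (x\<^sup>2 - y\<^sup>2)" for x
        proof -
          have "(x + int N)\<^sup>2 - y\<^sup>2 = (x\<^sup>2 - y\<^sup>2) + int N * (2 * x + int N)" by (simp add: power2_eq_square algebra_simps)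
          then show ?thesis by (simp only: ev_add ev_multiple) simp
        qed
        then show "per (\<lambda>x. ev (x\<^sup>2 - y\<^sup>2) * T x y - T x y)" using p1 by (simp add: per_def)
      qed
      also have "fro ?S = ?D"
      proof -
        have "cmod (?S x y) = cmod ((ev (x\<^sup>2) - ev (y\<^sup>2)) * T x y)" for x y
        proof -
          have "ev (x\<^sup>2 - y\<^sup>2) * ev (y\<^sup>2) = ev (x\<^sup>2)" by (simp flip: ev_add)
          then have "(ev (x\<^sup>2) - ev (y\<^sup>2)) * T x y = ev (y\<^sup>2) * ?S x y" by (simp add: algebra_simps)
          then show ?thesis by (simp add: norm_mult)
        qed
        then show ?thesis by (simp add: fro_def)
      qed
      finally show ?thesis using le by simp
    qed
    show "(\<Sum>a\<in>ZN. \<Sum>b\<in>ZN. (m b (- a) - m a b)\<^sup>2) \<le> d\<^sup>2"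
    proof -
      let ?R = "\<lambda>x y. (\<Sum>v\<in>ZN. \<Sum>u\<in>ZN. ev (x * u) * T u v * ev (- v * y)) / of_nat N"
      let ?S = "\<lambda>x y. ?R x y - T x y"
      let ?G = "\<lambda>x y. ((\<Sum>u\<in>ZN. ev (x * u) * T u y) - (\<Sum>u\<in>ZN. T x u * ev (u * y))) / complex_of_real (sqrt N)"
      have "(m b (- a) - m a b)\<^sup>2 \<le> (cmod (weyl ?S a b))\<^sup>2" for a b
        using tri[of "ev (a * b) * weyl T b (- a)" "weyl T a b"]
        unfolding weyl_diff weyl_fourier[OF p1] by (simp add: m_def norm_mult)
      then have "(\<Sum>a\<in>ZN. \<Sum>b\<in>ZN. (m b (- a) - m a b)\<^sup>2) \<le> (\<Sum>a\<in>ZN. \<Sum>b\<in>ZN. (cmod (weyl ?S a b))\<^sup>2)"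
        by (intro sum_mono)
      also have "\<dots> = real N * fro ?S"
      proof (rule sum_weyl)
        fix y
        have "ev ((x + int N) * u) = ev (x * u)" for x u by (simp add: distrib_right ev_add)
        then show "per (\<lambda>x. ?S x y)" using p1 by (simp add: per_def)
      qed
      also have "fro ?S = ?F"
      proof -
        have sN: "complex_of_real (sqrt N) * complex_of_real (sqrt N) = of_nat N"
          by (simp flip: of_real_mult)
        \<comment> \<open>Multiplying the Fourier commutator on the right by the inverse Fourier
          matrix gives conjugate minus \<open>T\<close>; Plancherel along the rows then equates the
          norms.\<close>
        have S: "?S x y = (\<Sum>v\<in>ZN. ?G x v * ev (- y * v)) / complex_of_real (sqrt N)" if y: "y \<in> ZN" for x y
        proof -
          have e2: "ev ((u - y) * v) = ev (u * v) * ev (- y * v)" for u v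
            unfolding ev_add[symmetric] by (simp add: algebra_simps)
          have "(\<Sum>v\<in>ZN. (\<Sum>u\<in>ZN. T x u * ev (u * v)) * ev (- y * v)) = (\<Sum>v\<in>ZN. \<Sum>u\<in>ZN. T x u * ev ((u - y) * v))"
            unfolding e2 sum_distrib_right by (simp only: mult.assoc)
          also have "\<dots> = (\<Sum>u\<in>ZN. T x u * (\<Sum>v\<in>ZN. ev ((u - y) * v)))"
            unfolding sum_distrib_left by (rule sum.swap)
          also have "\<dots> = (\<Sum>u\<in>ZN. if u = y then of_nat N * T x y else 0)"
            by (intro sum.cong refl) (use y in \<open>simp add: sum_ev_diff\<close>)
          also have "\<dots> = of_nat N * T x y" using y by simp
          finally have 1: "(\<Sum>v\<in>ZN. (\<Sum>u\<in>ZN. T x u * ev (u * v)) * ev (- y * v)) = of_nat N * T x y" .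
          have 2: "(\<Sum>v\<in>ZN. (\<Sum>u\<in>ZN. ev (x * u) * T u v) * ev (- y * v)) = of_nat N * ?R x y"
            unfolding sum_distrib_right using N by (simp add: mult_ac)
          have "(\<Sum>v\<in>ZN. ?G x v * ev (- y * v)) / complex_of_real (sqrt N)
            = ((\<Sum>v\<in>ZN. (\<Sum>u\<in>ZN. ev (x * u) * T u v) * ev (- y * v)) - (\<Sum>v\<in>ZN. (\<Sum>u\<in>ZN. T x u * ev (u * v)) * ev (- y * v)))
              / (complex_of_real (sqrt N) * complex_of_real (sqrt N))"
            by (simp add: sum_subtractf left_diff_distrib diff_divide_distrib flip: sum_divide_distrib)
          also have "\<dots> = ?S x y" unfolding 1 2 sN using N by (simp add: diff_divide_distrib)
          finally show ?thesis by simp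
        qed
        have "(\<Sum>y\<in>ZN. (cmod (?S x y))\<^sup>2) = (\<Sum>y\<in>ZN. (cmod (?G x y))\<^sup>2)" for x
        proof -
          have "(\<Sum>y\<in>ZN. (cmod (?S x y))\<^sup>2) = (\<Sum>y\<in>ZN. (cmod (\<Sum>v\<in>ZN. ?G x v * ev (- y * v)))\<^sup>2 / N)"
            by (rule sum.cong[OF refl], subst S) (auto simp: norm_divide power_divide)
          also have "\<dots> = (\<Sum>y\<in>ZN. (cmod (?G x y))\<^sup>2)"
            unfolding sum_divide_distrib[symmetric] parseval using N by simp
          finally show ?thesis .
        qed
        then show ?thesis by (simp add: fro_def)
      qed
      finally show ?thesis using le by simp
    qed
  qed
  then have "real N * fro T \<le> real N * (441 * (?X + ?D + ?F))"
    unfolding m_def sum_weyl[OF p1] d2 by (simp add: algebra_simps)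
  then show ?thesis using N by simp
qed

end

section \<open>Block matrices and the quantum gap\<close>

lift_definition blk :: "'a \<Rightarrow> 'a \<Rightarrow> ('a \<times> 'b) fmat \<Rightarrow> 'b fmat" is
  "\<lambda>a b f p q. f (a, p) (b, q)"
proof -
  fix a b and f :: "'a \<times> 'b \<Rightarrow> 'a \<times> 'b \<Rightarrow> complex"
  assume "\<exists>S. finite S \<and> (\<forall>x y. f x y \<noteq> 0 \<longrightarrow> x \<in> S \<and> y \<in> S)"
  then obtain S where S: "finite S" "\<And>x y. f x y \<noteq> 0 \<Longrightarrow> x \<in> S \<and> y \<in> S"
    by (elim exE conjE) (simp del: split_paired_All)
  have "p \<in> snd ` S \<and> q \<in> snd ` S" if "f (a, p) (b, q) \<noteq> 0" for p q
    using S(2)[OF that] by force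
  then show "\<exists>S. finite S \<and> (\<forall>x y. f (a, x) (b, y) \<noteq> 0 \<longrightarrow> x \<in> S \<and> y \<in> S)"
    using S(1) by (intro exI[of _ "snd ` S"]) simp
qed

lemma ent_blk [simp]: "ent (blk a b V) p q = ent V (a, p) (b, q)"
  by transfer simp

lemma blk_simps [simp]:
  "blk a b (V + W) = blk a b V + blk a b W" "blk a b (V - W) = blk a b V - blk a b W"
  "blk a b (star V) = star (blk b a V)"
  by (rule fmat_eqI; simp)+

lemma supported_blk: "supported (A \<times> S) V \<Longrightarrow> finite S \<Longrightarrow> supported S (blk a b V)"
  by (auto simp: supported_def)

lemma blk_outside: "supported (A \<times> S) V \<Longrightarrow> a \<notin> A \<or> b \<notin> A \<Longrightarrow> blk a b V = 0"
  by (rule fmat_eqI) (auto intro: ent_outside)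

lemma blk_eqI: "(\<And>a b. blk a b V = blk a b W) \<Longrightarrow> V = W"
proof (rule fmat_eqI)
  fix x y assume "\<And>a b. blk a b V = blk a b W"
  then have "ent (blk (fst x) (fst y) V) (snd x) (snd y) = ent (blk (fst x) (fst y) W) (snd x) (snd y)" by simp
  then show "ent V x y = ent W x y" by simp
qed

lemma ent_sum: "ent (\<Sum>i\<in>I. f i) x y = (\<Sum>i\<in>I. ent (f i) x y)"
  by (induction I rule: infinite_finite_induct) auto

lemma blk_times:
  assumes V: "supported (A \<times> S) V" and S: "finite S"
  shows "blk a b (V * W) = (\<Sum>c\<in>A. blk a c V * blk c b W)"
proof (rule fmat_eqI)
  fix p q
  have "ent (blk a b (V * W)) p q = (\<Sum>c\<in>A. \<Sum>u\<in>S. ent V (a, p) (c, u) * ent W (c, u) (b, q))"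
    unfolding sum.cartesian_product by (simp add: ent_times[OF V] case_prod_beta)
  also have "\<dots> = ent (\<Sum>c\<in>A. blk a c V * blk c b W) p q"
    by (simp add: ent_sum ent_times[OF supported_blk[OF V S]])
  finally show "ent (blk a b (V * W)) p q = ent (\<Sum>c\<in>A. blk a c V * blk c b W) p q" .
qed

lemma norm_sq_blk:
  assumes V: "supported (A \<times> S) V" and S: "finite S"
  shows "(norm V)\<^sup>2 = (\<Sum>a\<in>A. \<Sum>b\<in>A. (norm (blk a b V))\<^sup>2)"
proof -
  have "(norm V)\<^sup>2 = (\<Sum>a\<in>A. \<Sum>p\<in>S. \<Sum>b\<in>A. \<Sum>q\<in>S. (cmod (ent V (a, p) (b, q)))\<^sup>2)"
    by (simp add: norm_fmat_sq[OF V] sum.cartesian_product')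
  also have "\<dots> = (\<Sum>a\<in>A. \<Sum>b\<in>A. \<Sum>p\<in>S. \<Sum>q\<in>S. (cmod (ent V (a, p) (b, q)))\<^sup>2)"
    by (rule sum.cong[OF refl], rule sum.swap)
  finally show ?thesis by (simp add: norm_fmat_sq[OF supported_blk[OF V S]])
qed

lemma norm_blk_le:
  assumes V: "supported (A \<times> S) V" and A: "finite A" and S: "finite S"
  shows "norm (blk a b V) \<le> norm V"
proof (cases "a \<in> A \<and> b \<in> A")
  case True
  have "(norm (blk a b V))\<^sup>2 \<le> (\<Sum>b\<in>A. (norm (blk a b V))\<^sup>2)"
    using True A by (intro member_le_sum) auto
  also have "\<dots> \<le> (norm V)\<^sup>2"
    unfolding norm_sq_blk[OF V S] using True A
    by (intro member_le_sum[of a A "\<lambda>a. \<Sum>b\<in>A. (norm (blk a b V))\<^sup>2"]) (auto intro: sum_nonneg)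
  finally show ?thesis by (rule power2_le_imp_le) simp
qed (use blk_outside[OF V] in auto)

definition asm :: "'a set \<Rightarrow> 'b set \<Rightarrow> ('a \<Rightarrow> 'a \<Rightarrow> 'b fmat) \<Rightarrow> ('a \<times> 'b) fmat" where
  "asm A S k = mk (A \<times> S) (\<lambda>x y. ent (k (fst x) (fst y)) (snd x) (snd y))"

lemma supported_asm: "finite A \<Longrightarrow> finite S \<Longrightarrow> supported (A \<times> S) (asm A S k)"
  by (simp add: asm_def supported_mk)

lemma blk_asm:
  assumes "finite A" "finite S" "supported S (k a b)"
  shows "blk a b (asm A S k) = (if a \<in> A \<and> b \<in> A then k a b else 0)"
  by (rule fmat_eqI) (use assms in \<open>auto simp: asm_def ent_mk ent_outside\<close>)

section \<open>Tensor products with an identity factor\<close>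

definition rgt :: "'a set \<Rightarrow> 'b set \<Rightarrow> 'b fmat \<Rightarrow> ('a \<times> 'b) fmat" where
  "rgt A S h = asm A S (\<lambda>a b. if a = b then h else 0)"

lemma supported_0: "finite S \<Longrightarrow> supported S 0"
  by (simp add: supported_def)

lemma supported_rgt: "finite A \<Longrightarrow> finite S \<Longrightarrow> supported (A \<times> S) (rgt A S h)"
  by (simp add: rgt_def supported_asm)

lemma blk_rgt:
  "finite A \<Longrightarrow> supported S h \<Longrightarrow> blk a b (rgt A S h) = (if a = b \<and> a \<in> A then h else 0)"
  unfolding rgt_def by (subst blk_asm) (auto simp: supported_finite supported_0)

lemma rgt_times:
  assumes "finite A" "supported S g" "supported S h"
  shows "rgt A S g * rgt A S h = rgt A S (g * h)"
proof (rule blk_eqI)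
  have S: "finite S" using assms supported_finite by blast
  fix a b
  have "blk a b (rgt A S g * rgt A S h) = (\<Sum>c\<in>A. if c = a then (if a = b then g * h else 0) else 0)"
    unfolding blk_times[OF supported_rgt[OF assms(1) S] S]
    by (intro sum.cong refl) (auto simp: blk_rgt assms)
  then show "blk a b (rgt A S g * rgt A S h) = blk a b (rgt A S (g * h))"
    using assms by (simp add: blk_rgt supported_times)
qed

lemma rgt_diff:
  "finite A \<Longrightarrow> supported S g \<Longrightarrow> supported S h \<Longrightarrow> rgt A S (g - h) = rgt A S g - rgt A S h"
  by (rule blk_eqI) (auto simp: blk_rgt supported_diff)

lemma rgt_star: "finite A \<Longrightarrow> supported S h \<Longrightarrow> rgt A S (star h) = star (rgt A S h)"
  by (rule blk_eqI) (auto simp: blk_rgt supported_star)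

lemma rgt_idm: "finite A \<Longrightarrow> finite S \<Longrightarrow> rgt A S (idm S) = idm (A \<times> S)"
  by (rule fmat_eqI) (auto simp: rgt_def asm_def ent_mk ent_dg)

lemma norm_rgt:
  assumes "finite A" "supported S h"
  shows "(norm (rgt A S h))\<^sup>2 = card A * (norm h)\<^sup>2"
proof -
  have S: "finite S" using assms supported_finite by blast
  have "(norm (rgt A S h))\<^sup>2 = (\<Sum>a\<in>A. \<Sum>b\<in>A. if a = b then (norm h)\<^sup>2 else 0)"
    unfolding norm_sq_blk[OF supported_rgt[OF assms(1) S] S]
    by (intro sum.cong refl) (simp add: blk_rgt assms)
  then show ?thesis using assms(1) by simp
qed

text \<open>\<open>lft\<close> and \<open>rgt\<close> are the tensor products \<open>g \<otimes> 1\<close> and \<open>1 \<otimes> h\<close>.\<close>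

definition lft :: "'a set \<Rightarrow> 'b set \<Rightarrow> ('a \<Rightarrow> 'a \<Rightarrow> complex) \<Rightarrow> ('a \<times> 'b) fmat" where
  "lft A S g = mk (A \<times> S) (\<lambda>x y. if snd x = snd y then g (fst x) (fst y) else 0)"

lemma supported_lft: "finite A \<Longrightarrow> finite S \<Longrightarrow> supported (A \<times> S) (lft A S g)"
  by (simp add: lft_def supported_mk)

lemma ent_lft: "finite A \<Longrightarrow> finite S \<Longrightarrow>
  ent (lft A S g) (a, p) (b, q) = (if a \<in> A \<and> b \<in> A \<and> p = q \<and> p \<in> S then g a b else 0)"
  by (auto simp: lft_def ent_mk)

lemma ent_lft_times:
  assumes "finite A" "finite S" "a \<in> A" "p \<in> S"
  shows "ent (lft A S g * V) (a, p) y = (\<Sum>c\<in>A. g a c * ent V (c, p) y)"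
proof -
  have "ent (lft A S g * V) (a, p) y = (\<Sum>c\<in>A. \<Sum>u\<in>S. ent (lft A S g) (a, p) (c, u) * ent V (c, u) y)"
    unfolding sum.cartesian_product using assms by (simp add: ent_times[OF supported_lft] case_prod_beta)
  also have "\<dots> = (\<Sum>c\<in>A. \<Sum>u\<in>S. if p = u then g a c * ent V (c, u) y else 0)"
    using assms by (intro sum.cong refl) (simp add: ent_lft)
  finally show ?thesis using assms by simp
qed

lemma ent_times_lft:
  assumes "finite A" "finite S" "b \<in> A" "q \<in> S"
  shows "ent (V * lft A S g) x (b, q) = (\<Sum>c\<in>A. ent V x (c, q) * g c b)"
proof -
  have "ent (V * lft A S g) x (b, q) = (\<Sum>c\<in>A. \<Sum>u\<in>S. ent V x (c, u) * ent (lft A S g) (c, u) (b, q))"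
    unfolding sum.cartesian_product using assms by (simp add: ent_times'[OF supported_lft] case_prod_beta)
  also have "\<dots> = (\<Sum>c\<in>A. \<Sum>u\<in>S. if u = q then ent V x (c, u) * g c b else 0)"
    using assms by (intro sum.cong refl) (simp add: ent_lft)
  finally show ?thesis using assms by simp
qed

lemma lft_rgt_commute:
  assumes "finite A" "supported S h"
  shows "lft A S g * rgt A S h = rgt A S h * lft A S g"
proof (rule supported_eqI)
  have S: "finite S" using assms supported_finite by blast
  show "supported (A \<times> S) (lft A S g * rgt A S h)" "supported (A \<times> S) (rgt A S h * lft A S g)"
    using assms S by (auto intro!: supported_times supported_lft supported_rgt)
  fix x y assume xy: "x \<in> A \<times> S" "y \<in> A \<times> S"
  obtain a p b q where [simp]: "x = (a, p)" "y = (b, q)" by (cases x, cases y) auto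
  have h: "ent (rgt A S h) (c, u) (d, v) = (if c = d \<and> c \<in> A then ent h u v else 0)" for c u d v
    using arg_cong[OF blk_rgt[OF assms, of c d], of "\<lambda>w. ent w u v"] by (auto split: if_splits)
  show "ent (lft A S g * rgt A S h) x y = ent (rgt A S h * lft A S g) x y"
    using xy assms S by (simp add: ent_lft_times ent_times_lft h if_distrib[of "\<lambda>u. u * _"] if_distrib[of "\<lambda>u. _ * u"] cong: if_cong)
qed

lemma star_lft: "finite A \<Longrightarrow> finite S \<Longrightarrow> star (lft A S g) = lft A S (\<lambda>a b. cnj (g b a))"
  by (rule fmat_eqI) (auto simp: lft_def ent_mk)

lemma lft_isometry:
  assumes "finite A" "finite S"
    and g: "\<And>a b. a \<in> A \<Longrightarrow> b \<in> A \<Longrightarrow> (\<Sum>c\<in>A. cnj (g c a) * g c b) = (if a = b then 1 else 0)"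
  shows "star (lft A S g) * lft A S g = idm (A \<times> S)"
proof (rule supported_eqI)
  show "supported (A \<times> S) (star (lft A S g) * lft A S g)" "supported (A \<times> S) (idm (A \<times> S))"
    using assms by (auto intro!: supported_times supported_star supported_lft supported_dg)
  fix x y assume xy: "x \<in> A \<times> S" "y \<in> A \<times> S"
  obtain a p b q where [simp]: "x = (a, p)" "y = (b, q)" by (cases x, cases y) auto
  show "ent (star (lft A S g) * lft A S g) x y = ent (idm (A \<times> S)) x y"
    using xy assms g[of a b] by (cases "p = q") (auto simp: star_lft ent_lft_times ent_lft ent_dg)
qed

context fixes N :: nat assumes N: "N > 0"
begin

section \<open>Shift, quadratic phase and Fourier matrix\<close>

definition gX :: "int \<Rightarrow> int \<Rightarrow> complex" where "gX x y = (if x = (y + 1) mod int N then 1 else 0)"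
definition gD :: "int \<Rightarrow> int \<Rightarrow> complex" where "gD x y = (if x = y then ev N (x\<^sup>2) else 0)"
definition gF :: "int \<Rightarrow> int \<Rightarrow> complex" where "gF x y = ev N (x * y) / sqrt N"

lemma mod_succ_eq_iff: "x \<in> ZN N \<Longrightarrow> y \<in> ZN N \<Longrightarrow> x = (y + 1) mod int N \<longleftrightarrow> y = (x - 1) mod int N"
  by (auto simp: mod_simps)

lemma gX_iso: "a \<in> ZN N \<Longrightarrow> b \<in> ZN N \<Longrightarrow> (\<Sum>c\<in>ZN N. cnj (gX c a) * gX c b) = (if a = b then 1 else 0)"
proof -
  assume ab: "a \<in> ZN N" "b \<in> ZN N"
  have "(\<Sum>c\<in>ZN N. cnj (gX c a) * gX c b) = (\<Sum>c\<in>ZN N. if c = (a + 1) mod int N then (if (a + 1) mod int N = (b + 1) mod int N then 1 else 0) else 0)"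
    by (intro sum.cong refl) (auto simp: gX_def)
  also have "\<dots> = (if (a + 1) mod int N = (b + 1) mod int N then 1 else 0)" using N by simp
  also have "(a + 1) mod int N = (b + 1) mod int N \<longleftrightarrow> a = b"
  proof
    assume e: "(a + 1) mod int N = (b + 1) mod int N"
    have "a = (a + 1 - 1) mod int N" using ab by simp
    also have "\<dots> = (b + 1 - 1) mod int N" using e by (rule mod_diff_cong) simp
    finally show "a = b" using ab by simp
  qed simp
  finally show ?thesis .
qed

lemma gD_iso: "a \<in> ZN N \<Longrightarrow> b \<in> ZN N \<Longrightarrow> (\<Sum>c\<in>ZN N. cnj (gD c a) * gD c b) = (if a = b then 1 else 0)"
proof -
  assume ab: "a \<in> ZN N" "b \<in> ZN N"
  have "(\<Sum>c\<in>ZN N. cnj (gD c a) * gD c b) = (\<Sum>c\<in>ZN N. if c = a then (if a = b then 1 else 0) else 0)"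
    by (intro sum.cong refl) (auto simp: gD_def ev_cancel[OF N])
  then show ?thesis using ab by simp
qed

lemma gF_iso: "a \<in> ZN N \<Longrightarrow> b \<in> ZN N \<Longrightarrow> (\<Sum>c\<in>ZN N. cnj (gF c a) * gF c b) = (if a = b then 1 else 0)"
proof -
  assume ab: "a \<in> ZN N" "b \<in> ZN N"
  have sN: "complex_of_real (sqrt N) * complex_of_real (sqrt N) = of_nat N"
    by (simp flip: of_real_mult)
  have "cnj (gF c a) * gF c b = ev N ((b - a) * c) / of_nat N" for c
  proof -
    have "ev N ((b - a) * c) = ev N (- (c * a)) * ev N (c * b)"
      unfolding ev_add[OF N, symmetric] by (simp add: algebra_simps)
    then show ?thesis unfolding gF_def by (simp add: ev_minus[OF N] sN)
  qed
  then have "(\<Sum>c\<in>ZN N. cnj (gF c a) * gF c b) = (\<Sum>c\<in>ZN N. ev N ((b - a) * c)) / of_nat N"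
    by (simp add: sum_divide_distrib)
  then show ?thesis using sum_ev_diff[OF N ab(2,1)] N by simp
qed

text \<open>Each pair (r, r') cuts an N by N slice out of \<open>w\<close>. \<open>weyl_gap\<close>
  applies to it once its normalized trace is subtracted, and these traces together form the
  normalized partial trace \<open>w0\<close>.\<close>

lemma matrix_gap:
  assumes R: "finite R" and w: "supported (ZN N \<times> R) w"
  shows "\<exists>w0. supported R w0 \<and> (norm (w - rgt (ZN N) R w0))\<^sup>2 \<le> 441 *
    ((norm (lft (ZN N) R gX * w - w * lft (ZN N) R gX))\<^sup>2 + (norm (lft (ZN N) R gD * w - w * lft (ZN N) R gD))\<^sup>2
      + (norm (lft (ZN N) R gF * w - w * lft (ZN N) R gF))\<^sup>2)"
proof -
  let ?X = "lft (ZN N) R gX" let ?D = "lft (ZN N) R gD" let ?F = "lft (ZN N) R gF"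
  define w0 where "w0 = (1 / real N) *\<^sub>R (\<Sum>x\<in>ZN N. blk x x w)"
  have "supported R (\<Sum>x\<in>A. blk x x w)" if "finite A" for A
    using that by induction (auto intro: supported_add supported_blk[OF w R] supported_0 R)
  then have w0: "supported R w0" unfolding w0_def by (intro supported_scaleR) auto
  define v where "v = w - rgt (ZN N) R w0"
  have v: "supported (ZN N \<times> R) v" unfolding v_def using w R by (intro supported_diff supported_rgt) auto
  \<comment> \<open>Reducing the arguments makes each slice periodic and keeps its entries on
    \<open>ZN N\<close>.\<close>
  define T where "T r r' x y = ent v (x mod int N, r) (y mod int N, r')" for r r' x y
  have nrm: "(norm u)\<^sup>2 = (\<Sum>r\<in>R. \<Sum>r'\<in>R. \<Sum>x\<in>ZN N. \<Sum>y\<in>ZN N. (cmod (ent u (x, r) (y, r')))\<^sup>2)"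
    if u: "supported (ZN N \<times> R) u" for u
  proof -
    have "(norm u)\<^sup>2 = (\<Sum>x\<in>ZN N. \<Sum>y\<in>ZN N. \<Sum>r\<in>R. \<Sum>r'\<in>R. (cmod (ent u (x, r) (y, r')))\<^sup>2)"
      by (simp add: norm_sq_blk[OF u R] norm_fmat_sq[OF supported_blk[OF u R]])
    also have "\<dots> = (\<Sum>p\<in>ZN N \<times> ZN N. \<Sum>q\<in>R \<times> R. (cmod (ent u (fst p, fst q) (snd p, snd q)))\<^sup>2)"
      by (simp add: sum.cartesian_product')
    also have "\<dots> = (\<Sum>q\<in>R \<times> R. \<Sum>p\<in>ZN N \<times> ZN N. (cmod (ent u (fst p, fst q) (snd p, snd q)))\<^sup>2)"
      by (rule sum.swap)
    finally show ?thesis by (simp add: sum.cartesian_product')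
  qed
  \<comment> \<open>Subtracting 1 \<otimes> w0 changes no commutator with g \<otimes> 1.\<close>
  have cc: "lft (ZN N) R g * w - w * lft (ZN N) R g = lft (ZN N) R g * v - v * lft (ZN N) R g" for g
    using lft_rgt_commute[of "ZN N" R w0 g] w0 by (simp add: v_def algebra_simps)
  have sc: "supported (ZN N \<times> R) (lft (ZN N) R g * v - v * lft (ZN N) R g)" for g
    using R by (intro supported_intros supported_lft v) auto
  have ec: "ent (lft (ZN N) R g * v - v * lft (ZN N) R g) (x, r) (y, r')
      = (\<Sum>u\<in>ZN N. g x u * T r r' u y) - (\<Sum>u\<in>ZN N. T r r' x u * g u y)"
    if "x \<in> ZN N" "y \<in> ZN N" "r \<in> R" "r' \<in> R" for g x y r r'
    using that R by (simp add: ent_lft_times ent_times_lft T_def)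
  have main: "(\<Sum>x\<in>ZN N. \<Sum>y\<in>ZN N. (cmod (ent v (x, r) (y, r')))\<^sup>2) \<le> 441 *
     ((\<Sum>x\<in>ZN N. \<Sum>y\<in>ZN N. (cmod (ent (?X * v - v * ?X) (x, r) (y, r')))\<^sup>2)
    + (\<Sum>x\<in>ZN N. \<Sum>y\<in>ZN N. (cmod (ent (?D * v - v * ?D) (x, r) (y, r')))\<^sup>2)
    + (\<Sum>x\<in>ZN N. \<Sum>y\<in>ZN N. (cmod (ent (?F * v - v * ?F) (x, r) (y, r')))\<^sup>2))"
    if r: "r \<in> R" "r' \<in> R" for r r'
  proof -
    let ?T = "T r r'"
    have "fro N ?T \<le> 441 * (fro N (\<lambda>x y. ?T (x - 1) y - ?T x (y + 1)) + fro N (\<lambda>x y. (ev N (x\<^sup>2) - ev N (y\<^sup>2)) * ?T x y)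
      + fro N (\<lambda>x y. ((\<Sum>u\<in>ZN N. ev N (x * u) * ?T u y) - (\<Sum>u\<in>ZN N. ?T x u * ev N (u * y))) / sqrt N))"
    proof (rule weyl_gap[OF N])
      show "per N (\<lambda>x. ?T x y)" for y by (simp add: per_def[OF N] T_def)
      show "per N (?T x)" for x by (simp add: per_def[OF N] T_def)
      have h: "ent (rgt (ZN N) R w0) (x, r) (x, r') = ent w0 r r'" if "x \<in> ZN N" for x
        using that arg_cong[OF blk_rgt[OF _ w0, of "ZN N" x x], of "\<lambda>w. ent w r r'"] by simp
      have "(\<Sum>x\<in>ZN N. ?T x x) = (\<Sum>x\<in>ZN N. ent w (x, r) (x, r')) - of_nat N * ent w0 r r'"
        by (simp add: T_def v_def h sum_subtractf)
      also have "\<dots> = 0" using N by (simp add: w0_def ent_sum scaleR_conv_of_real)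
      finally show "(\<Sum>x\<in>ZN N. ?T x x) = 0" .
    qed
    also have "fro N ?T = (\<Sum>x\<in>ZN N. \<Sum>y\<in>ZN N. (cmod (ent v (x, r) (y, r')))\<^sup>2)"
      by (simp add: fro_def[OF N] T_def)
    also have "fro N (\<lambda>x y. ?T (x - 1) y - ?T x (y + 1)) =
      (\<Sum>x\<in>ZN N. \<Sum>y\<in>ZN N. (cmod (ent (?X * v - v * ?X) (x, r) (y, r')))\<^sup>2)"
      unfolding fro_def[OF N]
    proof (intro sum.cong refl)
      fix x y assume xy: "x \<in> ZN N" "y \<in> ZN N"
      have "(\<Sum>u\<in>ZN N. gX x u * ?T u y) = (\<Sum>u\<in>ZN N. if u = (x - 1) mod int N then ?T u y else 0)"
        by (intro sum.cong refl) (use mod_succ_eq_iff[OF xy(1)] in \<open>auto simp: gX_def\<close>)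
      also have "\<dots> = ?T (x - 1) y" using N by (simp add: T_def)
      finally have 1: "(\<Sum>u\<in>ZN N. gX x u * ?T u y) = ?T (x - 1) y" .
      have "(\<Sum>u\<in>ZN N. ?T x u * gX u y) = (\<Sum>u\<in>ZN N. if u = (y + 1) mod int N then ?T x u else 0)"
        by (intro sum.cong refl) (simp add: gX_def)
      also have "\<dots> = ?T x (y + 1)" using N by (simp add: T_def)
      finally have 2: "(\<Sum>u\<in>ZN N. ?T x u * gX u y) = ?T x (y + 1)" .
      show "(cmod (?T (x - 1) y - ?T x (y + 1)))\<^sup>2 = (cmod (ent (?X * v - v * ?X) (x, r) (y, r')))\<^sup>2"
        unfolding ec[OF xy r] 1 2 ..
    qed
    also have "fro N (\<lambda>x y. (ev N (x\<^sup>2) - ev N (y\<^sup>2)) * ?T x y) =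
      (\<Sum>x\<in>ZN N. \<Sum>y\<in>ZN N. (cmod (ent (?D * v - v * ?D) (x, r) (y, r')))\<^sup>2)"
      unfolding fro_def[OF N]
    proof (intro sum.cong refl)
      fix x y assume xy: "x \<in> ZN N" "y \<in> ZN N"
      have "(\<Sum>u\<in>ZN N. gD x u * ?T u y) = (\<Sum>u\<in>ZN N. if u = x then ev N (x\<^sup>2) * ?T u y else 0)"
        by (intro sum.cong refl) (auto simp: gD_def)
      then have 1: "(\<Sum>u\<in>ZN N. gD x u * ?T u y) = ev N (x\<^sup>2) * ?T x y" using xy by simp
      have "(\<Sum>u\<in>ZN N. ?T x u * gD u y) = (\<Sum>u\<in>ZN N. if u = y then ?T x u * ev N (y\<^sup>2) else 0)"
        by (intro sum.cong refl) (simp add: gD_def)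
      then have 2: "(\<Sum>u\<in>ZN N. ?T x u * gD u y) = ?T x y * ev N (y\<^sup>2)" using xy by simp
      show "(cmod ((ev N (x\<^sup>2) - ev N (y\<^sup>2)) * ?T x y))\<^sup>2 = (cmod (ent (?D * v - v * ?D) (x, r) (y, r')))\<^sup>2"
        unfolding ec[OF xy r] 1 2 by (simp add: algebra_simps)
    qed
    also have "fro N (\<lambda>x y. ((\<Sum>u\<in>ZN N. ev N (x * u) * ?T u y) - (\<Sum>u\<in>ZN N. ?T x u * ev N (u * y))) / sqrt N) =
      (\<Sum>x\<in>ZN N. \<Sum>y\<in>ZN N. (cmod (ent (?F * v - v * ?F) (x, r) (y, r')))\<^sup>2)"
      unfolding fro_def[OF N]
    proof (intro sum.cong refl)
      fix x y assume xy: "x \<in> ZN N" "y \<in> ZN N"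
      show "(cmod (((\<Sum>u\<in>ZN N. ev N (x * u) * ?T u y) - (\<Sum>u\<in>ZN N. ?T x u * ev N (u * y))) / sqrt N))\<^sup>2
        = (cmod (ent (?F * v - v * ?F) (x, r) (y, r')))\<^sup>2"
        unfolding ec[OF xy r] gF_def by (simp add: sum_divide_distrib diff_divide_distrib)
    qed
    finally show ?thesis .
  qed
  have "(norm v)\<^sup>2 \<le> 441 * ((norm (?X * v - v * ?X))\<^sup>2 + (norm (?D * v - v * ?D))\<^sup>2
      + (norm (?F * v - v * ?F))\<^sup>2)"
    unfolding nrm[OF v] nrm[OF sc] sum.distrib[symmetric] sum_distrib_left[of 441 _ R]
    by (intro sum_mono main[THEN order_trans]) (auto simp: sum.distrib)
  then show ?thesis using w0 unfolding cc v_def by blast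
qed

end

section \<open>The operators on one side\<close>

text \<open>Cauchy-Schwarz along a row of blocks; the crude factor is harmless because the number of
  blocks will be four.\<close>

lemma asm_bound:
  assumes A: "finite A" and S: "finite S" and k: "\<And>a b. a \<in> A \<Longrightarrow> b \<in> A \<Longrightarrow> supported S (k a b) \<and> contr (k a b)"
    and Y: "supported (A \<times> S) Y"
  shows "norm (asm A S k * Y) \<le> real (card A) * norm Y"
proof (rule power2_le_imp_le)
  have s: "supported (A \<times> S) (asm A S k)" using A S by (rule supported_asm)
  have "(norm (asm A S k * Y))\<^sup>2 = (\<Sum>a\<in>A. \<Sum>b\<in>A. (norm (\<Sum>c\<in>A. k a c * blk c b Y))\<^sup>2)"
    unfolding norm_sq_blk[OF supported_times[OF s Y] S] blk_times[OF s S]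
    using A S k by (intro sum.cong refl) (simp add: blk_asm)
  also have "\<dots> \<le> (\<Sum>a\<in>A. \<Sum>b\<in>A. real (card A) * (\<Sum>c\<in>A. (norm (blk c b Y))\<^sup>2))"
  proof (intro sum_mono)
    fix a b assume a: "a \<in> A" "b \<in> A"
    have "norm (\<Sum>c\<in>A. k a c * blk c b Y) \<le> (\<Sum>c\<in>A. norm (blk c b Y))"
      using a k by (intro order_trans[OF norm_sum] sum_mono contrD) auto
    then have "(norm (\<Sum>c\<in>A. k a c * blk c b Y))\<^sup>2 \<le> (\<Sum>c\<in>A. norm (blk c b Y))\<^sup>2"
      by (intro power_mono) auto
    also have "\<dots> \<le> real (card A) * (\<Sum>c\<in>A. (norm (blk c b Y))\<^sup>2)"
      by (rule order_trans[OF sum_squared_le_sum_of_squares]) (auto simp: A mult.commute)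
    finally show "(norm (\<Sum>c\<in>A. k a c * blk c b Y))\<^sup>2 \<le> real (card A) * (\<Sum>c\<in>A. (norm (blk c b Y))\<^sup>2)" .
  qed
  also have "\<dots> = (real (card A))\<^sup>2 * (\<Sum>b\<in>A. \<Sum>c\<in>A. (norm (blk c b Y))\<^sup>2)"
    by (simp add: power2_eq_square sum_distrib_left mult.assoc)
  also have "\<dots> = (real (card A) * norm Y)\<^sup>2"
    unfolding power_mult_distrib norm_sq_blk[OF Y S] by (subst sum.swap) simp
  finally show "(norm (asm A S k * Y))\<^sup>2 \<le> (real (card A) * norm Y)\<^sup>2" .
qed simp

lemma contr_0: "contr 0"
  by (simp add: contr_def)

definition controlled :: "nat \<Rightarrow> 'r set \<Rightarrow> (int \<Rightarrow> 'r fmat) \<Rightarrow> (int \<times> 'r) fmat" where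
  "controlled N R \<sigma> = asm (ZN N) R (\<lambda>x y. if x = y then \<sigma> x else 0)"

text \<open>The pairs a < b from {1, 2, 3} are exactly three, one per generator. This fixes the
  number of blocks at four, with block 0 reserved for \<open>controlled\<close> and for the identity
  links.\<close>

definition side_generator :: "nat \<Rightarrow> 'r set \<Rightarrow> nat \<Rightarrow> nat \<Rightarrow> (int \<times> 'r) fmat" where
  "side_generator N R a b =
    (if a = 1 \<and> b = 2 then lft (ZN N) R (gX N) else if a = 1 \<and> b = 3 then lft (ZN N) R (gD N)
     else if a = 2 \<and> b = 3 then lft (ZN N) R (gF N) else 0)"

text \<open>The blocks \<open>(0, b)\<close> force the diagonal blocks of an approximately commuting matrix to agree;
  each remaining block then contributes one generator.\<close>

definition side_block :: "nat \<Rightarrow> 'r set \<Rightarrow> (int \<Rightarrow> 'r fmat) \<Rightarrow> nat \<Rightarrow> nat \<Rightarrow> (int \<times> 'r) fmat" where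
  "side_block N R \<sigma> a b =
    (if a = 0 \<and> b = 0 then controlled N R \<sigma>
     else if a = 0 \<or> b = 0 then idm (ZN N \<times> R)
     else if a < b then side_generator N R a b
     else if b < a then star (side_generator N R b a)
     else 0)"

abbreviation side_index :: "nat \<Rightarrow> 'r set \<Rightarrow> (nat \<times> int \<times> 'r) set" where
  "side_index N R \<equiv> {..<4} \<times> ZN N \<times> R"

text \<open>Its commutator with a matrix multiplies the block (a, b) by a - b, which has modulus at
  least 1 off the diagonal.\<close>

definition side_H :: "nat \<Rightarrow> 'r set \<Rightarrow> (nat \<times> int \<times> 'r) fmat" where
  "side_H N R = dg (side_index N R) (\<lambda>p. of_nat (fst p))"

definition side_K :: "nat \<Rightarrow> 'r set \<Rightarrow> (int \<Rightarrow> 'r fmat) \<Rightarrow> (nat \<times> int \<times> 'r) fmat" where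
  "side_K N R \<sigma> = asm {..<4} (ZN N \<times> R) (side_block N R \<sigma>)"

text \<open>Up to the factor 1/7, the real and imaginary parts are \<open>side_H\<close>, bounded by
  its largest eigenvalue 3, and \<open>side_K\<close>, bounded by its four contractive blocks per
  row; 7 = 3 + 4.\<close>

definition side :: "nat \<Rightarrow> 'r set \<Rightarrow> (int \<Rightarrow> 'r fmat) \<Rightarrow> (nat \<times> int \<times> 'r) fmat" where
  "side N R \<sigma> = (1/7) *\<^sub>R (side_H N R + iim (side_index N R) * side_K N R \<sigma>)"

context
  fixes N :: nat and R :: "'r set" and \<sigma> :: "int \<Rightarrow> 'r fmat"
  assumes N: "N > 0" and R: "finite R"
    and \<sigma>: "\<And>x. supported R (\<sigma> x)" "\<And>x. star (\<sigma> x) = \<sigma> x" "\<And>x. \<sigma> x * \<sigma> x = idm R"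
begin

lemma blk_controlled: "blk x y (controlled N R \<sigma>) = (if x = y \<and> x \<in> ZN N then \<sigma> x else 0)"
  unfolding controlled_def using R by (subst blk_asm) (auto simp: \<sigma> supported_0)

lemma supported_controlled: "supported (ZN N \<times> R) (controlled N R \<sigma>)"
  unfolding controlled_def using R by (intro supported_asm) auto

lemma star_controlled: "star (controlled N R \<sigma>) = controlled N R \<sigma>"
  by (rule blk_eqI) (auto simp: blk_controlled \<sigma>)

lemma blk_controlled_times: "x \<in> ZN N \<Longrightarrow> blk x y (controlled N R \<sigma> * W) = \<sigma> x * blk x y W"
proof -
  assume x: "x \<in> ZN N"
  have "blk x y (controlled N R \<sigma> * W) = (\<Sum>c\<in>ZN N. if c = x then \<sigma> x * blk x y W else 0)"
    unfolding blk_times[OF supported_controlled R] by (intro sum.cong refl) (auto simp: blk_controlled)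
  then show ?thesis using x by simp
qed

lemma controlled_sq: "controlled N R \<sigma> * controlled N R \<sigma> = idm (ZN N \<times> R)"
proof (rule blk_eqI)
  fix x y
  show "blk x y (controlled N R \<sigma> * controlled N R \<sigma>) = blk x y (idm (ZN N \<times> R))"
  proof (cases "x \<in> ZN N")
    case True
    then show ?thesis
      using R by (simp add: blk_controlled_times blk_controlled \<sigma> flip: rgt_idm) (simp add: blk_rgt supported_dg)
  next
    case False
    then show ?thesis
      using blk_outside[OF supported_times[OF supported_controlled supported_controlled]]
        blk_outside[OF supported_dg] R by (metis finite_SigmaI finite_atLeastLessThan_int)
  qed
qed

lemma side_block_props:
  "supported (ZN N \<times> R) (side_block N R \<sigma> a b)" "contr (side_block N R \<sigma> a b)"
  "star (side_block N R \<sigma> a b) = side_block N R \<sigma> b a"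
proof -
  have fin: "finite (ZN N)" "finite (ZN N \<times> R)" using R by auto
  have c: "contr (lft (ZN N) R (gX N))" "contr (lft (ZN N) R (gD N))" "contr (lft (ZN N) R (gF N))"
    by (rule contr_isometry[OF fin(2) lft_isometry[OF fin(1) R]], rule gX_iso[OF N] gD_iso[OF N] gF_iso[OF N]; assumption)+
  have cu: "contr (controlled N R \<sigma>)"
    by (rule contr_isometry[OF fin(2)]) (simp add: star_controlled controlled_sq)
  have g: "supported (ZN N \<times> R) (side_generator N R a b)" "contr (side_generator N R a b)" for a b
    unfolding side_generator_def using fin R c by (auto intro!: supported_lft supported_0 simp: contr_0)
  show "supported (ZN N \<times> R) (side_block N R \<sigma> a b)"
    unfolding side_block_def using fin
    by (auto intro!: supported_star g supported_dg supported_controlled supported_0)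
  show "contr (side_block N R \<sigma> a b)"
    unfolding side_block_def using g(2) cu contr_idm[OF fin(2)] by (auto simp: contr_star contr_0)
  show "star (side_block N R \<sigma> a b) = side_block N R \<sigma> b a"
    unfolding side_block_def by (cases "a = 0"; cases "b = 0"; cases a b rule: linorder_cases)
      (auto simp: star_controlled star_dg fin)
qed

lemma finite_side_index: "finite (side_index N R)"
  using R by auto

lemma supported_side_H: "supported (side_index N R) (side_H N R)"
  unfolding side_H_def by (rule supported_dg[OF finite_side_index])

lemma supported_side_K: "supported (side_index N R) (side_K N R \<sigma>)"
  unfolding side_K_def using R by (intro supported_asm) auto

lemma supported_side: "supported (side_index N R) (side N R \<sigma>)"
  unfolding side_def
  by (intro supported_intros supported_side_H supported_side_K supported_dg finite_side_index)

lemma blk_side_K: "blk a b (side_K N R \<sigma>) = (if a < 4 \<and> b < 4 then side_block N R \<sigma> a b else 0)"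
  unfolding side_K_def using R by (subst blk_asm) (auto simp: side_block_props)

lemma star_side: "star (side N R \<sigma>) = (1/7) *\<^sub>R (side_H N R - iim (side_index N R) * side_K N R \<sigma>)"
proof -
  have "star (side_H N R) = side_H N R" unfolding side_H_def by (simp add: star_dg finite_side_index)
  moreover have "star (side_K N R \<sigma>) = side_K N R \<sigma>"
    by (rule blk_eqI) (auto simp: blk_side_K side_block_props)
  ultimately show ?thesis
    unfolding side_def by (simp add: star_iim[OF finite_side_index] iim_commute[OF supported_side_K])
qed

lemma side_contractive:
  assumes Y: "supported (side_index N R) Y"
  shows "norm (side N R \<sigma> * Y) \<le> norm Y"
proof -
  have "(norm (side_H N R * Y))\<^sup>2 \<le> (3 * norm Y)\<^sup>2"
  proof -
    have "(norm (side_H N R * Y))\<^sup>2 \<le> (\<Sum>x\<in>side_index N R. \<Sum>y\<in>side_index N R. 3\<^sup>2 * (cmod (ent Y x y))\<^sup>2)"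
      unfolding norm_fmat_sq[OF supported_times[OF supported_side_H Y]]
    proof (intro sum_mono)
      fix x y assume x: "x \<in> side_index N R"
      then have "real (fst x) \<le> 3" by auto
      then have "(real (fst x))\<^sup>2 \<le> 3\<^sup>2" by (intro power_mono) auto
      then show "(cmod (ent (side_H N R * Y) x y))\<^sup>2 \<le> 3\<^sup>2 * (cmod (ent Y x y))\<^sup>2"
        using x unfolding side_H_def
        by (simp only: ent_dg_times[OF finite_side_index] if_True norm_mult power_mult_distrib norm_of_nat)
          (intro mult_right_mono, auto)
    qed
    then show ?thesis by (simp add: norm_fmat_sq[OF Y] power_mult_distrib sum_distrib_left)
  qed
  then have H: "norm (side_H N R * Y) \<le> 3 * norm Y" by (rule power2_le_imp_le) simp
  have "norm (side_K N R \<sigma> * Y) \<le> real (card {..<4::nat}) * norm Y"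
    unfolding side_K_def using R Y by (intro asm_bound) (auto simp: side_block_props)
  then have K: "norm (iim (side_index N R) * (side_K N R \<sigma> * Y)) \<le> 4 * norm Y"
    by (simp add: norm_iim_times supported_times supported_side_K Y)
  have "norm (side N R \<sigma> * Y) = (1/7) * norm (side_H N R * Y + iim (side_index N R) * (side_K N R \<sigma> * Y))"
    unfolding side_def by (simp add: distrib_right mult.assoc)
  also have "\<dots> \<le> (1/7) * (3 * norm Y + 4 * norm Y)"
    by (intro mult_left_mono norm_triangle_mono H K) auto
  finally show ?thesis by simp
qed

text \<open>Sum and difference of the commutators with \<open>side\<close> and its adjoint isolate
  the two parts; 7/2 undoes the scaling and the doubling.\<close>

lemma side_parts_le:
  assumes V: "supported (side_index N R) V"
  defines "p \<equiv> norm (side N R \<sigma> * V - V * side N R \<sigma>)"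
    and "q \<equiv> norm (star (side N R \<sigma>) * V - V * star (side N R \<sigma>))"
  shows "norm (side_H N R * V - V * side_H N R) \<le> 7/2 * (p + q)"
    "norm (side_K N R \<sigma> * V - V * side_K N R \<sigma>) \<le> 7/2 * (p + q)"
proof -
  let ?I = "side_index N R" let ?H = "side_H N R" let ?K = "side_K N R \<sigma>" let ?A = "side N R \<sigma>"
  let ?P = "?A * V - V * ?A" let ?Q = "star ?A * V - V * star ?A"
  have half: "x \<le> 7/2 * (y + z)" if "2 * x = 7 * n" "n \<le> y + z" for x y z n :: real
    using that by (simp add: field_simps)
  have A: "7 *\<^sub>R ?A = ?H + iim ?I * ?K" "7 *\<^sub>R star ?A = ?H - iim ?I * ?K"
    unfolding star_side by (simp_all add: side_def)
  have V': "V * (iim ?I * ?K) = iim ?I * (V * ?K)"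
    using iim_commute[OF V] by (simp flip: mult.assoc)
  have P: "7 *\<^sub>R ?P = (7 *\<^sub>R ?A) * V - V * (7 *\<^sub>R ?A)" "7 *\<^sub>R ?Q = (7 *\<^sub>R star ?A) * V - V * (7 *\<^sub>R star ?A)"
    by (simp_all add: scaleR_diff_right)
  have "2 *\<^sub>R (?H * V - V * ?H) = 7 *\<^sub>R ?P + 7 *\<^sub>R ?Q"
    unfolding P A by (simp add: algebra_simps scaleR_2)
  then have "norm (2 *\<^sub>R (?H * V - V * ?H)) = norm (7 *\<^sub>R (?P + ?Q))"
    by (simp only: scaleR_right_distrib)
  then have "2 * norm (?H * V - V * ?H) = 7 * norm (?P + ?Q)"
    by (simp only: norm_scaleR abs_numeral)
  then show "norm (?H * V - V * ?H) \<le> 7/2 * (p + q)"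
    unfolding p_def q_def by (rule half) (rule norm_triangle_ineq)
  have "2 *\<^sub>R (iim ?I * (?K * V - V * ?K)) = 7 *\<^sub>R ?P - 7 *\<^sub>R ?Q"
    unfolding P A using V' by (simp add: algebra_simps scaleR_2)
  then have "norm (2 *\<^sub>R (iim ?I * (?K * V - V * ?K))) = norm (7 *\<^sub>R (?P - ?Q))"
    by (simp only: scaleR_right_diff_distrib)
  then have "2 * norm (iim ?I * (?K * V - V * ?K)) = 7 * norm (?P - ?Q)"
    by (simp only: norm_scaleR abs_numeral)
  moreover have "norm (iim ?I * (?K * V - V * ?K)) = norm (?K * V - V * ?K)"
    by (intro norm_iim_times supported_intros V supported_side_K)
  ultimately show "norm (?K * V - V * ?K) \<le> 7/2 * (p + q)"
    unfolding p_def q_def by (intro half[OF _ norm_triangle_ineq4]) simp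
qed

text \<open>The blocks of \<open>V\<close> off the diagonal are small, the diagonal ones are close
  to \<open>w\<close>, and \<open>w\<close> almost commutes with the generators, hence is close to 1
  \<otimes> w0; finally \<open>controlled\<close> tests \<open>w0\<close> against every \<sigma> x.
  The weight 6 in \<gamma> pays for the three off-diagonal blocks on each side in a block of the
  commutator with \<open>side_K\<close>.\<close>

lemma side_gap_aux:
  fixes \<gamma> :: real
  assumes V: "supported (side_index N R) V"
  defines "\<gamma> \<equiv> norm (side_K N R \<sigma> * V - V * side_K N R \<sigma>) + 6 * norm (side_H N R * V - V * side_H N R)"
  shows "(\<Sum>x\<in>ZN N. (norm (rgt {..<4} (ZN N \<times> R) (rgt (ZN N) R (\<sigma> x)) * V
      - V * rgt {..<4} (ZN N \<times> R) (rgt (ZN N) R (\<sigma> x))))\<^sup>2) \<le> real N * (1403 * \<gamma>)\<^sup>2"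
proof -
  let ?S = "ZN N \<times> R" let ?k = "side_block N R \<sigma>" let ?X = "lft (ZN N) R (gX N)" let ?D = "lft (ZN N) R (gD N)"
  let ?F = "lft (ZN N) R (gF N)" let ?K = "side_K N R \<sigma>" let ?H = "side_H N R"
  define \<alpha> where "\<alpha> = norm (?H * V - V * ?H)"
  define v where "v a b = blk a b V" for a b
  have S: "finite ?S" using R by auto
  have sv: "supported ?S (v a b)" for a b unfolding v_def by (rule supported_blk[OF V S])
  have \<alpha>: "0 \<le> \<alpha>" "\<alpha> \<le> \<gamma>" "0 \<le> \<gamma>" by (simp_all add: \<alpha>_def \<gamma>_def)
  have off: "norm (v a b) \<le> \<alpha>" if "a \<noteq> b" "a < 4" "b < 4" for a b
  proof -
    have "blk a b (?H * V - V * ?H) = (real a - real b) *\<^sub>R v a b"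
      by (rule supported_eqI[of ?S])
        (use that in \<open>auto simp: v_def side_H_def ent_dg_times[OF finite_side_index] ent_times_dg[OF finite_side_index]
          scaleR_conv_of_real algebra_simps
          intro!: supported_intros supported_blk[OF V S] supported_blk[OF supported_times[OF supported_dg[OF finite_side_index] V] S]
          supported_blk[OF supported_times[OF V supported_dg[OF finite_side_index]] S]\<close>)
    then have "\<bar>real a - real b\<bar> * norm (v a b) = norm (blk a b (?H * V - V * ?H))" by simp
    also have "\<dots> \<le> \<alpha>"
      unfolding \<alpha>_def using S by (intro norm_blk_le[of "{..<4}" ?S] supported_intros V supported_side_H) auto
    finally have "\<bar>real a - real b\<bar> * norm (v a b) \<le> \<alpha>" .
    moreover have "1 * norm (v a b) \<le> \<bar>real a - real b\<bar> * norm (v a b)"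
      using that by (intro mult_right_mono) auto
    ultimately show ?thesis by simp
  qed
  have link: "norm (?k a b * v b b - v a a * ?k a b) \<le> \<gamma>" if ab: "a < 4" "b < 4" for a b
  proof -
    have e: "blk a b (?K * V - V * ?K) = (\<Sum>c<4. ?k a c * v c b) - (\<Sum>c<4. v a c * ?k c b)"
      using ab by (simp add: blk_times[OF supported_side_K S] blk_times[OF V S] blk_side_K v_def)
    have "(\<Sum>c<4. ?k a c * v c b) = ?k a b * v b b + (\<Sum>c\<in>{..<4} - {b}. ?k a c * v c b)"
      "(\<Sum>c<4. v a c * ?k c b) = v a a * ?k a b + (\<Sum>c\<in>{..<4} - {a}. v a c * ?k c b)"
      using ab by (auto intro: sum.remove)
    then have "?k a b * v b b - v a a * ?k a b = blk a b (?K * V - V * ?K)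
        - (\<Sum>c\<in>{..<4} - {b}. ?k a c * v c b) + (\<Sum>c\<in>{..<4} - {a}. v a c * ?k c b)"
      unfolding e by simp
    also have "norm \<dots> \<le> norm (?K * V - V * ?K) + 3 * \<alpha> + 3 * \<alpha>"
    proof (intro norm_triangle_mono order_trans[OF norm_triangle_ineq4 add_mono])
      show "norm (blk a b (?K * V - V * ?K)) \<le> norm (?K * V - V * ?K)"
        using S by (intro norm_blk_le[of "{..<4}" ?S] supported_intros V supported_side_K) auto
      have "norm (\<Sum>c\<in>{..<4} - {b}. ?k a c * v c b) \<le> of_nat (card ({..<4} - {b})) * \<alpha>"
        by (rule order_trans[OF norm_sum sum_bounded_above])
          (use ab off in \<open>auto intro!: order_trans[OF contrD[OF side_block_props(2)]]\<close>)
      then show "norm (\<Sum>c\<in>{..<4} - {b}. ?k a c * v c b) \<le> 3 * \<alpha>" using ab by simp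
      have "norm (\<Sum>c\<in>{..<4} - {a}. v a c * ?k c b) \<le> of_nat (card ({..<4} - {a})) * \<alpha>"
        by (rule order_trans[OF norm_sum sum_bounded_above])
          (use ab off in \<open>auto intro!: order_trans[OF contrD_right[OF side_block_props(2)]]\<close>)
      then show "norm (\<Sum>c\<in>{..<4} - {a}. v a c * ?k c b) \<le> 3 * \<alpha>" using ab by simp
    qed
    finally show ?thesis by (simp add: \<gamma>_def \<alpha>_def)
  qed
  define w where "w = v 0 0"
  have diag: "norm (v b b - w) \<le> \<gamma>" if "b < 4" for b
  proof (cases "b = 0")
    case False
    then show ?thesis using link[of 0 b] that sv by (simp add: side_block_def w_def)
  qed (simp add: w_def \<alpha>)
  have comm: "norm (g * w - w * g) \<le> 3 * \<gamma>" if "g = ?k a b" "a < 4" "b < 4" for g a b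
  proof -
    have "g * w - w * g = (g * v b b - v a a * g) - g * (v b b - w) + (v a a - w) * g"
      by (simp add: algebra_simps)
    also have "norm \<dots> \<le> \<gamma> + \<gamma> + \<gamma>"
      using link[of a b] diag[of a] diag[of b] that
      by (intro norm_triangle_mono order_trans[OF norm_triangle_ineq4 add_mono])
        (auto intro: order_trans[OF contrD[OF side_block_props(2)]] order_trans[OF contrD_right[OF side_block_props(2)]])
    finally show ?thesis by simp
  qed
  obtain w0 where w0: "supported R w0" and gap: "(norm (w - rgt (ZN N) R w0))\<^sup>2 \<le> 441 *
    ((norm (?X * w - w * ?X))\<^sup>2 + (norm (?D * w - w * ?D))\<^sup>2
      + (norm (?F * w - w * ?F))\<^sup>2)"
    using matrix_gap[OF N R, of w] sv w_def by auto
  \<comment> \<open>441 * 27 = 11907 is below 110^2 = 12100.\<close>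
  have "(norm (w - rgt (ZN N) R w0))\<^sup>2 \<le> 441 * ((3 * \<gamma>)\<^sup>2 + (3 * \<gamma>)\<^sup>2 + (3 * \<gamma>)\<^sup>2)"
    by (rule order_trans[OF gap], intro mult_left_mono add_mono power_mono
        comm[of _ 1 2] comm[of _ 1 3] comm[of _ 2 3]) (auto simp: side_block_def side_generator_def)
  also have "\<dots> \<le> (110 * \<gamma>)\<^sup>2" by (simp add: power_mult_distrib)
  finally have w_near: "norm (w - rgt (ZN N) R w0) \<le> 110 * \<gamma>"
    by (rule power2_le_imp_le) (simp add: \<alpha>)
  let ?U = "controlled N R \<sigma>" let ?w = "rgt (ZN N) R w0"
  have sw: "supported ?S ?w" using R by (intro supported_rgt) auto
  have "norm (?U * ?w - ?w * ?U) \<le> 221 * \<gamma>"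
  proof -
    have cu: "contr ?U" using side_block_props(2)[of 0 0] by (simp add: side_block_def)
    have "?U * ?w - ?w * ?U = (?U * w - w * ?U) + ((w - ?w) * ?U - ?U * (w - ?w))"
      by (simp add: algebra_simps)
    also have "norm \<dots> \<le> \<gamma> + 2 * (110 * \<gamma>)"
      using link[of 0 0] norm_comm_le[OF cu, of "w - ?w"] w_near
      by (intro norm_triangle_mono) (auto simp: side_block_def w_def)
    finally show ?thesis by simp
  qed
  then have "(norm (?U * ?w - ?w * ?U))\<^sup>2 \<le> (221 * \<gamma>)\<^sup>2" by (intro power_mono) auto
  \<comment> \<open>The control decouples the sites: the diagonal block at \<open>x\<close> of this
    commutator is that of \<sigma> x with \<open>w0\<close>.\<close>
  moreover have "(\<Sum>x\<in>ZN N. (norm (\<sigma> x * w0 - w0 * \<sigma> x))\<^sup>2) \<le> (norm (?U * ?w - ?w * ?U))\<^sup>2"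
  proof -
    have "(\<Sum>x\<in>ZN N. (norm (\<sigma> x * w0 - w0 * \<sigma> x))\<^sup>2) = (\<Sum>x\<in>ZN N. (norm (blk x x (?U * ?w - ?w * ?U)))\<^sup>2)"
    proof (intro sum.cong refl)
      fix x assume x: "x \<in> ZN N"
      have "blk x x (?w * ?U) = (\<Sum>c\<in>ZN N. if c = x then w0 * \<sigma> x else 0)"
        unfolding blk_times[OF sw R] by (intro sum.cong refl) (auto simp: blk_controlled blk_rgt w0)
      then have "blk x x (?U * ?w - ?w * ?U) = \<sigma> x * w0 - w0 * \<sigma> x"
        using x by (simp add: blk_controlled_times blk_rgt w0)
      then show "(norm (\<sigma> x * w0 - w0 * \<sigma> x))\<^sup>2 = (norm (blk x x (?U * ?w - ?w * ?U)))\<^sup>2" by simp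
    qed
    also have "\<dots> \<le> (norm (?U * ?w - ?w * ?U))\<^sup>2"
      unfolding norm_sq_blk[OF supported_diff[OF supported_times[OF supported_controlled sw] supported_times[OF sw supported_controlled]] R]
      by (intro sum_mono member_le_sum) auto
    finally show ?thesis .
  qed
  ultimately have sig: "(\<Sum>x\<in>ZN N. (norm (\<sigma> x * w0 - w0 * \<sigma> x))\<^sup>2) \<le> (221 * \<gamma>)\<^sup>2" by simp
  let ?W = "rgt {..<4::nat} ?S ?w"
  have sW: "supported (side_index N R) ?W" using S by (intro supported_rgt) auto
  \<comment> \<open>Each of the 16 blocks is off by at most \<gamma> + 110 \<gamma>, and 444 = 4 *
    111.\<close>
  have V_near: "norm (V - ?W) \<le> 444 * \<gamma>"
  proof (rule power2_le_imp_le)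
    have "norm (blk a b (V - ?W)) \<le> 111 * \<gamma>" if "a < 4" "b < 4" for a b
    proof (cases "a = b")
      case True
      have "blk a b (V - ?W) = (v b b - w) + (w - ?w)"
        using that True sw by (simp add: blk_rgt v_def)
      also have "norm \<dots> \<le> \<gamma> + 110 * \<gamma>" using diag that w_near by (intro norm_triangle_mono) auto
      finally show ?thesis by simp
    next
      case False
      then have "blk a b (V - ?W) = v a b" using sw by (simp add: blk_rgt v_def)
      then show ?thesis using off[OF False that] \<alpha> by simp
    qed
    then have "(norm (V - ?W))\<^sup>2 \<le> (\<Sum>a<4::nat. \<Sum>b<4::nat. (111 * \<gamma>)\<^sup>2)"
      unfolding norm_sq_blk[OF supported_diff[OF V sW] S] by (intro sum_mono power_mono) auto
    also have "\<dots> = (444 * \<gamma>)\<^sup>2" by (simp add: power_mult_distrib)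
    finally show "(norm (V - ?W))\<^sup>2 \<le> (444 * \<gamma>)\<^sup>2" .
  qed (simp add: \<alpha>)
  let ?s = "\<lambda>x. rgt {..<4::nat} ?S (rgt (ZN N) R (\<sigma> x))"
  have s1: "supported ?S (rgt (ZN N) R h)" for h using R by (intro supported_rgt) auto
  have each: "(norm (?s x * V - V * ?s x))\<^sup>2 \<le> 8 * real N * (norm (\<sigma> x * w0 - w0 * \<sigma> x))\<^sup>2 + 2 * (888 * \<gamma>)\<^sup>2" for x
  proof -
    have fin: "finite (ZN N)" "finite {..<4::nat}" by auto
    have "star (?s x) * ?s x = rgt {..<4} ?S (rgt (ZN N) R (star (\<sigma> x) * \<sigma> x))"
      using \<sigma>(1) s1 fin by (simp add: rgt_star[symmetric] rgt_times supported_star)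
    also have "\<dots> = idm (side_index N R)"
      unfolding \<sigma>(2,3) using R S fin by (simp add: rgt_idm)
    finally have cs: "contr (?s x)" by (rule contr_isometry[OF finite_side_index])
    have W: "?s x * ?W - ?W * ?s x = rgt {..<4} ?S (rgt (ZN N) R (\<sigma> x * w0 - w0 * \<sigma> x))"
      using \<sigma>(1) w0 s1 fin by (simp add: rgt_times rgt_diff supported_times)
    \<comment> \<open>The identity on the other factors contributes 4 N to the squared norm. This
      \<open>N\<close> is also the number of sites, so the lemma bounds an average over the sites by
      a constant.\<close>
    have nW: "(norm (?s x * ?W - ?W * ?s x))\<^sup>2 = 4 * real N * (norm (\<sigma> x * w0 - w0 * \<sigma> x))\<^sup>2"
      unfolding W using \<sigma>(1) w0 s1 fin by (simp add: norm_rgt supported_intros)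
    have "?s x * V - V * ?s x = (?s x * ?W - ?W * ?s x) - ((V - ?W) * ?s x - ?s x * (V - ?W))"
      by (simp add: algebra_simps)
    then have "norm (?s x * V - V * ?s x) \<le> norm (?s x * ?W - ?W * ?s x) + norm ((V - ?W) * ?s x - ?s x * (V - ?W))"
      by (simp only: norm_triangle_ineq4)
    also have "\<dots> \<le> norm (?s x * ?W - ?W * ?s x) + 888 * \<gamma>"
      using norm_comm_le[OF cs, of "V - ?W"] V_near by simp
    finally have "(norm (?s x * V - V * ?s x))\<^sup>2 \<le> (norm (?s x * ?W - ?W * ?s x) + 888 * \<gamma>)\<^sup>2"
      by (intro power_mono) auto
    also have "\<dots> \<le> 2 * (norm (?s x * ?W - ?W * ?s x))\<^sup>2 + 2 * (888 * \<gamma>)\<^sup>2"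
      by (smt (verit) sum_squares_bound power2_sum)
    finally show ?thesis unfolding nW by simp
  qed
  have "(\<Sum>x\<in>ZN N. (norm (?s x * V - V * ?s x))\<^sup>2) \<le> (\<Sum>x\<in>ZN N. 8 * real N * (norm (\<sigma> x * w0 - w0 * \<sigma> x))\<^sup>2 + 2 * (888 * \<gamma>)\<^sup>2)"
    by (intro sum_mono each)
  also have "\<dots> = 8 * real N * (\<Sum>x\<in>ZN N. (norm (\<sigma> x * w0 - w0 * \<sigma> x))\<^sup>2) + real N * (2 * (888 * \<gamma>)\<^sup>2)"
    by (simp add: sum.distrib sum_distrib_left)
  also have "\<dots> \<le> 8 * real N * (221 * \<gamma>)\<^sup>2 + real N * (2 * (888 * \<gamma>)\<^sup>2)"
    using sig by (intro add_right_mono mult_left_mono) auto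
  \<comment> \<open>8 * 221^2 + 2 * 888^2 = 1967816 is below 1403^2 = 1968409.\<close>
  also have "\<dots> \<le> real N * (1403 * \<gamma>)\<^sup>2" by (simp add: power_mult_distrib)
  finally show ?thesis .
qed

text \<open>68747 = 1403 * 49: by \<open>side_parts_le\<close>, \<gamma> is at most (1 + 6) * 7/2 =
  49/2 times the sum of the two commutator norms.\<close>

lemma side_gap:
  assumes V: "supported (side_index N R) V"
  shows "(\<Sum>x\<in>ZN N. (norm (rgt {..<4} (ZN N \<times> R) (rgt (ZN N) R (\<sigma> x)) * V
      - V * rgt {..<4} (ZN N \<times> R) (rgt (ZN N) R (\<sigma> x))))\<^sup>2)
    \<le> real N * 68747\<^sup>2 * ((norm (side N R \<sigma> * V - V * side N R \<sigma>))\<^sup>2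
      + (norm (star (side N R \<sigma>) * V - V * star (side N R \<sigma>)))\<^sup>2)"
proof -
  define p where "p = norm (side N R \<sigma> * V - V * side N R \<sigma>)"
  define q where "q = norm (star (side N R \<sigma>) * V - V * star (side N R \<sigma>))"
  define \<gamma> where "\<gamma> = norm (side_K N R \<sigma> * V - V * side_K N R \<sigma>) + 6 * norm (side_H N R * V - V * side_H N R)"
  have "\<gamma> \<le> 49/2 * (p + q)" using side_parts_le[OF V] by (simp add: \<gamma>_def p_def q_def)
  then have "\<gamma>\<^sup>2 \<le> (49/2 * (p + q))\<^sup>2" by (intro power_mono) (auto simp: \<gamma>_def)
  also have "\<dots> = (49/2)\<^sup>2 * (p + q)\<^sup>2" by (simp only: power_mult_distrib)
  also have "\<dots> \<le> (49/2)\<^sup>2 * (2 * p\<^sup>2 + 2 * q\<^sup>2)"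
    by (intro mult_left_mono) (smt (verit) sum_squares_bound power2_sum, simp)
  also have "\<dots> = 49\<^sup>2 * (p\<^sup>2 + q\<^sup>2) / 2" by (simp add: power_divide field_simps)
  also have "\<dots> \<le> 49\<^sup>2 * (p\<^sup>2 + q\<^sup>2)" by simp
  finally have "real N * (1403 * \<gamma>)\<^sup>2 \<le> real N * (1403\<^sup>2 * (49\<^sup>2 * (p\<^sup>2 + q\<^sup>2)))"
    unfolding power_mult_distrib by (intro mult_left_mono) auto
  also have "\<dots> = real N * 68747\<^sup>2 * (p\<^sup>2 + q\<^sup>2)" by simp
  finally show ?thesis
    using side_gap_aux[OF V] unfolding \<gamma>_def[symmetric] p_def[symmetric] q_def[symmetric]
    by (rule order_trans[rotated])
qed

end

section \<open>The matrices A and B\<close>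

text \<open>Block and control coordinate of the first side, the same for the second side, and the
  spins.\<close>

type_synonym 's idx = "nat \<times> int \<times> nat \<times> int \<times> 's"

definition swp :: "'s idx \<Rightarrow> 's idx" where
  "swp = (\<lambda>(a, x, b, y, s). (b, y, a, x, s))"

lemma swp_simp [simp]: "swp (a, x, b, y, s) = (b, y, a, x, s)"
  by (simp add: swp_def)

lemma swp_swp [simp]: "swp (swp p) = p"
  by (cases p) simp

lemma inj_swp: "inj_on swp S"
  by (rule inj_on_inverseI[of _ swp]) simp

text \<open>Conjugation by the permutation that exchanges the sides. \<open>matB\<close> is built
  like \<open>matA\<close> and carried over by it, so that estimates are proved for one side
  only.\<close>

lift_definition relabel :: "'s idx fmat \<Rightarrow> 's idx fmat" is "\<lambda>f x y. f (swp x) (swp y)"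
proof -
  fix f :: "'s idx \<Rightarrow> 's idx \<Rightarrow> complex"
  assume "\<exists>S. finite S \<and> (\<forall>x y. f x y \<noteq> 0 \<longrightarrow> x \<in> S \<and> y \<in> S)"
  then obtain S where S: "finite S" "\<forall>x y. f x y \<noteq> 0 \<longrightarrow> x \<in> S \<and> y \<in> S" by (elim exE conjE)
  have "x \<in> swp ` S \<and> y \<in> swp ` S" if "f (swp x) (swp y) \<noteq> 0" for x y
    using S(2)[rule_format, OF that] by (metis imageI swp_swp)
  then show "\<exists>S. finite S \<and> (\<forall>x y. f (swp x) (swp y) \<noteq> 0 \<longrightarrow> x \<in> S \<and> y \<in> S)"
    using S(1) by (intro exI[of _ "swp ` S"]) (simp del: split_paired_All)
qed

lemma ent_relabel [simp]: "ent (relabel V) x y = ent V (swp x) (swp y)"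
  by transfer simp

lemma relabel_simps [simp]:
  "relabel (relabel V) = V" "relabel (V + W) = relabel V + relabel W" "relabel (V - W) = relabel V - relabel W"
  "relabel (star V) = star (relabel V)"
  by (rule fmat_eqI; simp)+

lemma supported_relabel: "supported S V \<Longrightarrow> swp ` S = T \<Longrightarrow> supported T (relabel V)"
  unfolding supported_def by (metis ent_relabel finite_imageI imageI swp_swp)

lemma relabel_times: "relabel (V * W) = relabel V * relabel W"
proof (rule fmat_eqI)
  fix x y
  obtain S where S: "supported S V" using ex_supported by blast
  have "ent (relabel V * relabel W) x y = (\<Sum>z\<in>swp ` S. ent V (swp x) (swp z) * ent W (swp z) (swp y))"
    by (simp add: ent_times[OF supported_relabel[OF S refl]])
  also have "\<dots> = (\<Sum>z\<in>S. ent V (swp x) z * ent W z (swp y))"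
    by (subst sum.reindex[OF inj_swp]) simp
  finally show "ent (relabel (V * W)) x y = ent (relabel V * relabel W) x y"
    by (simp add: ent_times[OF S])
qed

lemma norm_relabel: "norm (relabel V) = norm V"
proof -
  obtain S where S: "supported S V" using ex_supported by blast
  have "(norm (relabel V))\<^sup>2 = (norm V)\<^sup>2"
    unfolding norm_fmat_sq[OF S] norm_fmat_sq[OF supported_relabel[OF S refl]]
    by (simp add: sum.reindex[OF inj_swp])
  then show ?thesis by simp
qed

text \<open>A spin configuration is the set of sites whose spin is down. For \<open>x\<close> outside the sites
  \<open>flip N x\<close> is the identity, so that \<open>sx N x\<close> is unitary for every \<open>x\<close>.\<close>

definition flip :: "nat \<Rightarrow> int \<Rightarrow> int set \<Rightarrow> int set" where
  "flip N x s = (if x \<in> ZN N then (if x \<in> s then s - {x} else insert x s) else s)"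

abbreviation spins :: "nat \<Rightarrow> int set set" where "spins N \<equiv> Pow (ZN N)"

definition sx :: "nat \<Rightarrow> int \<Rightarrow> int set fmat" where
  "sx N x = mk (spins N) (\<lambda>s t. if t = flip N x s then 1 else 0)"

definition sz :: "nat \<Rightarrow> int \<Rightarrow> int set fmat" where
  "sz N x = dg (spins N) (\<lambda>s. if x \<in> s then - 1 else 1)"

lemma flip_flip [simp]: "flip N x (flip N x s) = s"
  by (auto simp: flip_def)

lemma flip_spins [simp]: "flip N x s \<in> spins N \<longleftrightarrow> s \<in> spins N"
  by (auto simp: flip_def split: if_splits)

lemma mem_flip: "x \<in> ZN N \<Longrightarrow> y \<in> flip N x s \<longleftrightarrow> (if y = x then y \<notin> s else y \<in> s)"
  by (auto simp: flip_def)

lemma supported_spin: "supported (spins N) (sx N x)" "supported (spins N) (sz N x)"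
  unfolding sx_def sz_def by (auto intro!: supported_mk supported_dg)

lemma ent_sx: "ent (sx N x) s t = (if s \<in> spins N \<and> t = flip N x s then 1 else 0)"
  using flip_spins[of N x s] unfolding sx_def by (subst ent_mk) auto

lemma ent_sx_times: "s \<in> spins N \<Longrightarrow> ent (sx N x * W) s t = ent W (flip N x s) t"
proof -
  assume s: "s \<in> spins N"
  have "ent (sx N x * W) s t = (\<Sum>u\<in>spins N. if u = flip N x s then ent W u t else 0)"
    unfolding ent_times[OF supported_spin(1)] using s by (intro sum.cong refl) (auto simp: ent_sx)
  also have "\<dots> = ent W (flip N x s) t"
    using s flip_spins[of N x s] by (subst sum.delta) auto
  finally show ?thesis .
qed

lemma sx_props: "star (sx N x) = sx N x" "sx N x * sx N x = idm (spins N)"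
proof -
  show "star (sx N x) = sx N x"
  proof (rule fmat_eqI)
    fix s t
    have "t \<in> spins N \<and> s = flip N x t \<longleftrightarrow> s \<in> spins N \<and> t = flip N x s"
      using flip_flip[of N x] flip_spins[of N x] by metis
    then show "ent (star (sx N x)) s t = ent (sx N x) s t" by (simp add: ent_sx)
  qed
  show "sx N x * sx N x = idm (spins N)"
  proof (rule supported_eqI[of "spins N"])
    fix s t assume st: "s \<in> spins N" "t \<in> spins N"
    then show "ent (sx N x * sx N x) s t = ent (idm (spins N)) s t"
      using flip_spins[of N x s] by (auto simp: ent_sx_times ent_sx ent_dg)
  qed (auto intro!: supported_times supported_spin supported_dg)
qed

lemma sz_props: "star (sz N x) = sz N x" "sz N x * sz N x = idm (spins N)"
  unfolding sz_def by (rule fmat_eqI; auto simp: ent_dg ent_dg_times)+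

lemma spin_anticommute: "x \<in> ZN N \<Longrightarrow> sx N x * sz N x = - (sz N x * sx N x)"
proof (rule supported_eqI[of "spins N"])
  fix s t assume x: "x \<in> ZN N" and st: "s \<in> spins N" "t \<in> spins N"
  show "ent (sx N x * sz N x) s t = ent (- (sz N x * sx N x)) s t"
    using st mem_flip[OF x, of x s] unfolding sz_def
    by (auto simp: ent_times_dg ent_dg_times ent_sx)
qed (auto intro!: supported_times supported_spin supported_uminus)

section \<open>Extending spin matrices and splitting off the spin part\<close>

abbreviation rest :: "nat \<Rightarrow> (nat \<times> int \<times> int set) set" where
  "rest N \<equiv> {..<4} \<times> ZN N \<times> spins N"

abbreviation full :: "nat \<Rightarrow> int set idx set" where
  "full N \<equiv> side_index N (rest N)"

definition ext :: "nat \<Rightarrow> 'r set \<Rightarrow> 'r fmat \<Rightarrow> (nat \<times> int \<times> 'r) fmat" where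
  "ext N R h = rgt {..<4} (ZN N \<times> R) (rgt (ZN N) R h)"

lemma supported_ext: "finite R \<Longrightarrow> supported (side_index N R) (ext N R h)"
  unfolding ext_def by (intro supported_rgt) auto

lemma ent_ext: "finite R \<Longrightarrow> supported R h \<Longrightarrow>
  ent (ext N R h) (a, x, r) (b, y, r') = (if a = b \<and> x = y \<and> a < 4 \<and> x \<in> ZN N then ent h r r' else 0)"
  unfolding ext_def rgt_def asm_def by (auto simp: ent_mk ent_outside)

lemma ext_times:
  assumes "finite R" "supported R g" "supported R h"
  shows "ext N R g * ext N R h = ext N R (g * h)"
  unfolding ext_def using assms by (simp add: rgt_times supported_rgt)

lemma ext_star: "finite R \<Longrightarrow> supported R h \<Longrightarrow> star (ext N R h) = ext N R (star h)"
  unfolding ext_def by (simp add: rgt_star supported_rgt)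

lemma ext_idm: "finite R \<Longrightarrow> ext N R (idm R) = idm (side_index N R)"
  unfolding ext_def by (simp add: rgt_idm)

lemma ext_uminus: "finite R \<Longrightarrow> supported R h \<Longrightarrow> ext N R (- h) = - ext N R h"
  by (rule fmat_eqI) (auto simp: ent_ext supported_uminus split_paired_all)

text \<open>A matrix acting on the spins alone does not see which side comes first, so after the
  swap the gap for \<open>matB\<close> still concerns the same spin matrices.\<close>

lemma relabel_ext:
  fixes h :: "'s fmat"
  assumes S: "finite S" and h: "supported S h"
  shows "relabel (ext N ({..<4} \<times> ZN N \<times> S) (ext N S h)) = ext N ({..<4} \<times> ZN N \<times> S) (ext N S h)"
proof (rule fmat_eqI)
  fix p q :: "'s idx"
  show "ent (relabel (ext N ({..<4} \<times> ZN N \<times> S) (ext N S h))) p q = ent (ext N ({..<4} \<times> ZN N \<times> S) (ext N S h)) p q"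
    using S h supported_ext[OF S] by (cases p; cases q) (auto simp: ent_ext)
qed

text \<open>Entries of \<open>side\<close> without its \<open>controlled\<close> block, that is, of
  the part that acts as the identity on \<open>R\<close>; the missing block returns in
  \<open>ent_side\<close>.\<close>

definition side_loc :: "nat \<Rightarrow> nat \<Rightarrow> int \<Rightarrow> nat \<Rightarrow> int \<Rightarrow> complex" where
  "side_loc N a x b y = (1/7) * ((if a = b \<and> x = y then of_nat a else 0) + \<i> *
    (if a = 0 \<and> b = 0 then 0 else if a = 0 \<or> b = 0 then (if x = y then 1 else 0)
     else if a = 1 \<and> b = 2 then gX N x y else if a = 1 \<and> b = 3 then gD N x y
     else if a = 2 \<and> b = 3 then gF N x y
     else if b = 1 \<and> a = 2 then cnj (gX N y x) else if b = 1 \<and> a = 3 then cnj (gD N y x)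
     else if b = 2 \<and> a = 3 then cnj (gF N y x) else 0))"

lemma ent_side:
  assumes R: "finite R" and \<sigma>: "\<And>x. supported R (\<sigma> x)"
    and p: "(a, x, r) \<in> side_index N R" "(b, y, r') \<in> side_index N R"
  shows "ent (side N R \<sigma>) (a, x, r) (b, y, r') = (if r = r' then side_loc N a x b y else 0)
    + (if a = 0 \<and> b = 0 \<and> x = y then \<i> / 7 * ent (\<sigma> x) r r' else 0)"
proof -
  have fin: "finite (side_index N R)" "finite (ZN N \<times> R)" "finite (ZN N)" using R by auto
  have K: "ent (side_K N R \<sigma>) (a, x, r) (b, y, r') = ent (side_block N R \<sigma> a b) (x, r) (y, r')"
    using p unfolding side_K_def asm_def by (subst ent_mk) (use fin in auto)
  have U: "ent (controlled N R \<sigma>) (x, r) (y, r') = (if x = y then ent (\<sigma> x) r r' else 0)"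
    using p unfolding controlled_def asm_def by (subst ent_mk) (use R in auto)
  have H: "ent (side_H N R) (a, x, r) (b, y, r') = (if a = b \<and> x = y \<and> r = r' then of_nat a else 0)"
    using p unfolding side_H_def by (subst ent_dg[OF fin(1)]) auto
  have B: "ent (side_block N R \<sigma> a b) (x, r) (y, r') =
    (if a = 0 \<and> b = 0 then (if x = y then ent (\<sigma> x) r r' else 0)
     else if r = r' then (if a = 0 \<or> b = 0 then (if x = y then 1 else 0)
     else if a = 1 \<and> b = 2 then gX N x y else if a = 1 \<and> b = 3 then gD N x y
     else if a = 2 \<and> b = 3 then gF N x y
     else if b = 1 \<and> a = 2 then cnj (gX N y x) else if b = 1 \<and> a = 3 then cnj (gD N y x)
     else if b = 2 \<and> a = 3 then cnj (gF N y x) else 0) else 0)"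
    using p R fin unfolding side_block_def side_generator_def
    by (simp add: U ent_dg ent_lft)
  have "ent (side N R \<sigma>) (a, x, r) (b, y, r') = (1/7) * (ent (side_H N R) (a, x, r) (b, y, r')
      + \<i> * ent (side_K N R \<sigma>) (a, x, r) (b, y, r'))"
    using p unfolding side_def by (simp add: ent_dg_times[OF fin(1)] scaleR_conv_of_real)
  then show ?thesis unfolding K B H side_loc_def by (auto simp: algebra_simps)
qed

lemma finite_rest: "finite (rest N)"
  by auto

lemma finite_full: "finite (full N)"
  by auto

lemma swp_full: "swp ` full N = full N"
proof
  show "swp ` full N \<subseteq> full N" by auto
  then have "swp ` swp ` full N \<subseteq> swp ` full N" by blast
  then show "full N \<subseteq> swp ` full N" by (simp add: image_image)
qed

lemma supported_relabel_full: "supported (full N) V \<Longrightarrow> supported (full N) (relabel V)"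
  by (rule supported_relabel[OF _ swp_full])

definition matA :: "nat \<Rightarrow> int set idx fmat" where
  "matA N = side N (rest N) (\<lambda>x. ext N (spins N) (sx N x))"

definition matB :: "nat \<Rightarrow> int set idx fmat" where
  "matB N = relabel (side N (rest N) (\<lambda>x. ext N (spins N) (sz N x)))"

lemma ext_spin_props:
  assumes "supported (spins N) h" "star h = h" "h * h = idm (spins N)"
  shows "supported (rest N) (ext N (spins N) h)" "star (ext N (spins N) h) = ext N (spins N) h"
    "ext N (spins N) h * ext N (spins N) h = idm (rest N)"
  using assms by (simp_all add: supported_ext ext_star ext_times ext_idm)

lemmas sx_ext = ext_spin_props[OF supported_spin(1) sx_props]
lemmas sz_ext = ext_spin_props[OF supported_spin(2) sz_props]

text \<open>Entrywise form of p \<otimes> 1 for the splitting of an index into (a, x) and the rest;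
  \<open>second_local\<close> is the form 1 \<otimes> q. The spins belong to the second
  factor.\<close>

definition first_local :: "nat \<Rightarrow> int set idx fmat \<Rightarrow> bool" where
  "first_local N P \<longleftrightarrow> supported (full N) P \<and>
    (\<forall>a x r b y r'. r \<noteq> r' \<longrightarrow> ent P (a, x, r) (b, y, r') = 0) \<and>
    (\<forall>a x b y. \<forall>r\<in>rest N. \<forall>r'\<in>rest N. ent P (a, x, r) (b, y, r) = ent P (a, x, r') (b, y, r'))"

definition second_local :: "nat \<Rightarrow> int set idx fmat \<Rightarrow> bool" where
  "second_local N Q \<longleftrightarrow> supported (full N) Q \<and>
    (\<forall>a x r b y r'. (a, x) \<noteq> (b, y) \<longrightarrow> ent Q (a, x, r) (b, y, r') = 0) \<and>
    (\<forall>r r'. \<forall>a<4. \<forall>b<4. \<forall>x\<in>ZN N. \<forall>y\<in>ZN N. ent Q (a, x, r) (a, x, r') = ent Q (b, y, r) (b, y, r'))"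

lemma second_localI:
  assumes "supported (full N) Q"
    and "\<And>a x r b y r'. (a, x) \<noteq> (b, y) \<Longrightarrow> ent Q (a, x, r) (b, y, r') = 0"
    and "\<And>a x b y r r'. a < 4 \<Longrightarrow> b < 4 \<Longrightarrow> x \<in> ZN N \<Longrightarrow> y \<in> ZN N \<Longrightarrow>
      ent Q (a, x, r) (a, x, r') = ent Q (b, y, r) (b, y, r')"
  shows "second_local N Q"
  unfolding second_local_def using assms(1) by (intro conjI allI ballI impI assms(2,3))

lemma first_localI:
  assumes "supported (full N) P"
    and "\<And>a x r b y r'. r \<noteq> r' \<Longrightarrow> ent P (a, x, r) (b, y, r') = 0"
    and "\<And>a x b y r r'. r \<in> rest N \<Longrightarrow> r' \<in> rest N \<Longrightarrow>
      ent P (a, x, r) (b, y, r) = ent P (a, x, r') (b, y, r')"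
  shows "first_local N P"
  unfolding first_local_def using assms(1) by (intro conjI allI ballI impI assms(2,3))

lemma second_localD:
  assumes "second_local N Q"
  shows "supported (full N) Q" "(a, x) \<noteq> (b, y) \<Longrightarrow> ent Q (a, x, r) (b, y, r') = 0"
    "a < 4 \<Longrightarrow> b < 4 \<Longrightarrow> x \<in> ZN N \<Longrightarrow> y \<in> ZN N \<Longrightarrow> ent Q (a, x, r) (a, x, r') = ent Q (b, y, r) (b, y, r')"
  using assms unfolding second_local_def by blast+

lemma first_localD:
  assumes "first_local N P"
  shows "supported (full N) P" "r \<noteq> r' \<Longrightarrow> ent P (a, x, r) (b, y, r') = 0"
    "r \<in> rest N \<Longrightarrow> r' \<in> rest N \<Longrightarrow> ent P (a, x, r) (b, y, r) = ent P (a, x, r') (b, y, r')"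
  using assms unfolding first_local_def by blast+

lemma second_local_star: "second_local N Q \<Longrightarrow> second_local N (star Q)"
proof (rule second_localI)
  assume Q: "second_local N Q"
  show "supported (full N) (star Q)" by (rule supported_star[OF second_localD(1)[OF Q]])
  show "ent (star Q) (a, x, r) (b, y, r') = 0" if "(a, x) \<noteq> (b, y)" for a x r b y r'
    unfolding ent_star using second_localD(2)[OF Q, of b y a x r' r] that by auto
  show "ent (star Q) (a, x, r) (a, x, r') = ent (star Q) (b, y, r) (b, y, r')"
    if "a < 4" "b < 4" "x \<in> ZN N" "y \<in> ZN N" for a x b y r r'
    unfolding ent_star by (rule arg_cong[OF second_localD(3)[OF Q that]])
qed

lemma first_local_star: "first_local N P \<Longrightarrow> first_local N (star P)"
proof (rule first_localI)
  assume P: "first_local N P"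
  show "supported (full N) (star P)" by (rule supported_star[OF first_localD(1)[OF P]])
  show "ent (star P) (a, x, r) (b, y, r') = 0" if "r \<noteq> r'" for a x r b y r'
    unfolding ent_star using first_localD(2)[OF P, of r' r] that by simp
  show "ent (star P) (a, x, r) (b, y, r) = ent (star P) (a, x, r') (b, y, r')"
    if "r \<in> rest N" "r' \<in> rest N" for a x b y r r'
    unfolding ent_star by (rule arg_cong[OF first_localD(3)[OF P that]])
qed

text \<open>In either order a single intermediate index survives: (b, y, r) in one product and (a,
  x, r') in the other.\<close>

lemma local_commute:
  assumes P: "first_local N P" and Q: "second_local N Q"
  shows "P * Q = Q * P"
proof (rule supported_eqI[of "full N"])
  note sP = first_localD(1)[OF P] and sQ = second_localD(1)[OF Q]
  show "supported (full N) (P * Q)" "supported (full N) (Q * P)"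
    by (rule supported_times[OF sP sQ], rule supported_times[OF sQ sP])
  fix p q assume pq: "p \<in> full N" "q \<in> full N"
  obtain a x r where p: "p = (a, x, r)" by (cases p)
  obtain b y r' where q: "q = (b, y, r')" by (cases q)
  have "ent (P * Q) p q = (\<Sum>w\<in>full N. if w = (b, y, r) then ent P p w * ent Q w q else 0)"
    unfolding ent_times[OF sP]
  proof (intro sum.cong refl)
    fix w :: "int set idx" obtain c z u where w: "w = (c, z, u)" by (cases w)
    show "ent P p w * ent Q w q = (if w = (b, y, r) then ent P p w * ent Q w q else 0)"
      using first_localD(2)[OF P, of r u a x c z] second_localD(2)[OF Q, of c z b y u r']
      unfolding p q w by auto
  qed
  also have "\<dots> = ent P (a, x, r) (b, y, r) * ent Q (b, y, r) (b, y, r')"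
    using pq p q by (subst sum.delta[OF finite_full]) auto
  also have "\<dots> = ent Q (a, x, r) (a, x, r') * ent P (a, x, r') (b, y, r')"
  proof -
    have "ent P (a, x, r) (b, y, r) = ent P (a, x, r') (b, y, r')"
      using pq unfolding p q by (intro first_localD(3)[OF P]) auto
    moreover have "ent Q (b, y, r) (b, y, r') = ent Q (a, x, r) (a, x, r')"
      using pq unfolding p q by (intro second_localD(3)[OF Q]) auto
    ultimately show ?thesis by simp
  qed
  also have "\<dots> = (\<Sum>w\<in>full N. if w = (a, x, r') then ent Q p w * ent P w q else 0)"
    using pq p q by (subst sum.delta[OF finite_full]) auto
  also have "\<dots> = ent (Q * P) p q"
    unfolding ent_times[OF sQ]
  proof (intro sum.cong refl)
    fix w :: "int set idx" obtain c z u where w: "w = (c, z, u)" by (cases w)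
    show "(if w = (a, x, r') then ent Q p w * ent P w q else 0) = ent Q p w * ent P w q"
      using first_localD(2)[OF P, of u r' c z b y] second_localD(2)[OF Q, of a x c z r u]
      unfolding p q w by auto
  qed
  finally show "ent (P * Q) p q = ent (Q * P) p q" .
qed

definition loc_part :: "nat \<Rightarrow> int set idx fmat" where
  "loc_part N = mk (full N) (\<lambda>(a, x, r) (b, y, r'). if r = r' then side_loc N a x b y else 0)"

definition spin_part :: "nat \<Rightarrow> int set idx fmat" where
  "spin_part N = mk (full N) (\<lambda>(a, x, b, y, s) p. if a = 0 \<and> p = (a, x, b, y, flip N x s) then \<i> / 7 else 0)"

text \<open>Diagonal of the controlled block of \<open>matB\<close>: active at b = 0, with the sign
  given by the spin at site \<open>y\<close>.\<close>

definition spin_sign :: "int set idx \<Rightarrow> complex" where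
  "spin_sign = (\<lambda>(a, x, b, y, s). if b = 0 then (if y \<in> s then - (\<i> / 7) else \<i> / 7) else 0)"

lemma matA_decomp: assumes N: "N > 0" shows "matA N = loc_part N + spin_part N"
proof (rule supported_eqI[of "full N"])
  show "supported (full N) (matA N)"
    unfolding matA_def by (rule supported_side[OF N finite_rest sx_ext])
  show "supported (full N) (loc_part N + spin_part N)"
    unfolding loc_part_def spin_part_def by (intro supported_add supported_mk finite_full)
  fix p q assume pq: "p \<in> full N" "q \<in> full N"
  obtain a x b y s where p: "p = (a, x, b, y, s)" by (cases p)
  obtain a' x' b' y' s' where q: "q = (a', x', b', y', s')" by (cases q)
  show "ent (matA N) p q = ent (loc_part N + spin_part N) p q"
    using pq unfolding p q matA_def
    by (subst ent_side[OF finite_rest sx_ext(1)])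
      (auto simp: loc_part_def spin_part_def ent_mk[OF finite_full] ent_ext supported_spin ent_sx)
qed

lemma ent_sz: "ent (sz N x) s t = (if s = t \<and> s \<in> spins N then if x \<in> s then - 1 else 1 else 0)"
  unfolding sz_def by (subst ent_dg) auto

lemma matB_decomp: assumes N: "N > 0" shows "matB N = relabel (loc_part N) + dg (full N) spin_sign"
proof (rule supported_eqI[of "full N"])
  show "supported (full N) (matB N)"
    unfolding matB_def by (rule supported_relabel_full, rule supported_side[OF N finite_rest sz_ext])
  show "supported (full N) (relabel (loc_part N) + dg (full N) spin_sign)"
    unfolding loc_part_def by (intro supported_add supported_relabel_full supported_mk finite_full supported_dg)
  fix p q assume pq: "p \<in> full N" "q \<in> full N"
  obtain a x b y s where p: "p = (a, x, b, y, s)" by (cases p)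
  obtain a' x' b' y' s' where q: "q = (a', x', b', y', s')" by (cases q)
  show "ent (matB N) p q = ent (relabel (loc_part N) + dg (full N) spin_sign) p q"
    using pq unfolding p q matB_def ent_relabel swp_simp
    by (subst ent_side[OF finite_rest sz_ext(1)])
      (auto simp: loc_part_def spin_sign_def ent_mk[OF finite_full] ent_dg[OF finite_full] ent_ext supported_spin
        ent_sz)
qed

lemma locality:
  shows first_local_loc_part: "first_local N (loc_part N)"
    and second_local_relabel: "second_local N (relabel (loc_part N))"
    and second_local_spin_sign: "second_local N (dg (full N) spin_sign)"
    and second_local_spin_part: "second_local N (relabel (spin_part N))"
proof -
  have s: "supported (full N) (loc_part N)" "supported (full N) (spin_part N)"
    unfolding loc_part_def spin_part_def by (intro supported_mk finite_full)+
  show "first_local N (loc_part N)"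
    by (rule first_localI[OF s(1)]) (auto simp: loc_part_def ent_mk[OF finite_full])
  show "second_local N (relabel (loc_part N))"
  proof (rule second_localI[OF supported_relabel_full[OF s(1)]])
    fix a x b y and r r' :: "nat \<times> int \<times> int set"
    obtain c z t where r: "r = (c, z, t)" by (cases r)
    obtain c' z' t' where r': "r' = (c', z', t')" by (cases r')
    show "(a, x) \<noteq> (b, y) \<Longrightarrow> ent (relabel (loc_part N)) (a, x, r) (b, y, r') = 0"
      unfolding r r' by (auto simp: loc_part_def ent_mk[OF finite_full])
    show "a < 4 \<Longrightarrow> b < 4 \<Longrightarrow> x \<in> ZN N \<Longrightarrow> y \<in> ZN N \<Longrightarrow>
      ent (relabel (loc_part N)) (a, x, r) (a, x, r') = ent (relabel (loc_part N)) (b, y, r) (b, y, r')"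
      unfolding r r' by (simp add: loc_part_def ent_mk[OF finite_full])
  qed
  show "second_local N (dg (full N) spin_sign)"
  proof (rule second_localI[OF supported_dg[OF finite_full]])
    fix a x b y and r r' :: "nat \<times> int \<times> int set"
    obtain c z t where r: "r = (c, z, t)" by (cases r)
    show "(a, x) \<noteq> (b, y) \<Longrightarrow> ent (dg (full N) spin_sign) (a, x, r) (b, y, r') = 0"
      by (auto simp: ent_dg[OF finite_full])
    show "a < 4 \<Longrightarrow> b < 4 \<Longrightarrow> x \<in> ZN N \<Longrightarrow> y \<in> ZN N \<Longrightarrow>
      ent (dg (full N) spin_sign) (a, x, r) (a, x, r') = ent (dg (full N) spin_sign) (b, y, r) (b, y, r')"
      unfolding r by (simp add: ent_dg[OF finite_full] spin_sign_def)
  qed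
  show "second_local N (relabel (spin_part N))"
  proof (rule second_localI[OF supported_relabel_full[OF s(2)]])
    fix a x b y and r r' :: "nat \<times> int \<times> int set"
    obtain c z t where r: "r = (c, z, t)" by (cases r)
    obtain c' z' t' where r': "r' = (c', z', t')" by (cases r')
    show "(a, x) \<noteq> (b, y) \<Longrightarrow> ent (relabel (spin_part N)) (a, x, r) (b, y, r') = 0"
      unfolding r r' by (auto simp: spin_part_def ent_mk[OF finite_full])
    show "a < 4 \<Longrightarrow> b < 4 \<Longrightarrow> x \<in> ZN N \<Longrightarrow> y \<in> ZN N \<Longrightarrow>
      ent (relabel (spin_part N)) (a, x, r) (a, x, r') = ent (relabel (spin_part N)) (b, y, r) (b, y, r')"
      unfolding r r' by (simp add: spin_part_def ent_mk[OF finite_full])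
  qed
qed

lemma star_dg_spin_sign: "star (dg (full N) spin_sign) = - dg (full N) spin_sign"
  by (rule fmat_eqI) (auto simp: ent_dg[OF finite_full] spin_sign_def split: prod.splits)

text \<open>All pairs of summands commute except the two spin parts. The diagonal one is
  skew-adjoint, so replacing \<open>matB\<close> by its adjoint only flips the sign.\<close>

lemma commutators:
  assumes N: "N > 0"
  shows "matA N * matB N - matB N * matA N = spin_part N * dg (full N) spin_sign - dg (full N) spin_sign * spin_part N"
  "matA N * star (matB N) - star (matB N) * matA N
    = - (spin_part N * dg (full N) spin_sign - dg (full N) spin_sign * spin_part N)"
proof -
  let ?P = "loc_part N" let ?S = "spin_part N" let ?D = "dg (full N) spin_sign" let ?Q = "relabel ?P"
  have c: "?P * ?Q = ?Q * ?P" "?P * ?D = ?D * ?P" "?P * star ?Q = star ?Q * ?P" "?P * star ?D = star ?D * ?P"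
    by (auto intro!: local_commute locality second_local_star)
  \<comment> \<open>\<open>spin_part N\<close> acts on the first side and the spins, so it is
    second-local only after the swap; its commutation with \<open>?Q\<close> is shown there and
    carried back.\<close>
  have "relabel (?P * relabel ?S) = relabel (relabel ?S * ?P)" "relabel (star ?P * relabel ?S) = relabel (relabel ?S * star ?P)"
    by (auto intro!: arg_cong[of _ _ relabel] local_commute locality first_local_star)
  then have d: "?Q * ?S = ?S * ?Q" "star ?Q * ?S = ?S * star ?Q"
    by (simp_all add: relabel_times)
  show "matA N * matB N - matB N * matA N = ?S * ?D - ?D * ?S"
    unfolding matA_decomp[OF N] matB_decomp[OF N] using c d by (simp add: algebra_simps)
  show "matA N * star (matB N) - star (matB N) * matA N = - (?S * ?D - ?D * ?S)"
    unfolding matA_decomp[OF N] matB_decomp[OF N] star_simps using c d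
    by (simp add: algebra_simps star_dg_spin_sign)
qed

lemma card_full: "card (full N) = 16 * N\<^sup>2 * 2 ^ N"
  by (simp add: card_cartesian_product card_Pow power2_eq_square)

text \<open>Flipping the spin at \<open>x\<close> changes the sign read at \<open>y\<close> only if
  x = y. So only the N * 2^N rows with a = b = 0 and x = y are nonzero, out of 16 N^2 * 2^N, each
  with a single entry of modulus 2/49.\<close>

lemma commutator_norm:
  "(norm (spin_part N * dg (full N) spin_sign - dg (full N) spin_sign * spin_part N))\<^sup>2 \<le> real (N * 2 ^ N)"
  (is "(norm ?C)\<^sup>2 \<le> _")
proof -
  let ?T = "{p \<in> full N. \<exists>x s. p = (0, x, 0, x, s)}"
  have sS: "supported (full N) (spin_part N)" unfolding spin_part_def by (intro supported_mk finite_full)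
  have sC: "supported (full N) ?C" by (intro supported_intros supported_dg finite_full sS)
  have row: "(\<Sum>q\<in>full N. (cmod (ent ?C p q))\<^sup>2) \<le> of_bool (p \<in> ?T)" if p: "p \<in> full N" for p
  proof -
    obtain a x b y s where p': "p = (a, x, b, y, s)" by (cases p)
    have x: "x \<in> ZN N" using p p' by auto
    have "(cmod (ent ?C p q))\<^sup>2 \<le> (if q = (a, x, b, y, flip N x s) then of_bool (p \<in> ?T) else 0)" if q: "q \<in> full N" for q
    proof -
      have e: "ent ?C p q = ent (spin_part N) p q * (spin_sign q - spin_sign p)"
        using p q by (simp add: ent_times_dg[OF finite_full] ent_dg_times[OF finite_full] algebra_simps)
      have S: "ent (spin_part N) p q = (if a = 0 \<and> q = (a, x, b, y, flip N x s) then \<i> / 7 else 0)"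
        using p q unfolding spin_part_def ent_mk[OF finite_full] p' by simp
      show ?thesis
      proof (cases "a = 0 \<and> q = (a, x, b, y, flip N x s) \<and> b = 0 \<and> x = y")
        case True
        have "cmod (ent ?C p q) \<le> 1"
          unfolding e S using True mem_flip[OF x, of x s] by (auto simp: p' spin_sign_def norm_mult)
        then have "(cmod (ent ?C p q))\<^sup>2 \<le> 1" by (simp add: power_le_one)
        then show ?thesis using True p p' by auto
      next
        case False
        then have "ent ?C p q = 0"
          unfolding e S using mem_flip[OF x, of y s] by (auto simp: p' spin_sign_def)
        then show ?thesis by simp
      qed
    qed
    then have "(\<Sum>q\<in>full N. (cmod (ent ?C p q))\<^sup>2) \<le> (\<Sum>q\<in>full N. if q = (a, x, b, y, flip N x s) then of_bool (p \<in> ?T) else 0)"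
      by (intro sum_mono)
    also have "\<dots> \<le> of_bool (p \<in> ?T)" by (subst sum.delta[OF finite_full]) auto
    finally show ?thesis .
  qed
  have "(norm ?C)\<^sup>2 \<le> (\<Sum>p\<in>full N. of_bool (p \<in> ?T))"
    unfolding norm_fmat_sq[OF sC] by (intro sum_mono row)
  also have "\<dots> = real (card ?T)"
    by (subst sum_of_bool_eq) (auto simp: finite_full Int_def)
  also have "?T \<subseteq> (\<lambda>(x, s). (0, x, 0, x, s)) ` (ZN N \<times> spins N)" by auto
  then have "card ?T \<le> card (ZN N \<times> spins N)" by (intro surj_card_le) auto
  then have "card ?T \<le> N * 2 ^ N" by (simp add: card_cartesian_product card_Pow)
  then have "real (card ?T) \<le> real (N * 2 ^ N)" by (simp only: of_nat_le_iff)
  finally show ?thesis .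
qed

section \<open>Transport to matrices\<close>

definition to_mat :: "nat \<Rightarrow> (nat \<Rightarrow> 'i) \<Rightarrow> 'i fmat \<Rightarrow> complex mat" where
  "to_mat d \<phi> V = mat d d (\<lambda>(i, j). ent V (\<phi> i) (\<phi> j))"

context
  fixes d :: nat and \<phi> :: "nat \<Rightarrow> 'i" and I :: "'i set"
  assumes \<phi>: "bij_betw \<phi> {..<d} I"
begin

lemma fin_I: "finite I"
  using \<phi> bij_betw_finite by blast

lemma sum_I: "(\<Sum>i<d. f (\<phi> i)) = (\<Sum>p\<in>I. f p)"
  by (rule sum.reindex_bij_betw[OF \<phi>])

lemma to_mat_diff: "to_mat d \<phi> (V - W) = to_mat d \<phi> V - to_mat d \<phi> W"
  by (rule eq_matI) (auto simp: to_mat_def)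

lemma to_mat_star: "to_mat d \<phi> (star V) = adj (to_mat d \<phi> V)"
  by (rule eq_matI) (auto simp: to_mat_def adj_def)

lemma to_mat_times: "supported I V \<Longrightarrow> to_mat d \<phi> (V * W) = to_mat d \<phi> V * to_mat d \<phi> W"
  by (rule eq_matI)
    (auto simp: to_mat_def scalar_prod_def ent_times sum_I[symmetric] atLeast0LessThan)

lemma to_mat_inj:
  assumes "supported I V" "supported I W" "to_mat d \<phi> V = to_mat d \<phi> W"
  shows "V = W"
proof (rule supported_eqI[OF assms(1,2)])
  fix p q assume "p \<in> I" "q \<in> I"
  then obtain i j where "i < d" "j < d" "p = \<phi> i" "q = \<phi> j"
    using \<phi> unfolding bij_betw_def by blast
  then show "ent V p q = ent W p q"
    using arg_cong[OF assms(3), of "\<lambda>M. M $$ (i, j)"] by (simp add: to_mat_def)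
qed

lemma to_mat_surj:
  assumes "M \<in> carrier_mat d d" shows "\<exists>V. supported I V \<and> to_mat d \<phi> V = M"
proof -
  let ?\<psi> = "the_inv_into {..<d} \<phi>"
  let ?V = "mk I (\<lambda>p q. M $$ (?\<psi> p, ?\<psi> q))"
  have inv: "?\<psi> (\<phi> i) = i" "\<phi> i \<in> I" if "i < d" for i
    using \<phi> that by (auto simp: bij_betw_def the_inv_into_f_f)
  have "to_mat d \<phi> ?V = M"
    by (rule eq_matI) (use assms inv in \<open>auto simp: to_mat_def ent_mk[OF fin_I]\<close>)
  then show ?thesis using supported_mk[OF fin_I] by blast
qed

lemma hs_norm_to_mat: "supported I V \<Longrightarrow> hs_norm (to_mat d \<phi> V) = norm V / sqrt d"
proof -
  assume V: "supported I V"
  have "(\<Sum>i<d. \<Sum>j<d. (cmod (ent V (\<phi> i) (\<phi> j)))\<^sup>2) = (norm V)\<^sup>2"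
  proof -
    have "(\<Sum>i<d. \<Sum>j<d. (cmod (ent V (\<phi> i) (\<phi> j)))\<^sup>2) = (\<Sum>i<d. \<Sum>q\<in>I. (cmod (ent V (\<phi> i) q))\<^sup>2)"
      by (intro sum.cong refl sum_I)
    also have "\<dots> = (\<Sum>p\<in>I. \<Sum>q\<in>I. (cmod (ent V p q))\<^sup>2)" by (rule sum_I)
    finally show ?thesis by (simp only: norm_fmat_sq[OF V])
  qed
  then show ?thesis by (simp add: hs_norm_def to_mat_def real_sqrt_divide)
qed

text \<open>A vector is stored as the column \<open>\<phi> 0\<close> of an otherwise zero matrix
  \<open>Y\<close>, whose Hilbert-Schmidt norm is the norm of the vector.\<close>

lemma op_norm_to_mat_le:
  assumes d: "d > 0" and V: "supported I V" and c: "\<And>Y. supported I Y \<Longrightarrow> norm (V * Y) \<le> norm Y"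
  shows "op_norm (to_mat d \<phi> V) \<le> 1"
  unfolding op_norm_def
proof (rule cSup_least)
  have "vec_norm (0\<^sub>v d) = 0" by (simp add: vec_norm_def)
  then have "0\<^sub>v d \<in> carrier_vec (dim_col (to_mat d \<phi> V)) \<and> vec_norm (0\<^sub>v d) \<le> 1"
    by (simp add: to_mat_def)
  then show "{vec_norm (to_mat d \<phi> V *\<^sub>v x) |x. x \<in> carrier_vec (dim_col (to_mat d \<phi> V)) \<and> vec_norm x \<le> 1} \<noteq> {}"
    by blast
next
  fix z assume "z \<in> {vec_norm (to_mat d \<phi> V *\<^sub>v x) |x. x \<in> carrier_vec (dim_col (to_mat d \<phi> V)) \<and> vec_norm x \<le> 1}"
  then obtain x where x: "x \<in> carrier_vec d" "vec_norm x \<le> 1" and z: "z = vec_norm (to_mat d \<phi> V *\<^sub>v x)"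
    by (auto simp: to_mat_def)
  let ?\<psi> = "the_inv_into {..<d} \<phi>"
  have inv: "?\<psi> (\<phi> i) = i" "\<phi> i \<in> I" if "i < d" for i
    using \<phi> that by (auto simp: bij_betw_def the_inv_into_f_f)
  have inj: "\<phi> i = \<phi> 0 \<longleftrightarrow> i = 0" if "i < d" for i using inv that d by metis
  define Y where "Y = mk I (\<lambda>p q. if q = \<phi> 0 then x $ ?\<psi> p else 0)"
  have Y: "supported I Y" unfolding Y_def by (rule supported_mk[OF fin_I])
  have col: "norm W = sqrt (\<Sum>i<d. (cmod (ent W (\<phi> i) (\<phi> 0)))\<^sup>2)"
    if W: "supported I W" "\<And>p q. q \<noteq> \<phi> 0 \<Longrightarrow> ent W p q = 0" for W
  proof -
    have "(norm W)\<^sup>2 = (\<Sum>p\<in>I. \<Sum>q\<in>I. if q = \<phi> 0 then (cmod (ent W p q))\<^sup>2 else 0)"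
      unfolding norm_fmat_sq[OF W(1)] by (intro sum.cong refl) (auto simp: W(2))
    also have "\<dots> = (\<Sum>p\<in>I. (cmod (ent W p (\<phi> 0)))\<^sup>2)"
      using inv(2)[OF d] fin_I by simp
    also have "\<dots> = (\<Sum>i<d. (cmod (ent W (\<phi> i) (\<phi> 0)))\<^sup>2)" by (rule sum_I[symmetric])
    finally show ?thesis by (metis abs_norm_cancel real_sqrt_abs)
  qed
  have "vec_norm x = norm Y"
    using x by (subst col[OF Y]) (auto simp: Y_def ent_mk[OF fin_I] vec_norm_def inv d)
  moreover have "vec_norm (to_mat d \<phi> V *\<^sub>v x) = norm (V * Y)"
  proof (subst col)
    show "supported I (V * Y)" by (rule supported_times[OF V Y])
    show "ent (V * Y) p q = 0" if "q \<noteq> \<phi> 0" for p q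
    proof -
      have "ent Y w q = 0" for w using that by (simp add: Y_def ent_mk[OF fin_I])
      then show ?thesis by (simp add: ent_times[OF V])
    qed
    have "(to_mat d \<phi> V *\<^sub>v x) $ i = ent (V * Y) (\<phi> i) (\<phi> 0)" if i: "i < d" for i
    proof -
      have "(to_mat d \<phi> V *\<^sub>v x) $ i = (\<Sum>j<d. ent V (\<phi> i) (\<phi> j) * x $ j)"
        using x i by (simp add: to_mat_def scalar_prod_def atLeast0LessThan)
      also have "\<dots> = (\<Sum>j<d. ent V (\<phi> i) (\<phi> j) * ent Y (\<phi> j) (\<phi> 0))"
        by (intro sum.cong refl) (auto simp: Y_def ent_mk[OF fin_I] inv d)
      also have "\<dots> = ent (V * Y) (\<phi> i) (\<phi> 0)"
        unfolding ent_times[OF V] by (rule sum_I)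
      finally show ?thesis .
    qed
    then show "vec_norm (to_mat d \<phi> V *\<^sub>v x) = sqrt (\<Sum>i<d. (cmod (ent (V * Y) (\<phi> i) (\<phi> 0)))\<^sup>2)"
      by (simp add: vec_norm_def to_mat_def)
  qed
  ultimately show "z \<le> 1" using c[OF Y] x z by simp
qed

end

text \<open>The commutator equals 2 S T, and S T is unitary.\<close>

lemma norm_anticommutator:
  assumes S: "supported I S" "star S = S" "S * S = idm I" and T: "supported I T" "star T = T" "T * T = idm I"
    and ST: "S * T = - (T * S)"
  shows "norm (S * T - T * S) = 2 * norm (idm I)"
proof -
  have "T * S = - (S * T)" using ST by simp
  then have "S * T - T * S = 2 *\<^sub>R (S * T)" by (simp add: scaleR_2)
  moreover have "(norm (S * T))\<^sup>2 = (norm (idm I))\<^sup>2"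
  proof -
    have "(norm (S * T))\<^sup>2 = inner T (S * S * T)"
      by (simp only: power2_norm_eq_inner inner_times_left S(2) mult.assoc)
    also have "\<dots> = inner (T * idm I) T" by (simp add: S T)
    also have "\<dots> = inner (idm I) (T * T)" by (simp only: inner_times_left T)
    finally show ?thesis by (simp add: T power2_norm_eq_inner)
  qed
  ultimately show ?thesis by simp
qed

text \<open>The case C = 68747 of \<open>no_commuting_approximants\<close>. The gap for
  \<open>matB\<close> is the gap of \<open>side\<close> applied to the swapped \<open>V\<close>,
  since the swap fixes the extended spin matrices.\<close>

lemma separation:
  assumes N: "N > 0" and A': "supported (full N) A'" and B': "supported (full N) B'"
    and comm: "A' * B' = B' * A'" "A' * star B' = star B' * A'"
  shows "norm (idm (full N)) \<le> 8 * 68747 * (norm (matA N - A') + norm (matB N - B'))"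
proof -
  define e where "e h = ext N (rest N) (ext N (spins N) h)" for h
  have fin: "finite (spins N)" by simp
  have e: "supported (full N) (e h)" "star (e h) = e (star h)" "e h * e k = e (h * k)" "e (- h) = - e h"
    "relabel (e h) = e h" if "supported (spins N) h" "supported (spins N) k" for h k
    unfolding e_def using that finite_rest[of N] supported_ext[OF fin, of N]
    by (simp_all add: supported_ext ext_star ext_times ext_uminus relabel_ext)
  have e1: "e (idm (spins N)) = idm (full N)" unfolding e_def by (simp add: ext_idm finite_rest)
  let ?s = "\<lambda>i. e (sx N (int i))" let ?t = "\<lambda>i. e (sz N (int i))"
  note sx = supported_spin(1)[of N] note sz = supported_spin(2)[of N]
  have s: "supported (full N) (e (sx N x))" "star (e (sx N x)) = e (sx N x)" "e (sx N x) * e (sx N x) = idm (full N)" for x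
    using e[OF sx sx] e1 by (simp_all add: sx_props)
  have t: "supported (full N) (e (sz N x))" "star (e (sz N x)) = e (sz N x)" "e (sz N x) * e (sz N x) = idm (full N)" for x
    using e[OF sz sz] e1 by (simp_all add: sz_props)
  have contr: "contr (e (sx N x))" "contr (e (sz N x))" for x
    using s t by (auto intro!: contr_isometry[OF finite_full])
  have sum_Z: "(\<Sum>x\<in>ZN N. f x) = (\<Sum>i<N. f (int i))" for f :: "int \<Rightarrow> real"
    by (rule sum.reindex_bij_witness[of _ int nat]) auto
  note gap = side_gap[OF N finite_rest, folded ext_def]
  have A: "supported (full N) (matA N)" "supported (full N) (matB N)"
    unfolding matA_def matB_def
    by (rule supported_side[OF N finite_rest sx_ext],
        rule supported_relabel_full[OF supported_side[OF N finite_rest sz_ext]])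
  show ?thesis
  proof (rule no_commuting_approximants[where s = ?s and t = ?t and N = N])
    show "norm (?s i * ?t i - ?t i * ?s i) = 2 * norm (idm (full N))" if "i < N" for i
    proof (rule norm_anticommutator[OF s t])
      have "?s i * ?t i = e (- (sz N (int i) * sx N (int i)))"
        using e(3)[OF sx sz] spin_anticommute[of "int i" N] that by simp
      then show "?s i * ?t i = - (?t i * ?s i)"
        using e(3)[OF sz sx] e(4)[OF supported_times[OF sz sx] sx] by simp
    qed
    show "(\<Sum>i<N. (norm (?s i * V - V * ?s i))\<^sup>2) \<le> real N * 68747\<^sup>2 *
      ((norm (matA N * V - V * matA N))\<^sup>2 + (norm (star (matA N) * V - V * star (matA N)))\<^sup>2)"
      if "supported (full N) V" for V
      using gap[OF sx_ext that] unfolding sum_Z matA_def e_def .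
    show "(\<Sum>i<N. (norm (?t i * V - V * ?t i))\<^sup>2) \<le> real N * 68747\<^sup>2 *
      ((norm (matB N * V - V * matB N))\<^sup>2 + (norm (star (matB N) * V - V * star (matB N)))\<^sup>2)"
      if V: "supported (full N) V" for V
    proof -
      have r: "norm (relabel X * V - V * relabel X) = norm (X * relabel V - relabel V * X)" for X
      proof -
        have "relabel X * V - V * relabel X = relabel (X * relabel V - relabel V * X)"
          by (simp add: relabel_times)
        then show ?thesis by (simp only: norm_relabel)
      qed
      have rt: "norm (?t i * V - V * ?t i) = norm (?t i * relabel V - relabel V * ?t i)" for i
        using r[of "?t i"] e(5)[OF sz sz] by simp
      show ?thesis
        using gap[where \<sigma> = "\<lambda>x. ext N (spins N) (sz N x)", OF sz_ext supported_relabel_full[OF V]]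
        unfolding sum_Z e_def[symmetric] rt[symmetric] matB_def relabel_simps(4)[symmetric] r .
    qed
  qed (use finite_full N A A' B' comm s t contr in auto)
qed

theorem theoremA:
  shows "\<exists>(d :: nat \<Rightarrow> nat) (A :: nat \<Rightarrow> complex mat) (B :: nat \<Rightarrow> complex mat).
    (\<forall>n. d n > 0 \<and> A n \<in> carrier_mat (d n) (d n) \<and> B n \<in> carrier_mat (d n) (d n)) \<and>
    (\<forall>n. op_norm (A n) \<le> 1 \<and> op_norm (B n) \<le> 1) \<and>
    (\<lambda>n. hs_norm (A n * B n - B n * A n)) \<longlonglongrightarrow> 0 \<and>
    (\<lambda>n. hs_norm (A n * adj (B n) - adj (B n) * A n)) \<longlonglongrightarrow> 0 \<and>
    (\<forall>(A' :: nat \<Rightarrow> complex mat) (B' :: nat \<Rightarrow> complex mat).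
       (\<forall>n. A' n \<in> carrier_mat (d n) (d n) \<and> B' n \<in> carrier_mat (d n) (d n) \<and>
            A' n * B' n = B' n * A' n \<and> A' n * adj (B' n) = adj (B' n) * A' n)
       \<longrightarrow> (INF n. hs_norm (A n - A' n) + hs_norm (B n - B' n)) > 0)"
proof -
  \<comment> \<open>\<open>Suc n\<close> keeps the number of sites positive.\<close>
  define F where "F n = full (Suc n)" for n
  define d where "d n = card (F n)" for n
  have "\<exists>f. bij_betw f {..<d n} (F n)" for n
    using ex_bij_betw_nat_finite[of "F n"] unfolding d_def F_def by (simp add: atLeast0LessThan)
  then obtain \<phi> where \<phi>: "\<And>n. bij_betw (\<phi> n) {..<d n} (F n)" by metis
  define A where "A n = to_mat (d n) (\<phi> n) (matA (Suc n))" for n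
  define B where "B n = to_mat (d n) (\<phi> n) (matB (Suc n))" for n
  have d: "d n = 16 * (Suc n)\<^sup>2 * 2 ^ Suc n" for n unfolding d_def F_def by (rule card_full)
  have d0: "d n > 0" for n unfolding d by simp
  have sA: "supported (F n) (matA (Suc n))" "supported (F n) (matB (Suc n))" for n
    unfolding matA_def matB_def F_def
    by (rule supported_side[OF zero_less_Suc finite_rest sx_ext],
        rule supported_relabel_full[OF supported_side[OF zero_less_Suc finite_rest sz_ext]])
  have op: "op_norm (A n) \<le> 1" "op_norm (B n) \<le> 1" for n
  proof -
    show "op_norm (A n) \<le> 1"
      unfolding A_def
    proof (rule op_norm_to_mat_le[OF \<phi> d0 sA(1)])
      fix Y assume "supported (F n) Y"
      then show "norm (matA (Suc n) * Y) \<le> norm Y"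
        unfolding F_def matA_def by (rule side_contractive[OF zero_less_Suc finite_rest sx_ext])
    qed
    show "op_norm (B n) \<le> 1"
      unfolding B_def
    proof (rule op_norm_to_mat_le[OF \<phi> d0 sA(2)])
      fix Y assume Y: "supported (F n) Y"
      have "matB (Suc n) * Y = relabel (side (Suc n) (rest (Suc n)) (\<lambda>x. ext (Suc n) (spins (Suc n)) (sz (Suc n) x)) * relabel Y)"
        by (simp add: matB_def relabel_times)
      then have "norm (matB (Suc n) * Y) \<le> norm (relabel Y)"
        using side_contractive[OF zero_less_Suc finite_rest sz_ext supported_relabel_full] Y
        by (simp add: norm_relabel F_def)
      then show "norm (matB (Suc n) * Y) \<le> norm Y" by (simp add: norm_relabel)
    qed
  qed
  let ?C = "\<lambda>n. spin_part (Suc n) * dg (F n) spin_sign - dg (F n) spin_sign * spin_part (Suc n)"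
  have tm: "to_mat (d n) (\<phi> n) V * to_mat (d n) (\<phi> n) W - to_mat (d n) (\<phi> n) W * to_mat (d n) (\<phi> n) V
      = to_mat (d n) (\<phi> n) (V * W - W * V)" if "supported (F n) V" "supported (F n) W" for n V W
    using to_mat_times[OF \<phi>] to_mat_diff[OF \<phi>] that by metis
  \<comment> \<open>With N = Suc n, the ratio N 2^N / (16 N^2 2^N) is at most 1/N.\<close>
  have small: "norm (?C n) / sqrt (d n) \<le> sqrt (1 / real (Suc n))" for n
  proof -
    have "norm (?C n) \<le> sqrt (real (Suc n * 2 ^ Suc n))"
      using commutator_norm[of "Suc n"] unfolding F_def by (rule real_le_rsqrt)
    then have "norm (?C n) / sqrt (d n) \<le> sqrt (real (Suc n * 2 ^ Suc n)) / sqrt (d n)"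
      by (rule divide_right_mono) simp
    also have "\<dots> = sqrt (real (Suc n * 2 ^ Suc n) / d n)" by (simp only: real_sqrt_divide)
    also have "\<dots> \<le> sqrt (1 / real (Suc n))"
    proof -
      have "m * k * m \<le> 16 * m\<^sup>2 * k" for m k :: nat by (simp add: power2_eq_square)
      then have "real (Suc n * 2 ^ Suc n) * real (Suc n) \<le> 1 * real (d n)"
        unfolding d of_nat_mult[symmetric] mult_1 of_nat_le_iff by this
      moreover have "u / v \<le> 1 / w" if "u * w \<le> 1 * v" "v > 0" "w > 0" for u v w :: real
        using that by (simp add: field_simps)
      ultimately show ?thesis using d0[of n] by (intro real_sqrt_le_mono) simp
    qed
    finally show ?thesis .
  qed
  have lim0: "f \<longlonglongrightarrow> 0" if "\<And>n. f n = norm (?C n) / sqrt (d n)" for f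
  proof (rule tendsto_sandwich[of "\<lambda>_. 0" f _ "\<lambda>n. sqrt (1 / real (Suc n))"])
    have "(\<lambda>n. sqrt (1 / real (Suc n))) \<longlonglongrightarrow> sqrt 0"
      by (intro tendsto_real_sqrt) (use LIMSEQ_inverse_real_of_nat in \<open>simp add: inverse_eq_divide\<close>)
    then show "(\<lambda>n. sqrt (1 / real (Suc n))) \<longlonglongrightarrow> 0" by simp
  qed (use small that in auto)
  have sC: "supported (F n) (?C n)" for n
    unfolding F_def spin_part_def by (intro supported_intros supported_dg supported_mk finite_full)
  have limits: "(\<lambda>n. hs_norm (A n * B n - B n * A n)) \<longlonglongrightarrow> 0"
    "(\<lambda>n. hs_norm (A n * adj (B n) - adj (B n) * A n)) \<longlonglongrightarrow> 0"
  proof -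
    show "(\<lambda>n. hs_norm (A n * B n - B n * A n)) \<longlonglongrightarrow> 0"
    proof (rule lim0)
      fix n
      show "hs_norm (A n * B n - B n * A n) = norm (?C n) / sqrt (d n)"
        unfolding A_def B_def tm[OF sA] commutators(1)[OF zero_less_Suc] F_def[symmetric]
        by (rule hs_norm_to_mat[OF \<phi> sC])
    qed
    show "(\<lambda>n. hs_norm (A n * adj (B n) - adj (B n) * A n)) \<longlonglongrightarrow> 0"
    proof (rule lim0)
      fix n
      have "hs_norm (A n * adj (B n) - adj (B n) * A n) = norm (- ?C n) / sqrt (d n)"
        unfolding A_def B_def to_mat_star[OF \<phi>, symmetric] tm[OF sA(1) supported_star[OF sA(2)]]
          commutators(2)[OF zero_less_Suc] F_def[symmetric]
        by (rule hs_norm_to_mat[OF \<phi> supported_uminus[OF sC]])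
      then show "hs_norm (A n * adj (B n) - adj (B n) * A n) = norm (?C n) / sqrt (d n)"
        by (simp only: norm_minus_cancel)
    qed
  qed
  have sep: "1 / (8 * 68747) \<le> hs_norm (A n - A') + hs_norm (B n - B')"
    if c: "A' \<in> carrier_mat (d n) (d n)" "B' \<in> carrier_mat (d n) (d n)"
      "A' * B' = B' * A'" "A' * adj B' = adj B' * A'" for n A' B'
  proof -
    obtain V W where V: "supported (F n) V" "to_mat (d n) (\<phi> n) V = A'"
      and W: "supported (F n) W" "to_mat (d n) (\<phi> n) W = B'"
      using to_mat_surj[OF \<phi>] c(1,2) by metis
    have "V * W = W * V"
    proof (rule to_mat_inj[OF \<phi> supported_times[OF V(1) W(1)] supported_times[OF W(1) V(1)]])
      show "to_mat (d n) (\<phi> n) (V * W) = to_mat (d n) (\<phi> n) (W * V)"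
        using c(3) by (simp add: to_mat_times[OF \<phi>] V W)
    qed
    moreover have "V * star W = star W * V"
    proof (rule to_mat_inj[OF \<phi> supported_times[OF V(1) supported_star[OF W(1)]] supported_times[OF supported_star[OF W(1)] V(1)]])
      show "to_mat (d n) (\<phi> n) (V * star W) = to_mat (d n) (\<phi> n) (star W * V)"
        using c(4) by (simp add: to_mat_times[OF \<phi>] to_mat_star[OF \<phi>] V W supported_star)
    qed
    ultimately have "norm (idm (F n)) \<le> 8 * 68747 * (norm (matA (Suc n) - V) + norm (matB (Suc n) - W))"
      unfolding F_def using V(1) W(1) by (intro separation) (auto simp: F_def)
    \<comment> \<open>The unnormalized norm of the identity is \<open>sqrt (d n)\<close>, which
      cancels the normalization of \<open>hs_norm\<close> and leaves a bound independent of
      \<open>n\<close>.\<close>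
    then have le: "sqrt (d n) \<le> 8 * 68747 * (norm (matA (Suc n) - V) + norm (matB (Suc n) - W))"
      using norm_idm[of "F n"] by (simp add: d_def F_def)
    have hs: "hs_norm (A n - A') + hs_norm (B n - B') = (norm (matA (Suc n) - V) + norm (matB (Suc n) - W)) / sqrt (d n)"
      unfolding A_def B_def V(2)[symmetric] W(2)[symmetric] to_mat_diff[OF \<phi>, symmetric]
        hs_norm_to_mat[OF \<phi> supported_diff[OF sA(1) V(1)]] hs_norm_to_mat[OF \<phi> supported_diff[OF sA(2) W(1)]]
      by (simp add: add_divide_distrib)
    have "1 / (8 * 68747) \<le> u / sqrt (d n)" if "sqrt (d n) \<le> 8 * 68747 * u" for u :: real
      using that d0[of n] by (simp add: field_simps)
    from this[OF le] show ?thesis unfolding hs .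
  qed
  show ?thesis
  proof (intro exI conjI allI impI)
    fix A' B' :: "nat \<Rightarrow> complex mat"
    assume "\<forall>n. A' n \<in> carrier_mat (d n) (d n) \<and> B' n \<in> carrier_mat (d n) (d n) \<and>
      A' n * B' n = B' n * A' n \<and> A' n * adj (B' n) = adj (B' n) * A' n"
    then have "1 / (8 * 68747) \<le> (INF n. hs_norm (A n - A' n) + hs_norm (B n - B' n))"
      by (intro cINF_greatest sep) auto
    then show "0 < (INF n. hs_norm (A n - A' n) + hs_norm (B n - B' n))"
      by (rule less_le_trans[rotated]) simp
  qed (use d0 op limits in \<open>auto simp: A_def B_def to_mat_def\<close>)
qed

end
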